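(* Let $k$ be an algebraically closed field of characteristic $p \ge 3$ and let $q \ge 5$ be a power of $p$. Let $C_1 \subset \mathbb{P}^2$ be the plane curve of degree $q$ over $k$ which is the image of the morphism $$\varphi_1: \mathbb{P}^1 \rightarrow \mathbb{P}^2; \quad (s:t) \mapsto \left(s^{\frac{q+1}{2}}t^{\frac{q-1}{2}} : (s-t)t^{q-1} : s^q-st^{q-1}\right).$$ Then: (a) The point $P_1:=(0:1:0)=\varphi_1(0:1)$ is an inner Galois point for $C_1$ with $G_{P_1} \cong D_{q-1}$, where $D_{q-1}$ is the dihedral group of order $q-1$. (b) The point $P_2:=(1:0:0)=\varphi_1(1:1)$ is an inner Galois point for $C_1$ with $G_{P_2} \cong \mathbb{Z}/(q-1)\mathbb{Z}$. (c) The number of inner Galois points for $C_1$ is exactly two.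
   Context: Let $C \subset \mathbb{P}^2$ be an irreducible plane curve over an algebraically closed field $k$, with function field $k(C)$. For a point $P \in \mathbb{P}^2$, let $\pi_P: C \dashrightarrow \mathbb{P}^1$ denote the projection from $P$ (the restriction to $C$ of the linear projection $\mathbb{P}^2 \dashrightarrow \mathbb{P}^1$ with center $P$). The point $P$ is called a Galois point for $C$ if the function field extension $k(C)/\pi_P^*k(\mathbb{P}^1)$ induced by $\pi_P$ is Galois; in that case $G_P$ denotes the Galois group of this extension. A Galois point $P$ is called inner if $P$ is a smooth point of $C$, and outer if $P \in \mathbb{P}^2 \setminus C$. For an even integer $2m$, $D_{2m}$ denotes the dihedral group of order $2m$, i.e. $\langle a,b \mid a^m=b^2=(ab)^2=1\rangle$ (so $D_4$ is the Klein four-group). *)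

theory Defs
  imports
    "HOL-Analysis.Cartesian_Space"
    "HOL-Computational_Algebra.Computational_Algebra"
    "HOL-Algebra.Finite_Extensions"
    "HOL-Algebra.Elementary_Groups"
    "HOL-Algebra.Bij"
begin

section \<open>Projective space\<close>

definition proj_rel :: "(('a::field) ^ 'n) rel" where
  "proj_rel = {(u, v). u \<noteq> 0 \<and> v \<noteq> 0 \<and> (\<exists>c. c \<noteq> 0 \<and> v = c *s u)}"

definition projective_space :: "('a::field ^ 'n) set set" where
  "projective_space = (UNIV - {0}) // proj_rel"

definition point :: "'a::field ^ 'n \<Rightarrow> ('a ^ 'n) set" where
  "point v = proj_rel `` {v}"


section \<open>Ternary forms and plane curves\<close>

text \<open>
  The polynomial ring in the homogeneous coordinates X, Y, Z is the iterated polynomial type, with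
  X the innermost and Z the outermost variable: the coefficient of
  \<open>X ^ i * Y ^ j * Z ^ l\<close> in \<open>F\<close> is \<open>coeff (coeff (coeff F l) j) i\<close>.
\<close>

type_synonym 'a poly3 = "'a poly poly poly"

definition const3 :: "'a::zero \<Rightarrow> 'a poly3" where
  "const3 c = [:[:[:c:]:]:]"

definition eval3 :: "'a::comm_ring_1 poly3 \<Rightarrow> 'a ^ 3 \<Rightarrow> 'a" where
  "eval3 F v = poly (poly (poly F [:[:v $ 3:]:]) [:v $ 2:]) (v $ 1)"

definition is_form :: "nat \<Rightarrow> 'a::zero poly3 \<Rightarrow> bool" where
  "is_form d F \<longleftrightarrow>
     (\<forall>i j l. Polynomial.coeff (Polynomial.coeff (Polynomial.coeff F l) j) i \<noteq> 0 \<longrightarrow> i + j + l = d)"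

definition vanishes_at :: "'a::comm_ring_1 poly3 \<Rightarrow> ('a ^ 3) set \<Rightarrow> bool" where
  "vanishes_at F P \<longleftrightarrow> (\<forall>v\<in>P. eval3 F v = 0)"

definition vanishes_on :: "'a::comm_ring_1 poly3 \<Rightarrow> ('a ^ 3) set set \<Rightarrow> bool" where
  "vanishes_on F C \<longleftrightarrow> (\<forall>P\<in>C. vanishes_at F P)"

definition defining_form :: "nat \<Rightarrow> 'a::field poly3 \<Rightarrow> ('a ^ 3) set set \<Rightarrow> bool" where
  "defining_form d f C \<longleftrightarrow>
     is_form d f \<and> Factorial_Ring.irreducible f \<and> C = {P \<in> projective_space. vanishes_at f P}"

definition irreducible_plane_curve :: "nat \<Rightarrow> ('a::field ^ 3) set set \<Rightarrow> bool" where
  "irreducible_plane_curve d C \<longleftrightarrow> (\<exists>f. defining_form d f C)"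

definition partials :: "'a::field poly3 \<Rightarrow> 'a poly3 set" where
  "partials f = {map_poly (map_poly pderiv) f, map_poly pderiv f, pderiv f}"

definition smooth_point :: "('a::field ^ 3) set set \<Rightarrow> ('a ^ 3) set \<Rightarrow> bool" where
  "smooth_point C P \<longleftrightarrow>
     P \<in> C \<and> (\<exists>d f. defining_form d f C \<and> (\<exists>g\<in>partials f. \<not> vanishes_at g P))"


section \<open>The function field of a plane curve\<close>

text \<open>
  Rational functions on C are quotients \<open>F / G\<close> of forms of equal degree with \<open>G\<close> not vanishing
  identically on C; two of them are equal if \<open>F * G' - F' * G\<close> lies in the ideal of C.
\<close>

definition fractions :: "('a::field ^ 3) set set \<Rightarrow> ('a poly3 \<times> 'a poly3) set" where
  "fractions C = {(F, G). \<exists>d. is_form d F \<and> is_form d G \<and> \<not> vanishes_on G C}"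

definition frac_rel :: "('a::field ^ 3) set set \<Rightarrow> ('a poly3 \<times> 'a poly3) rel" where
  "frac_rel C = {((F, G), (F', G')).
     (F, G) \<in> fractions C \<and> (F', G') \<in> fractions C \<and> vanishes_on (F * G' - F' * G) C}"

definition rat_fun :: "('a::field ^ 3) set set \<Rightarrow> 'a poly3 \<Rightarrow> 'a poly3 \<Rightarrow> ('a poly3 \<times> 'a poly3) set" where
  "rat_fun C F G = frac_rel C `` {(F, G)}"

definition function_field :: "('a::field ^ 3) set set \<Rightarrow> ('a poly3 \<times> 'a poly3) set ring" where
  "function_field C =
     \<lparr>carrier = fractions C // frac_rel C,
      monoid.mult = (\<lambda>x y. \<Union>(F, G)\<in>x. \<Union>(F', G')\<in>y. rat_fun C (F * F') (G * G')),
      one = rat_fun C 1 1,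
      zero = rat_fun C 0 1,
      add = (\<lambda>x y. \<Union>(F, G)\<in>x. \<Union>(F', G')\<in>y. rat_fun C (F * G' + F' * G) (G * G'))\<rparr>"


section \<open>Galois extensions\<close>

context field
begin

definition normal_over :: "'a set \<Rightarrow> bool" where
  "normal_over K \<longleftrightarrow> (\<forall>x\<in>carrier R. splitted (Irr K x))"

text \<open>An algebraic element is separable if it is a simple root of its minimal polynomial.\<close>

definition separable_over :: "'a set \<Rightarrow> bool" where
  "separable_over K \<longleftrightarrow> (\<forall>x\<in>carrier R. alg_mult (Irr K x) x = 1)"

definition galois_over :: "'a set \<Rightarrow> bool" where
  "galois_over K \<longleftrightarrow>
     subfield K R \<and> (\<forall>x\<in>carrier R. (algebraic over K) x) \<and> normal_over K \<and> separable_over K"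

end

definition galois_extension :: "('a, 'b) ring_scheme \<Rightarrow> 'a set \<Rightarrow> bool" where
  "galois_extension L K \<longleftrightarrow> field L \<and> field.galois_over L K"

definition galois_group :: "('a, 'b) ring_scheme \<Rightarrow> 'a set \<Rightarrow> ('a \<Rightarrow> 'a) monoid" where
  "galois_group L K =
     BijGroup (carrier L)
       \<lparr>carrier := {\<sigma> \<in> Bij (carrier L). \<sigma> \<in> ring_hom L L \<and> (\<forall>x\<in>K. \<sigma> x = x)}\<rparr>"


section \<open>Projections and Galois points\<close>

text \<open>
  The projection from P is the rational map \<open>(l : m)\<close>, for linear forms \<open>l\<close>, \<open>m\<close> whose common zero
  locus is the centre P.
\<close>

definition projection_forms :: "('a::field ^ 3) set \<Rightarrow> 'a poly3 \<Rightarrow> 'a poly3 \<Rightarrow> bool" where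
  "projection_forms P l m \<longleftrightarrow>
     is_form 1 l \<and> is_form 1 m \<and>
     {Q \<in> projective_space. vanishes_at l Q \<and> vanishes_at m Q} = {P}"

text \<open>The binary form of degree \<open>d\<close> with coefficients \<open>a 0, \<dots>, a d\<close>, evaluated at \<open>(l, m)\<close>.\<close>

definition binary_form :: "nat \<Rightarrow> (nat \<Rightarrow> 'a::comm_ring_1) \<Rightarrow> 'a poly3 \<Rightarrow> 'a poly3 \<Rightarrow> 'a poly3" where
  "binary_form d a l m = (\<Sum>i\<le>d. const3 (a i) * l ^ i * m ^ (d - i))"

text \<open>
  The pullback of the function field of the projective line along the projection from P. Two
  choices of \<open>(l, m)\<close> differ by an invertible linear substitution, so all of them contribute the
  same subfield to the union.
\<close>

definition projection_subfield ::
    "('a::field ^ 3) set set \<Rightarrow> ('a ^ 3) set \<Rightarrow> ('a poly3 \<times> 'a poly3) set set" where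
  "projection_subfield C P =
     {rat_fun C (binary_form d a l m) (binary_form d b l m) | l m d a b.
        projection_forms P l m \<and> \<not> vanishes_on (binary_form d b l m) C}"

definition galois_point :: "('a::field ^ 3) set set \<Rightarrow> ('a ^ 3) set \<Rightarrow> bool" where
  "galois_point C P \<longleftrightarrow>
     P \<in> projective_space \<and> galois_extension (function_field C) (projection_subfield C P)"

definition inner_galois_point :: "('a::field ^ 3) set set \<Rightarrow> ('a ^ 3) set \<Rightarrow> bool" where
  "inner_galois_point C P \<longleftrightarrow> galois_point C P \<and> smooth_point C P"

definition galois_group_at ::
    "('a::field ^ 3) set set \<Rightarrow> ('a ^ 3) set \<Rightarrow>
     (('a poly3 \<times> 'a poly3) set \<Rightarrow> ('a poly3 \<times> 'a poly3) set) monoid" where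
  "galois_group_at C P = galois_group (function_field C) (projection_subfield C P)"


section \<open>Groups given by generators and relations\<close>

text \<open>In a word, \<open>(g, True)\<close> stands for the generator \<open>g\<close> and \<open>(g, False)\<close> for its inverse.\<close>

inductive word_eq :: "('g \<times> bool) list set \<Rightarrow> ('g \<times> bool) list \<Rightarrow> ('g \<times> bool) list \<Rightarrow> bool"
  for R where
  refl: "word_eq R u u"
| sym: "word_eq R u v \<Longrightarrow> word_eq R v u"
| trans: "word_eq R u v \<Longrightarrow> word_eq R v w \<Longrightarrow> word_eq R u w"
| cancel: "word_eq R (u @ [(g, e), (g, \<not> e)] @ v) (u @ v)"
| relator: "r \<in> R \<Longrightarrow> word_eq R (u @ r @ v) (u @ v)"

definition word_class :: "('g \<times> bool) list set \<Rightarrow> ('g \<times> bool) list \<Rightarrow> ('g \<times> bool) list set" where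
  "word_class R u = {v. word_eq R u v}"

definition presented_group :: "('g \<times> bool) list set \<Rightarrow> ('g \<times> bool) list set monoid" where
  "presented_group R =
     \<lparr>carrier = range (word_class R),
      monoid.mult = (\<lambda>x y. \<Union>u\<in>x. \<Union>v\<in>y. word_class R (u @ v)),
      one = word_class R []\<rparr>"

datatype dihedral_gen = gen_a | gen_b

text \<open>For even \<open>n\<close>, the dihedral group of order \<open>n\<close> (not of the n-gon).\<close>

definition dihedral_group :: "nat \<Rightarrow> (dihedral_gen \<times> bool) list set monoid" where
  "dihedral_group n =
     (let a = (gen_a, True); b = (gen_b, True)
      in presented_group {replicate (n div 2) a, [b, b], [a, b, a, b]})"


section \<open>The parametrized curve\<close>

definition phi1_vec :: "nat \<Rightarrow> 'a::field ^ 2 \<Rightarrow> 'a ^ 3" where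
  "phi1_vec q v =
     (let s = v $ 1; t = v $ 2
      in vector [s ^ ((q + 1) div 2) * t ^ ((q - 1) div 2),
                 (s - t) * t ^ (q - 1),
                 s ^ q - s * t ^ (q - 1)])"

definition phi1 :: "nat \<Rightarrow> ('a::field ^ 2) set \<Rightarrow> ('a ^ 3) set" where
  "phi1 q S = (\<Union>v\<in>S. point (phi1_vec q v))"

end

theory Submission
  imports Defs "HOL-Algebra.Multiplicative_Group"
begin

text \<open>
  The parametrization is birational, so the function field of the curve is the field \<open>k(T)\<close> of
  rational functions of one variable, and the projection from a point \<open>P\<close> becomes a rational
  function \<open>\<pi>\<close> on the line. The point is Galois if and only if \<open>k(T) / k(\<pi>)\<close> is. Throughout,
  \<open>q = 2 m + 1\<close>.

  The two Galois points are seen in suitable coordinates of the line. With \<open>T = s / t - 1\<close> the projection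
  from \<open>P2\<close> is \<open>\<pi> = T ^ (2 m) - 1\<close>, invariant under \<open>T \<mapsto> \<zeta> T\<close> for \<open>\<zeta> ^ (2 m) = 1\<close>. With \<open>T = t / s\<close>
  the projection from \<open>P1\<close> is \<open>\<pi> = (1 - T ^ (2 m)) / T ^ m\<close>, invariant under \<open>T \<mapsto> a T\<close> for \<open>a ^ m = 1\<close>
  and under \<open>T \<mapsto> b / T\<close> for \<open>b ^ m = -1\<close>; these form a dihedral group of order \<open>2 m\<close>. In both cases
  the number of substitutions is the degree of \<open>\<pi>\<close>, and this forces \<open>k(\<pi>)\<close> to be the whole fixed
  field (\<open>fixed_in_range\<close>); so the extension is Galois and the substitutions are its Galois group.

  That no other point of the curve is Galois is a matter of ramification: in a Galois extension all
  points of the line over the same value of \<open>\<pi>\<close> have the same multiplicity (\<open>ramification_divides\<close>,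
  \<open>galois_point_orders\<close>). The parameter \<open>(1:0)\<close> is mapped to the singular point \<open>(0:0:1)\<close>, through
  which a general line passes with multiplicity \<open>m \<ge> 2\<close>. Projecting from \<open>P = \<phi>(1:c)\<close>, the line
  joining \<open>P\<close> to \<open>(0:0:1)\<close> therefore has \<open>(1:0)\<close> in its fibre with multiplicity \<open>m\<close>. The other
  intersections of this line with the curve are given by the roots of \<open>(1 - T) T ^ m - y\<close>, which are
  simple, except that \<open>-1\<close> may be a double root. Unless \<open>m = 2\<close> and \<open>-1\<close> is a root, they can only be
  parameters of \<open>P\<close> itself, of which there are at most two; but the polynomial has degree \<open>m + 1\<close>
  (\<open>not_galois_general\<close>). The exceptional case and the point \<open>(0:0:1)\<close> are handled by
  exhibiting two different multiplicities in one fibre.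

  An equation of the curve comes from writing \<open>Z = a + b\<close> and \<open>X ^ 2 = - a b\<close>: on the curve one may
  take \<open>a = s ^ q\<close> and \<open>b = - s t ^ (2 m)\<close>, and these satisfy \<open>X (Y + b) ^ m + b ^ (m + 1) = 0\<close>. The product
  of this expression with its conjugate is symmetric in \<open>a\<close> and \<open>b\<close>, and is \<open>X\<close> times a form of
  degree \<open>q\<close> (\<open>curve_form_product\<close>). That form is irreducible because the tangent \<open>Y + Z = 0\<close> at
  \<open>P2\<close> meets the curve in no other point (\<open>irreducible_form_total_flex\<close>).
\<close>

section \<open>Galois extensions of a field with a carrier set\<close>

definition is_subfield :: "'f::Fields.field set \<Rightarrow> bool" where
  "is_subfield K \<longleftrightarrow> 0 \<in> K \<and> 1 \<in> K \<and> (\<forall>x\<in>K. \<forall>y\<in>K. x + y \<in> K \<and> x * y \<in> K) \<and>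
     (\<forall>x\<in>K. - x \<in> K \<and> inverse x \<in> K)"

definition coeffs_in :: "'f::zero set \<Rightarrow> 'f poly \<Rightarrow> bool" where
  "coeffs_in K g \<longleftrightarrow> (\<forall>i. Polynomial.coeff g i \<in> K)"

lemma poly_prod_linear: "poly (\<Prod>z\<leftarrow>zs. [:- z, 1:]) y = (\<Prod>z\<leftarrow>zs. y - z)"
  for y :: "'f::comm_ring_1"
  by (induction zs) (simp_all add: algebra_simps)

lemma degree_prod_linear: "Polynomial.degree (\<Prod>z\<leftarrow>zs. [:- z, 1:]) = length zs"
  for zs :: "'f::Fields.field list"
proof (induction zs)
  case (Cons z zs)
  have "(\<Prod>z\<leftarrow>zs. [:- z, 1:]) \<noteq> 0" by (auto simp: prod_list_zero_iff)
  then show ?case using Cons by (simp add: degree_mult_eq del: mult_pCons_left)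
qed simp

text \<open>
  Galois extensions are defined for fields given by a carrier set, whereas computing in \<open>k(T)\<close> is
  convenient in a type class. An isomorphism \<open>\<psi>\<close> from a field that is a type onto the carrier allows
  minimal polynomials, splitting and multiplicity of roots to be expressed through ordinary
  polynomials.
\<close>

locale field_model =
  fixes L :: "('c, 'd) ring_scheme" (structure) and \<psi> :: "'f::Fields.field \<Rightarrow> 'c"
  assumes inj_model: "inj \<psi>"
    and carrier_model: "carrier L = range \<psi>"
    and model_add: "\<psi> x \<oplus> \<psi> y = \<psi> (x + y)"
    and model_mult: "\<psi> x \<otimes> \<psi> y = \<psi> (x * y)"
    and model_zero: "\<zero> = \<psi> 0"
    and model_one: "\<one> = \<psi> 1"
begin

lemma model_eq [simp]: "\<psi> x = \<psi> y \<longleftrightarrow> x = y"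
  using inj_model by (auto dest: injD)

lemma model_closed [simp]: "\<psi> x \<in> carrier L"
  by (simp add: carrier_model)

lemma carrierE: 
  assumes "x \<in> carrier L" obtains y where "x = \<psi> y"
  using assms by (auto simp: carrier_model)

lemma field_L: "field L"
proof -
  have ab: "abelian_group L"
  proof (rule abelian_groupI)
    fix x assume "x \<in> carrier L"
    then obtain u where "x = \<psi> u" by (rule carrierE)
    then show "\<exists>y\<in>carrier L. y \<oplus> x = \<zero>"
      by (intro bexI[of _ "\<psi> (- u)"]) (simp_all add: model_add model_zero)
  qed (auto elim!: carrierE simp: model_add model_zero algebra_simps)
  have cm: "Group.comm_monoid L"
    by (rule comm_monoidI)
       (auto elim!: carrierE simp: model_mult model_one algebra_simps)
  have cr: "cring L"
    by (rule cringI[OF ab cm])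
       (auto elim!: carrierE simp: model_mult model_add algebra_simps)
  show ?thesis
  proof (rule cring.cring_fieldI2[OF cr])
    show "\<zero> \<noteq> \<one>" by (simp add: model_zero model_one)
    fix a assume a: "a \<in> carrier L" "a \<noteq> \<zero>"
    then obtain x where x: "a = \<psi> x" by (auto elim: carrierE)
    with a have "x \<noteq> 0" by (auto simp: model_zero)
    then show "\<exists>b\<in>carrier L. a \<otimes> b = \<one>"
      by (intro bexI[of _ "\<psi> (inverse x)"]) (auto simp: x model_mult model_one)
  qed
qed

end

sublocale field_model \<subseteq> field L by (rule field_L)

context field_model
begin

lemma model_neg: "\<ominus> \<psi> x = \<psi> (- x)"
  by (rule minus_equality) (auto simp: model_add model_zero)

lemma model_inv: "x \<noteq> 0 \<Longrightarrow> inv (\<psi> x) = \<psi> (inverse x)"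
  by (rule comm_inv_char) (auto simp: model_mult model_one)

lemma model_pow: "\<psi> x [^] (n::nat) = \<psi> (x ^ n)"
  by (induction n) (auto simp: model_one model_mult mult.commute)

lemma model_finsum: "finite A \<Longrightarrow> (\<Oplus>i\<in>A. \<psi> (f i)) = \<psi> (sum f A)"
  by (induction A rule: finite_induct) (auto simp: model_zero model_add)

lemma model_mem [simp]: "\<psi> x \<in> \<psi> ` K \<longleftrightarrow> x \<in> K"
  by auto

lemma subfield_model:
  assumes "is_subfield K" shows "subfield (\<psi> ` K) L"
proof (rule subfieldI')
  show "subring (\<psi> ` K) L"
    using assms by (intro subringI) (auto simp: is_subfield_def model_neg model_mult model_add model_one)
  show "\<And>k. k \<in> \<psi> ` K - {\<zero>} \<Longrightarrow> inv k \<in> \<psi> ` K"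
    using assms by (auto simp: is_subfield_def model_inv model_zero)
qed

text \<open>
  Polynomials over a carrier are lists with the leading coefficient first, the reverse of
  \<^const>\<open>coeffs\<close>.
\<close>

definition lift :: "'f poly \<Rightarrow> 'c list" where
  "lift g = map \<psi> (rev (coeffs g))"

lemma lift_0 [simp]: "lift 0 = []"
  by (simp add: lift_def)

lemma lift_eq_Nil [simp]: "lift g = [] \<longleftrightarrow> g = 0"
  by (simp add: lift_def)

lemma degree_lift [simp]: "length (lift g) - Suc 0 = Polynomial.degree g"
  by (simp add: lift_def degree_eq_length_coeffs)

lemma lead_coeff_lift: "g \<noteq> 0 \<Longrightarrow> lead_coeff (lift g) = \<psi> (Polynomial.lead_coeff g)"
  by (simp add: lift_def list.map_sel(1) hd_rev last_coeffs_eq_coeff_degree)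

lemma coeffs_in_set: "coeffs_in K g \<Longrightarrow> set (coeffs g) \<subseteq> K"
proof
  fix x assume g: "coeffs_in K g" and "x \<in> set (coeffs g)"
  then have "x \<in> range (Polynomial.coeff g)" by (simp add: range_coeff)
  then show "x \<in> K" using g by (auto simp: coeffs_in_def)
qed

lemma lift_closed: "coeffs_in K g \<Longrightarrow> lift g \<in> carrier ((\<psi> ` K)[X])"
  unfolding univ_poly_carrier[symmetric] polynomial_def
  using coeffs_in_set[of K g] lead_coeff_lift[of g]
  by (cases "g = 0") (auto simp: lift_def model_zero)

lemma lift_in_carrier: "lift g \<in> carrier (poly_ring L)"
  using lift_closed[of UNIV g] by (simp add: coeffs_in_def carrier_model)

lemma lift_surj:
  assumes "p \<in> carrier ((\<psi> ` K)[X])" and "0 \<in> K"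
  obtains g where "p = lift g" "coeffs_in K g"
proof -
  from assms(1) have p: "p = [] \<or> (set p \<subseteq> \<psi> ` K \<and> lead_coeff p \<noteq> \<zero>)"
    unfolding univ_poly_carrier[symmetric] polynomial_def .
  define cs where "cs = rev (map (inv_into UNIV \<psi>) p)"
  have pcs: "p = map \<psi> (rev cs)"
  proof -
    have "map (\<psi> \<circ> inv_into UNIV \<psi>) p = p"
      using p by (intro map_idI) (auto intro!: f_inv_into_f)
    then show ?thesis by (simp add: cs_def rev_map)
  qed
  have csK: "set cs \<subseteq> K"
    using p inj_model by (auto simp: cs_def)
  have nt: "no_trailing (HOL.eq 0) cs"
    using p by (cases cs rule: rev_cases) (auto simp: pcs model_zero no_trailing_unfold)
  have "coeffs (Poly cs) = cs"
    using nt by (simp add: strip_while_idem_iff)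
  then have "p = lift (Poly cs)" by (simp add: lift_def pcs)
  moreover have "coeffs_in K (Poly cs)"
    using csK assms(2) by (auto simp: coeffs_in_def nth_default_def)
  ultimately show ?thesis by (rule that)
qed

lemma lift_surj':
  assumes "p \<in> carrier (poly_ring L)"
  obtains g where "p = lift g"
  using lift_surj[of p UNIV] assms by (auto simp: carrier_model)

lemma eval_map: "eval (map \<psi> cs) (\<psi> y) = \<psi> (poly (Poly (rev cs)) y)"
  by (induction cs) (auto simp: model_zero model_mult model_add model_pow Poly_append poly_monom algebra_simps)

lemma eval_lift: "eval (lift g) (\<psi> y) = \<psi> (poly g y)"
  by (simp add: lift_def eval_map)

lemma coeff_map: "coeff (map \<psi> cs) i = \<psi> (Polynomial.coeff (Poly (rev cs)) i)"
  by (induction cs) (auto simp: model_zero Poly_append coeff_monom_mult nth_default_append nth_default_def)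

lemma coeff_lift: "coeff (lift g) i = \<psi> (Polynomial.coeff g i)"
  by (simp add: lift_def coeff_map nth_default_coeffs_eq)

lemma lift_mult: "lift (g * h) = lift g \<otimes>\<^bsub>poly_ring L\<^esub> lift h"
proof -
  interpret UP: domain "poly_ring L"
    using univ_poly_is_domain[OF carrier_is_subring] .
  have pg: "polynomial (carrier L) (lift f)" for f
    using lift_in_carrier univ_poly_carrier by blast
  have s: "set (lift f) \<subseteq> carrier L" for f
    using polynomial_in_carrier[OF carrier_is_subring pg] .
  have "polynomial (carrier L) (lift g \<otimes>\<^bsub>poly_ring L\<^esub> lift h)"
    using UP.m_closed[OF lift_in_carrier lift_in_carrier] univ_poly_carrier by blast
  moreover have "coeff (lift (g * h)) = coeff (lift g \<otimes>\<^bsub>poly_ring L\<^esub> lift h)"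
    unfolding univ_poly_mult poly_mult_coeff[OF s s]
    by (auto simp: coeff_lift model_mult model_finsum coeff_mult)
  ultimately show ?thesis
    using coeff_iff_polynomial_cond[OF pg] by blast
qed

lemma lift_linear: "lift [:- z, 1:] = [\<one>, \<ominus> \<psi> z]"
  by (simp add: lift_def model_neg model_one)

lemma lift_1: "lift 1 = [\<one>]"
  by (simp add: lift_def model_one)

lemma roots_lift_split:
  "roots (lift (\<Prod>z\<leftarrow>zs. [:- z, 1:])) = image_mset \<psi> (mset zs)"
proof (induction zs)
  case Nil
  have "degree [\<one>] = 0" by simp
  then show ?case using lift_in_carrier[of 1] degree_zero_imp_empty_roots[of "[\<one>]"] by (simp add: lift_1)
next
  case (Cons z zs)
  have nz: "(\<Prod>z\<leftarrow>zs. [:- z, 1:]) \<noteq> 0" by (auto simp: prod_list_zero_iff)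
  show ?case
    using poly_mult_degree_one_monic_imp_same_roots[OF model_closed[of z] lift_in_carrier, of "\<Prod>z\<leftarrow>zs. [:- z, 1:]"] nz Cons
    by (simp add: lift_mult lift_linear del: mult_pCons_left)
qed

lemma pdivides_lift: "lift g pdivides lift h \<longleftrightarrow> g dvd h"
proof
  assume "g dvd h"
  then show "lift g pdivides lift h"
    by (auto simp: pdivides_def factor_def lift_mult lift_in_carrier elim!: dvdE)
next
  assume "lift g pdivides lift h"
  then obtain c where c: "c \<in> carrier (poly_ring L)" "lift h = lift g \<otimes>\<^bsub>poly_ring L\<^esub> c"
    by (auto simp: pdivides_def factor_def)
  obtain f where "c = lift f" using c(1) by (rule lift_surj')
  with c(2) have "lift h = lift (g * f)" by (simp add: lift_mult)
  then have "coeff (lift h) i = coeff (lift (g * f)) i" for i by simp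
  then have "h = g * f" by (intro poly_eqI) (simp only: coeff_lift model_eq)
  then show "g dvd h" by simp
qed

text \<open>
  Splitting is defined by counting roots; removing one linear factor at a time turns the count into a
  factorization.
\<close>

lemma splitted_lift_imp:
  assumes "splitted (lift g)" "Polynomial.lead_coeff g = 1"
  shows "\<exists>zs. g = (\<Prod>z\<leftarrow>zs. [:- z, 1:])"
  using assms
proof (induction "Polynomial.degree g" arbitrary: g)
  case 0
  then have "g = 1" by (metis degree0_coeffs coeff_pCons_0 degree_pCons_0 one_pCons)
  then show ?case by (intro exI[of _ "[]"]) simp
next
  case (Suc n)
  have g0: "g \<noteq> 0" using Suc by auto
  have "size (roots (lift g)) = Suc n" using Suc by (simp add: splitted_def)
  then obtain a where "a \<in># roots (lift g)" by (metis Suc_eq_plus1 multiset_nonemptyE size_empty add_is_0 one_neq_zero)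
  then have a: "is_root (lift g) a" using roots_mem_iff_is_root[OF lift_in_carrier] by blast
  then obtain z where z: "a = \<psi> z" by (auto simp: is_root_def elim: carrierE)
  have "poly g z = 0" using a by (auto simp: is_root_def z eval_lift model_zero)
  then obtain h where h: "g = [:- z, 1:] * h" using poly_eq_0_iff_dvd by blast
  have h0: "h \<noteq> 0" using g0 h by auto
  have "Polynomial.degree g = Suc (Polynomial.degree h)" using h0 by (simp add: h degree_mult_eq del: mult_pCons_left)
  moreover have "Polynomial.lead_coeff h = 1" using Suc(4) unfolding h lead_coeff_mult by simp
  moreover have "splitted (lift h)"
    using pdivides_imp_splitted[OF lift_in_carrier lift_in_carrier _ Suc(3), of h] g0
    by (simp add: pdivides_lift) (simp add: h del: mult_pCons_left)
  ultimately obtain zs where "h = (\<Prod>z\<leftarrow>zs. [:- z, 1:])" using Suc by auto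
  then show ?case by (intro exI[of _ "z # zs"]) (simp add: h)
qed

text \<open>
  The minimal polynomial of \<open>y\<close> divides every polynomial over \<open>K\<close> with root \<open>y\<close>. If one of these is a
  product of distinct linear factors, then so is the minimal polynomial, which gives normality and
  separability at once.
\<close>

lemma galois_extensionI:
  assumes K: "is_subfield K"
    and split: "\<And>y. \<exists>Z. finite Z \<and> y \<in> Z \<and> coeffs_in K (\<Prod>z\<in>Z. [:- z, 1:])"
  shows "galois_extension L (\<psi> ` K)"
proof -
  have main: "(algebraic over (\<psi> ` K)) x \<and> splitted (Irr (\<psi> ` K) x) \<and> alg_mult (Irr (\<psi> ` K) x) x = 1"
    if x: "x \<in> carrier L" for x
  proof -
    obtain y where y: "x = \<psi> y" using x by (rule carrierE)
    obtain Z where Z: "finite Z" "y \<in> Z" "coeffs_in K (\<Prod>z\<in>Z. [:- z, 1:])" using split by blast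
    define g where "g = (\<Prod>z\<in>Z. [:- z, 1:])"
    obtain zs where zs: "set zs = Z" "distinct zs" using finite_distinct_list[OF Z(1)] by blast
    have gzs: "g = (\<Prod>z\<leftarrow>zs. [:- z, 1:])"
      unfolding g_def zs(1)[symmetric] by (rule prod.distinct_set_conv_list[OF zs(2)])
    have g0: "g \<noteq> 0" using Z(1) by (simp add: g_def)
    have lg: "lift g \<in> carrier ((\<psi> ` K)[X])" using Z(3) by (intro lift_closed) (simp add: g_def)
    have "poly g y = 0" using Z(1,2) by (auto simp: g_def poly_prod)
    then have ev: "eval (lift g) x = \<zero>" by (simp add: y eval_lift model_zero)
    have alg: "(algebraic over (\<psi> ` K)) x" by (rule algebraicI[OF lg _ ev]) (simp add: g0)
    note I = IrrE[OF subfield_model[OF K] x alg]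
    have dv: "Irr (\<psi> ` K) x pdivides lift g"
      by (rule Irr_minimal[OF subfield_model[OF K] x alg lg ev])
    have Ic: "Irr (\<psi> ` K) x \<in> carrier (poly_ring L)"
      using I(1) subringE(1)[OF subfieldE(1)[OF subfield_model[OF K]]] by (meson carrier_polynomial_shell subfieldE(1) subfield_model K)
    have deg: "size (roots (lift g)) = Polynomial.degree g"
      by (simp add: gzs roots_lift_split degree_prod_linear)
    have spl: "splitted (Irr (\<psi> ` K) x)"
      by (rule pdivides_imp_splitted[OF Ic lift_in_carrier _ _ dv]) (auto simp: g0 splitted_def deg)
    have sub: "roots (Irr (\<psi> ` K) x) \<subseteq># roots (lift g)"
      by (rule pdivides_imp_roots_incl[OF Ic lift_in_carrier _ dv]) (simp add: g0)
    have "count (roots (lift g)) x \<le> 1"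
      using zs(2) inj_model by (simp add: gzs roots_lift_split y mset_map[symmetric] del: mset_map)
         (metis distinct_map distinct_count_atmost_1 inj_on_subset subset_UNIV One_nat_def le_numeral_extra(4) zero_le)
    then have "alg_mult (Irr (\<psi> ` K) x) x \<le> 1"
      using mset_subset_eq_count[OF sub, of x] by (simp add: alg_mult_eq_count_roots[OF Ic])
    moreover have "alg_mult (Irr (\<psi> ` K) x) x > 0"
      unfolding alg_mult_gt_zero_iff_is_root[OF Ic] is_root_def
      using x I(2,4) Ic pirreducibleE(1)[OF subfieldE(1)[OF subfield_model[OF K]] I(1,2)] by auto
    ultimately show ?thesis using alg spl by simp
  qed
  then show ?thesis
    unfolding galois_extension_def galois_over_def normal_over_def separable_over_def
    using field_L subfield_model[OF K] by auto
qed

text \<open>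
  What a Galois extension provides later is that the minimal polynomial of \<open>y\<close> has all its roots
  in the field.
\<close>

lemma galois_extensionD:
  assumes "galois_extension L (\<psi> ` K)" and "is_subfield K"
  obtains zs where "coeffs_in K (\<Prod>z\<leftarrow>zs. [:- z, 1:])" "y \<in> set zs"
    "\<And>g. coeffs_in K g \<Longrightarrow> poly g y = 0 \<Longrightarrow> (\<Prod>z\<leftarrow>zs. [:- z, 1:]) dvd g"
proof -
  note sf = subfield_model[OF assms(2)]
  have alg: "(algebraic over (\<psi> ` K)) (\<psi> y)" and spl: "splitted (Irr (\<psi> ` K) (\<psi> y))"
    using assms(1) unfolding galois_extension_def galois_over_def normal_over_def by auto
  note I = IrrE[OF sf model_closed alg]
  have "0 \<in> K" using assms(2) by (simp add: is_subfield_def)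
  then obtain \<mu> where \<mu>: "Irr (\<psi> ` K) (\<psi> y) = lift \<mu>" "coeffs_in K \<mu>" using I(1) by (blast elim: lift_surj)
  have \<mu>0: "\<mu> \<noteq> 0"
    using I(2) pirreducibleE(1)[OF subfieldE(1)[OF sf] I(1,2)] by (auto simp: \<mu>)
  have "Polynomial.lead_coeff \<mu> = 1"
    using I(3) lead_coeff_lift[OF \<mu>0] by (simp add: \<mu> model_one)
  then obtain zs where zs: "\<mu> = (\<Prod>z\<leftarrow>zs. [:- z, 1:])" using splitted_lift_imp spl \<mu>(1) by auto
  show ?thesis
  proof (rule that[of zs])
    show "coeffs_in K (\<Prod>z\<leftarrow>zs. [:- z, 1:])" using \<mu> zs by simp
    have "poly \<mu> y = 0" using I(4) by (simp add: \<mu> eval_lift model_zero)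
    then show "y \<in> set zs" by (auto simp: zs poly_prod_linear prod_list_zero_iff)
    fix g assume g: "coeffs_in K g" "poly g y = 0"
    have "lift \<mu> pdivides lift g"
      using Irr_minimal[OF sf model_closed alg lift_closed[OF g(1)]] g(2) by (simp add: \<mu> eval_lift model_zero)
    then show "(\<Prod>z\<leftarrow>zs. [:- z, 1:]) dvd g" by (simp add: pdivides_lift zs)
  qed
qed

end

section \<open>Ring homomorphisms between types\<close>

definition unital_hom :: "('r::comm_ring_1 \<Rightarrow> 's::comm_ring_1) \<Rightarrow> bool" where
  "unital_hom f \<longleftrightarrow> f 1 = 1 \<and> (\<forall>x y. f (x + y) = f x + f y) \<and> (\<forall>x y. f (x * y) = f x * f y)"

lemma
  assumes "unital_hom f"
  shows hom_1: "f 1 = 1" and hom_add: "f (x + y) = f x + f y" and hom_mult: "f (x * y) = f x * f y"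
  using assms by (auto simp: unital_hom_def)

context
  fixes f :: "'r::comm_ring_1 \<Rightarrow> 's::comm_ring_1"
  assumes f: "unital_hom f"
begin

lemma hom_0: "f 0 = 0"
  using hom_add[OF f, of 0 0] by simp

lemma hom_uminus: "f (- x) = - f x"
  using hom_add[OF f, of x "- x"] by (simp add: hom_0 eq_neg_iff_add_eq_0 add.commute)

lemma hom_diff: "f (x - y) = f x - f y"
  using hom_add[OF f, of x "- y"] by (simp add: hom_uminus)

lemma hom_power: "f (x ^ n) = f x ^ n"
  by (induction n) (simp_all add: hom_1[OF f] hom_mult[OF f])

lemma hom_sum: "f (sum g A) = (\<Sum>x\<in>A. f (g x))"
  by (induction A rule: infinite_finite_induct) (simp_all add: hom_0 hom_add[OF f])

lemma hom_prod: "f (prod g A) = (\<Prod>x\<in>A. f (g x))"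
  by (induction A rule: infinite_finite_induct) (simp_all add: hom_1[OF f] hom_mult[OF f])

lemma hom_of_nat: "f (of_nat n) = of_nat n"
  by (induction n) (simp_all add: hom_0 hom_add[OF f] hom_1[OF f])

lemma hom_map_poly: "unital_hom (map_poly f)"
  unfolding unital_hom_def
  by (auto intro!: poly_eqI
           simp: hom_1[OF f] coeff_map_poly hom_0 hom_add[OF f] coeff_mult hom_sum hom_mult[OF f])

lemma poly_map_poly_hom: "poly (map_poly f p) (f x) = f (poly p x)"
  by (induction p) (simp_all add: map_poly_pCons hom_0 hom_add[OF f] hom_mult[OF f])

end

lemmas hom_simps = hom_1 hom_0 hom_add hom_mult hom_uminus hom_diff hom_power hom_sum hom_prod hom_of_nat

lemma hom_comp: "unital_hom f \<Longrightarrow> unital_hom g \<Longrightarrow> unital_hom (\<lambda>x. f (g x))"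
  by (simp add: unital_hom_def)

lemma hom_poly: "unital_hom (\<lambda>p. poly p x)"
  by (simp add: unital_hom_def)

context
  fixes f :: "'r::Fields.field \<Rightarrow> 's::Fields.field"
  assumes f: "unital_hom f"
begin

lemma hom_eq_0_iff: "f x = 0 \<longleftrightarrow> x = 0"
  using hom_mult[OF f, of x "inverse x"] by (cases "x = 0") (auto simp: hom_0[OF f] hom_1[OF f])

lemma hom_inj: "inj f"
proof (rule injI)
  fix x y assume "f x = f y"
  then have "f (x - y) = 0" by (simp add: hom_diff[OF f])
  then show "x = y" by (simp add: hom_eq_0_iff)
qed

lemma hom_inverse: "f (inverse x) = inverse (f x)"
proof (cases "x = 0")
  case False
  then have "f x * f (inverse x) = 1" by (simp add: hom_mult[OF f, symmetric] hom_1[OF f])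
  then show ?thesis by (metis inverse_unique)
qed (simp add: hom_0[OF f])

lemma hom_divide: "f (x / y) = f x / f y"
  by (simp add: field_class.field_divide_inverse hom_mult[OF f] hom_inverse)

lemma range_hom_subfield: "is_subfield (range f)"
  unfolding is_subfield_def
proof (intro conjI ballI)
  show "0 \<in> range f" "1 \<in> range f" using hom_0[OF f] hom_1[OF f] by (metis rangeI)+
  fix x y assume "x \<in> range f" "y \<in> range f"
  then obtain u v where uv: "x = f u" "y = f v" by blast
  show "x + y \<in> range f" "x * y \<in> range f"
    unfolding uv hom_add[OF f, symmetric] hom_mult[OF f, symmetric] by simp_all
next
  fix x assume "x \<in> range f"
  then obtain u where u: "x = f u" by blast
  show "- x \<in> range f" "inverse x \<in> range f"
    unfolding u hom_uminus[OF f, symmetric] hom_inverse[symmetric] by simp_all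
qed

end

lemma hom_to_fract: "unital_hom to_fract"
  by (simp add: unital_hom_def)

lemma coeffs_in_range:
  assumes "unital_hom f" and "coeffs_in (range f) g"
  obtains h where "g = map_poly f h"
proof
  let ?i = "\<lambda>y. if y = 0 then 0 else inv_into UNIV f y"
  show "g = map_poly f (map_poly ?i g)"
    using assms(2) by (intro poly_eqI) (auto simp: coeff_map_poly hom_0[OF assms(1)] coeffs_in_def f_inv_into_f)
qed

section \<open>The rational function field\<close>

definition fconst :: "'a::Fields.field \<Rightarrow> 'a poly fract" where
  "fconst c = to_fract [:c:]"

definition fvar :: "'a::Fields.field poly fract" where
  "fvar = to_fract [:0, 1:]"

definition feval :: "'a::Fields.field poly fract \<Rightarrow> 'a poly \<Rightarrow> 'a poly fract" where
  "feval y p = poly (map_poly fconst p) y"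

definition transcendental_fract :: "'a::Fields.field poly fract \<Rightarrow> bool" where
  "transcendental_fract y \<longleftrightarrow> (\<forall>p. feval y p = 0 \<longrightarrow> p = 0)"

text \<open>
  The substitution \<open>T \<mapsto> y\<close> in a rational function. For transcendental \<open>y\<close> no denominator becomes
  zero and the result is independent of the representation as a fraction; only then is the
  description proper.
\<close>

definition fsubst :: "'a::Fields.field poly fract \<Rightarrow> 'a poly fract \<Rightarrow> 'a poly fract" where
  "fsubst y x = (THE z. \<exists>a b. b \<noteq> 0 \<and> x = Fract a b \<and> z = feval y a / feval y b)"

lemma hom_fconst: "unital_hom fconst"
  by (simp add: unital_hom_def fconst_def one_pCons[symmetric] flip: to_fract_add to_fract_mult)

lemma fconst_eq_iff [simp]: "fconst x = fconst y \<longleftrightarrow> x = y"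
  by (simp add: fconst_def)

lemma fconst_0 [simp]: "fconst 0 = 0" and fconst_1 [simp]: "fconst 1 = 1"
  by (simp_all add: hom_0[OF hom_fconst] hom_1[OF hom_fconst])

lemma fconst_eq_0_iff [simp]: "fconst x = 0 \<longleftrightarrow> x = 0"
  by (simp add: fconst_def)

lemma hom_feval: "unital_hom (feval y)"
  unfolding feval_def by (rule hom_comp[OF hom_poly hom_map_poly[OF hom_fconst]])

lemma feval_pCons [simp]: "feval y (pCons c p) = fconst c + y * feval y p"
  by (simp add: feval_def map_poly_pCons)

lemma feval_0 [simp]: "feval y 0 = 0" 
  by (simp add: feval_def)

lemma feval_altdef: "feval y p = (\<Sum>i\<le>Polynomial.degree p. fconst (Polynomial.coeff p i) * y ^ i)"
  by (simp add: feval_def poly_altdef degree_map_poly coeff_map_poly)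

lemma feval_altdef': "Polynomial.degree p \<le> d \<Longrightarrow> feval y p = (\<Sum>i\<le>d. fconst (Polynomial.coeff p i) * y ^ i)"
  unfolding feval_altdef by (rule sum.mono_neutral_left) (auto simp: coeff_eq_0)

lemma feval_monom: "feval y (Polynomial.monom c n) = fconst c * y ^ n"
  by (simp add: feval_def map_poly_monom poly_monom)

lemma feval_fvar: "feval fvar p = to_fract p"
proof (induction p)
  case (pCons c p)
  have "pCons c p = [:c:] + [:0, 1:] * p" by simp
  then have "to_fract (pCons c p) = to_fract [:c:] + to_fract [:0,1:] * to_fract p"
    by (simp only: to_fract_add to_fract_mult)
  then show ?case using pCons by (simp add: fconst_def fvar_def)
qed simp

lemma fract_as_feval: "Fract a b = feval fvar a / feval fvar b"
  by (simp add: feval_fvar Fract_conv_to_fract)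

lemma fsubst_Fract:
  assumes "transcendental_fract y" "b \<noteq> 0"
  shows "fsubst y (Fract a b) = feval y a / feval y b"
  unfolding fsubst_def
proof (rule the_equality)
  fix z assume "\<exists>a' b'. b' \<noteq> 0 \<and> Fract a b = Fract a' b' \<and> z = feval y a' / feval y b'"
  then obtain a' b' where b': "b' \<noteq> 0" "Fract a b = Fract a' b'" "z = feval y a' / feval y b'" by blast
  then have "a * b' = a' * b" using assms by (simp add: eq_fract)
  then have "feval y a * feval y b' = feval y a' * feval y b" by (simp add: hom_mult[OF hom_feval, symmetric])
  moreover have "feval y b \<noteq> 0" "feval y b' \<noteq> 0" using assms b' by (auto simp: transcendental_fract_def)
  ultimately show "z = feval y a / feval y b" by (simp add: b'(3) field_simps)
qed (use assms in blast)

lemma fsubst_to_fract: "transcendental_fract y \<Longrightarrow> fsubst y (to_fract p) = feval y p"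
  using fsubst_Fract[of y 1 p] by (simp add: to_fract_def hom_1[OF hom_feval])

lemma fsubst_fvar [simp]: "transcendental_fract y \<Longrightarrow> fsubst y fvar = y"
  by (simp add: fvar_def fsubst_to_fract)

lemma fsubst_fconst [simp]: "transcendental_fract y \<Longrightarrow> fsubst y (fconst c) = fconst c"
  by (simp add: fconst_def[of c] fsubst_to_fract)

lemma hom_fsubst:
  assumes y: "transcendental_fract y"
  shows "unital_hom (fsubst y)"
proof -
  have nz: "feval y b \<noteq> 0" if "b \<noteq> 0" for b using y that by (auto simp: transcendental_fract_def)
  have "fsubst y (u + v) = fsubst y u + fsubst y v \<and> fsubst y (u * v) = fsubst y u * fsubst y v" for u v
    by (cases u; cases v)
       (simp add: fsubst_Fract[OF y] nz hom_simps[OF hom_feval] field_simps)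
  moreover have "fsubst y 1 = 1" using fsubst_fconst[OF y, of 1] by simp
  ultimately show ?thesis by (simp add: unital_hom_def)
qed

lemma hom_feval_commute:
  assumes "unital_hom f" and "\<And>c. f (fconst c) = fconst c"
  shows "f (feval y p) = feval (f y) p"
  by (induction p) (simp_all add: hom_simps[OF assms(1)] assms(2))

text \<open>
  An endomorphism of \<open>k(T)\<close> over \<open>k\<close> is determined by the image of \<open>T\<close>, which is transcendental since
  homomorphisms of fields are injective. So endomorphisms and substitutions are the same thing.
\<close>

lemma hom_eq_fsubst:
  fixes f :: "'a::Fields.field poly fract \<Rightarrow> 'a poly fract"
  assumes "unital_hom f" and "\<And>c. f (fconst c) = fconst c"
  shows "transcendental_fract (f fvar)" and "f = fsubst (f fvar)"
proof -
  have e: "feval (f fvar) p = f (to_fract p)" for p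
    using hom_feval_commute[OF assms, of fvar p] by (simp add: feval_fvar)
  show t: "transcendental_fract (f fvar)"
    using e hom_eq_0_iff[OF assms(1)] by (simp add: transcendental_fract_def)
  show "f = fsubst (f fvar)"
  proof
    fix x :: "'a poly fract"
    obtain a b where x: "x = Fract a b" "b \<noteq> 0" by (cases x)
    have "f (Fract a b) = f (to_fract a) / f (to_fract b)"
      by (simp only: Fract_conv_to_fract hom_divide[OF assms(1)])
    then show "f x = fsubst (f fvar) x"
      by (simp only: x(1) fsubst_Fract[OF t x(2)] e)
  qed
qed

lemma fsubst_comp:
  assumes "transcendental_fract y" "transcendental_fract z"
  shows "fsubst y (fsubst z x) = fsubst (fsubst y z) x" and "transcendental_fract (fsubst y z)"
proof -
  have h: "unital_hom (\<lambda>x. fsubst y (fsubst z x))"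
    by (rule hom_comp[OF hom_fsubst hom_fsubst]) fact+
  have c: "fsubst y (fsubst z (fconst c)) = fconst c" for c using assms by simp
  show "transcendental_fract (fsubst y z)" using hom_eq_fsubst(1)[OF h c] assms by simp
  show "fsubst y (fsubst z x) = fsubst (fsubst y z) x"
    using fun_cong[OF hom_eq_fsubst(2)[OF h c], of x] assms by simp
qed

lemma transcendental_fvar [simp]: "transcendental_fract fvar"
  by (simp add: transcendental_fract_def feval_fvar)

lemma fsubst_ident [simp]: "fsubst fvar x = x"
  by (cases x) (simp add: fsubst_Fract fract_as_feval[symmetric])

text \<open>
  A polynomial relation for \<open>y\<close> over the algebraically closed field \<open>k\<close> splits into factors \<open>y - c\<close>.
\<close>

lemma transcendental_if_nonconstant:
  fixes y :: "'a::alg_closed_field poly fract"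
  assumes "y \<notin> range fconst" shows "transcendental_fract y"
  unfolding transcendental_fract_def
proof (intro allI impI)
  fix p assume p: "feval y p = 0"
  show "p = 0"
  proof (rule ccontr)
    assume "p \<noteq> 0"
    then obtain A where A: "size A = Polynomial.degree p"
        "p = Polynomial.smult (Polynomial.lead_coeff p) (\<Prod>x\<in>#A. [:-x, 1:])"
      using alg_closed_imp_factorization by blast
    have "feval y (\<Prod>x\<in>#A. [:-x, 1:]) = (\<Prod>x\<in>#A. y - fconst x)"
      by (induction A) (simp_all add: hom_1[OF hom_feval] hom_mult[OF hom_feval] hom_uminus[OF hom_fconst] del: mult_pCons_left)
    moreover have "feval y p = fconst (Polynomial.lead_coeff p) * feval y (\<Prod>x\<in>#A. [:-x, 1:])"
      by (subst A(2)) (simp add: hom_mult[OF hom_feval, of _ "[:_:]", simplified])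
    ultimately have "\<exists>x\<in>#A. y - fconst x = 0" using p \<open>p \<noteq> 0\<close> by (auto simp: prod_mset_zero_iff)
    then show False using assms by auto
  qed
qed

lemma transcendental_Fract:
  fixes N M :: "'a::alg_closed_field poly"
  assumes "Polynomial.degree M < Polynomial.degree N" and "M \<noteq> 0"
  shows "transcendental_fract (Fract N M)"
proof (rule transcendental_if_nonconstant, rule)
  assume "Fract N M \<in> range fconst"
  then obtain c where "Fract N M = fconst c" by auto
  then have "N = [:c:] * M" using assms(2) by (simp add: fconst_def to_fract_def eq_fract)
  then show False using assms(1) by (simp add: degree_smult_eq split: if_splits)
qed

section \<open>Galois theory of rational functions\<close>

text \<open>
  Let \<open>\<Sigma>\<close> be a set of \<open>n\<close> substitutions and \<open>f\<close> a polynomial of degree \<open>n\<close> whose image under an embedding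
  \<open>\<kappa>\<close> of \<open>k(T)\<close> into itself vanishes on \<open>\<Sigma>\<close>. Every \<open>x\<close> fixed by the substitutions lies in the range
  of \<open>\<kappa>\<close>. This is Artin's theorem without degrees of extensions: write \<open>x = a / b\<close> and
  reduce \<open>a\<close> and \<open>b\<close> modulo the image of \<open>f\<close>. The difference of the remainder of \<open>a\<close> and \<open>x\<close> times the remainder of
  \<open>b\<close> has degree less than \<open>n\<close>, but vanishes at all elements of \<open>\<Sigma>\<close>; so it is zero, and
  comparing coefficients exhibits \<open>x\<close> as a quotient of two elements of the range.
\<close>

lemma fixed_in_range:
  fixes \<kappa> :: "'a::Fields.field poly fract \<Rightarrow> 'a poly fract"
  assumes \<kappa>: "unital_hom \<kappa>" "\<And>c. \<kappa> (fconst c) = fconst c"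
    and \<Sigma>: "finite \<Sigma>" "fvar \<in> \<Sigma>" "\<And>y. y \<in> \<Sigma> \<Longrightarrow> transcendental_fract y"
    and f: "Polynomial.degree f = card \<Sigma>" "\<And>y. y \<in> \<Sigma> \<Longrightarrow> poly (map_poly \<kappa> f) y = 0"
    and x: "\<And>y. y \<in> \<Sigma> \<Longrightarrow> fsubst y x = x"
  shows "x \<in> range \<kappa>"
proof -
  obtain a b where ab: "x = Fract a b" "b \<noteq> 0" by (cases x)
  have card: "card \<Sigma> > 0" using \<Sigma>(1,2) card_gt_0_iff by blast
  define r where "r p = map_poly fconst p mod f" for p
  have red: "poly (map_poly \<kappa> (r p)) y = feval y p" if "y \<in> \<Sigma>" for p y
  proof -
    have "map_poly \<kappa> (map_poly fconst p) = map_poly fconst p"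
      by (intro poly_eqI) (simp add: coeff_map_poly hom_0[OF \<kappa>(1)] \<kappa>(2))
    moreover have "map_poly fconst p = f * (map_poly fconst p div f) + r p"
      by (simp add: r_def)
    ultimately have "map_poly fconst p = map_poly \<kappa> f * map_poly \<kappa> (map_poly fconst p div f) + map_poly \<kappa> (r p)"
      by (metis hom_add[OF hom_map_poly[OF \<kappa>(1)]] hom_mult[OF hom_map_poly[OF \<kappa>(1)]])
    then have "feval y p = poly (map_poly \<kappa> f * map_poly \<kappa> (map_poly fconst p div f) + map_poly \<kappa> (r p)) y"
      unfolding feval_def by (rule arg_cong)
    then show ?thesis using f(2)[OF that] by simp
  qed
  have deg: "Polynomial.degree (map_poly \<kappa> (r p)) < card \<Sigma>" for p
  proof -
    have "r p = 0 \<or> Polynomial.degree (r p) < Polynomial.degree f"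
      unfolding r_def by (rule degree_mod_less) (use card f(1) in auto)
    then show ?thesis using card f(1) le_less_trans[OF map_poly_degree_leq] by fastforce
  qed
  define g where "g = map_poly \<kappa> (r a) - Polynomial.smult x (map_poly \<kappa> (r b))"
  have "poly g y = 0" if y: "y \<in> \<Sigma>" for y
  proof -
    have "feval y b \<noteq> 0" using \<Sigma>(3)[OF y] ab(2) by (auto simp: transcendental_fract_def)
    moreover have "x = feval y a / feval y b"
      using x[OF y] fsubst_Fract[OF \<Sigma>(3)[OF y] ab(2)] by (simp add: ab(1))
    ultimately show ?thesis by (simp add: g_def red[OF y])
  qed
  moreover have "Polynomial.degree g < card \<Sigma>"
    unfolding g_def using deg card by (intro degree_diff_less) (auto intro: le_less_trans[OF degree_smult_le])
  ultimately have g0: "g = 0"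
    using card_poly_roots_bound[of g] card_mono[of "{y. poly g y = 0}" \<Sigma>] poly_roots_finite[of g] by fastforce
  have "poly (map_poly \<kappa> (r b)) fvar \<noteq> 0"
    using red[OF \<Sigma>(2), of b] ab(2) by (simp add: feval_fvar)
  then obtain i where i: "Polynomial.coeff (map_poly \<kappa> (r b)) i \<noteq> 0" by (metis leading_coeff_0_iff poly_0)
  have "Polynomial.coeff (map_poly \<kappa> (r a)) i = x * Polynomial.coeff (map_poly \<kappa> (r b)) i"
    using arg_cong[OF g0, of "\<lambda>p. Polynomial.coeff p i"] by (simp add: g_def)
  then have "x = \<kappa> (Polynomial.coeff (r a) i / Polynomial.coeff (r b) i)"
    using i by (simp add: coeff_map_poly hom_0[OF \<kappa>(1)] hom_divide[OF \<kappa>(1)] field_simps)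
  then show ?thesis by simp
qed

text \<open>
  A finite group of substitutions fixing a rational function \<open>\<pi>\<close> whose degree is the order of the
  group. The embedding of \<open>k(T)\<close> onto \<open>k(\<pi>)\<close> is \<^term>\<open>fsubst \<pi>\<close>.
\<close>

locale substitution_group =
  fixes \<Sigma> :: "'a::Fields.field poly fract set" and \<pi> :: "'a poly fract" and N M :: "'a poly"
  assumes fin: "finite \<Sigma>" and fvar_mem: "fvar \<in> \<Sigma>"
    and trans: "\<And>y. y \<in> \<Sigma> \<Longrightarrow> transcendental_fract y"
    and closed: "\<And>y z. y \<in> \<Sigma> \<Longrightarrow> z \<in> \<Sigma> \<Longrightarrow> fsubst y z \<in> \<Sigma>"
    and inv: "\<And>y. y \<in> \<Sigma> \<Longrightarrow> fsubst y \<pi> = \<pi>"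
    and \<pi>: "\<pi> = Fract N M" "transcendental_fract \<pi>" "M \<noteq> 0"
    and deg: "Polynomial.degree N = card \<Sigma>" "Polynomial.degree M < card \<Sigma>"
begin

text \<open>
  The polynomial \<open>N - \<pi> M\<close>, which vanishes on the group, with \<open>\<pi>\<close> replaced by the variable of \<open>k(T)\<close>: its
  image under \<^term>\<open>fsubst \<pi>\<close> then visibly has coefficients in \<open>k(\<pi>)\<close>.
\<close>

definition genpoly :: "'a poly fract poly" where
  "genpoly = map_poly fconst N - Polynomial.smult fvar (map_poly fconst M)"

lemma degree_genpoly: "Polynomial.degree genpoly = card \<Sigma>"
proof -
  have "Polynomial.degree (Polynomial.smult fvar (map_poly fconst M)) < Polynomial.degree (map_poly fconst N)"
    using deg by (auto simp: degree_map_poly intro: le_less_trans[OF degree_smult_le])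
  then have "Polynomial.degree genpoly = Polynomial.degree (map_poly fconst N)"
    unfolding genpoly_def by (metis degree_add_eq_left degree_minus diff_conv_add_uminus)
  then show ?thesis using deg by (simp add: degree_map_poly)
qed

lemma poly_genpoly: "poly (map_poly (fsubst \<pi>) genpoly) y = feval y N - \<pi> * feval y M"
proof -
  note h = hom_fsubst[OF \<pi>(2)]
  have "map_poly (fsubst \<pi>) (map_poly fconst p) = map_poly fconst p" for p
    by (intro poly_eqI) (simp add: coeff_map_poly hom_0[OF h] \<pi>(2))
  then have "map_poly (fsubst \<pi>) genpoly = map_poly fconst N - Polynomial.smult \<pi> (map_poly fconst M)"
    by (simp add: genpoly_def hom_diff[OF hom_map_poly[OF h]] map_poly_smult hom_0[OF h] hom_mult[OF h] \<pi>(2))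
  then show ?thesis by (simp add: feval_def)
qed

lemma genpoly_root: assumes "y \<in> \<Sigma>" shows "poly (map_poly (fsubst \<pi>) genpoly) y = 0"
proof -
  have "feval y M \<noteq> 0" using trans[OF assms] \<pi>(3) by (auto simp: transcendental_fract_def)
  moreover have "\<pi> = feval y N / feval y M"
    using inv[OF assms] by (simp add: \<pi>(1) fsubst_Fract[OF trans[OF assms] \<pi>(3)])
  ultimately have "\<pi> * feval y M = feval y N" by simp
  then show ?thesis by (simp add: poly_genpoly)
qed

text \<open>
  Composition with \<open>y\<close> maps the finite set \<open>\<Sigma>\<close> injectively into itself, so it attains \<open>T\<close>.
\<close>

lemma substitution_inverse: assumes "y \<in> \<Sigma>" shows "\<exists>z\<in>\<Sigma>. fsubst y z = fvar"
proof -
  have "fsubst y ` \<Sigma> = \<Sigma>"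
    using closed[OF assms] fin hom_inj[OF hom_fsubst[OF trans[OF assms]]]
    by (metis card_image card_subset_eq image_subsetI inj_on_subset subset_UNIV)
  then show ?thesis using fvar_mem by (metis imageE)
qed

lemma group_substitutions: "group \<lparr>carrier = \<Sigma>, monoid.mult = fsubst, one = fvar\<rparr>"
proof (rule groupI; simp)
  fix x y z assume "x \<in> \<Sigma>" "y \<in> \<Sigma>"
  then show "fsubst (fsubst x y) z = fsubst x (fsubst y z)" by (simp add: fsubst_comp(1)[OF trans trans])
next
  fix y assume y: "y \<in> \<Sigma>"
  obtain z where z: "z \<in> \<Sigma>" "fsubst y z = fvar" using substitution_inverse[OF y] by blast
  obtain w where w: "w \<in> \<Sigma>" "fsubst z w = fvar" using substitution_inverse[OF z(1)] by blast
  have "y = fsubst y (fsubst z w)" using y w trans by simp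
  also have "\<dots> = w" using z fsubst_comp(1)[OF trans trans, OF y z(1), of w] by simp
  finally show "\<exists>z\<in>\<Sigma>. fsubst z y = fvar" using z(1) w(2) by blast
qed (auto simp: closed fvar_mem trans)

lemma fixed_field: "(\<And>y. y \<in> \<Sigma> \<Longrightarrow> fsubst y x = x) \<Longrightarrow> x \<in> range (fsubst \<pi>)"
  by (rule fixed_in_range[OF hom_fsubst[OF \<pi>(2)] fsubst_fconst[OF \<pi>(2)] fin fvar_mem trans
        degree_genpoly genpoly_root])

lemma fixes_range: "y \<in> \<Sigma> \<Longrightarrow> x \<in> range (fsubst \<pi>) \<Longrightarrow> fsubst y x = x"
  using fsubst_comp(1)[OF trans \<pi>(2)] inv by auto

text \<open>
  The image of \<open>T\<close> is a root of \<open>N - \<pi> M\<close>, and the group already accounts for all roots that a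
  polynomial of this degree can have.
\<close>

lemma fixing_hom_in_group:
  assumes f: "unital_hom f" and fixd: "\<And>x. x \<in> range (fsubst \<pi>) \<Longrightarrow> f x = x"
  shows "f fvar \<in> \<Sigma>" "f = fsubst (f fvar)"
proof -
  have c: "f (fconst c) = fconst c" for c
    by (rule fixd) (metis fsubst_fconst \<pi>(2) rangeI)
  show "f = fsubst (f fvar)" by (rule hom_eq_fsubst(2)[OF f c])
  define h where "h = map_poly (fsubst \<pi>) genpoly"
  have "map_poly f h = h"
    by (intro poly_eqI) (auto simp: h_def coeff_map_poly hom_0[OF f] hom_0[OF hom_fsubst[OF \<pi>(2)]] fixd)
  then have root: "poly h (f fvar) = 0"
    using poly_map_poly_hom[OF f, of h fvar] genpoly_root[OF fvar_mem] by (simp add: h_def hom_0[OF f])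
  have "Polynomial.degree h = card \<Sigma>"
    unfolding h_def degree_genpoly[symmetric]
    by (rule degree_map_poly) (simp add: hom_eq_0_iff[OF hom_fsubst[OF \<pi>(2)]])
  moreover have "card \<Sigma> > 0" using fin fvar_mem card_gt_0_iff by blast
  ultimately have h0: "h \<noteq> 0" by auto
  have "\<Sigma> = {y. poly h y = 0}"
  proof (rule card_subset_eq)
    show "finite {y. poly h y = 0}" using h0 by (rule poly_roots_finite)
    show s: "\<Sigma> \<subseteq> {y. poly h y = 0}" using genpoly_root by (auto simp: h_def)
    show "card \<Sigma> = card {y. poly h y = 0}"
      using card_poly_roots_bound[OF h0] card_mono[OF \<open>finite {y. poly h y = 0}\<close> s] \<open>Polynomial.degree h = card \<Sigma>\<close> by simp
  qed
  then show "f fvar \<in> \<Sigma>" using root by auto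
qed

text \<open>
  The product runs over the orbit of \<open>x\<close>, as a set and hence without repetition. The group
  permutes the orbit, so the coefficients are fixed and lie in \<open>k(\<pi>)\<close>.
\<close>

lemma conjugates_split:
  "\<exists>Z. finite Z \<and> x \<in> Z \<and> coeffs_in (range (fsubst \<pi>)) (\<Prod>z\<in>Z. [:- z, 1:])"
proof (intro exI conjI)
  let ?Z = "(\<lambda>y. fsubst y x) ` \<Sigma>"
  show finZ: "finite ?Z" using fin by simp
  show "x \<in> ?Z" by (rule image_eqI[OF _ fvar_mem]) simp
  show "coeffs_in (range (fsubst \<pi>)) (\<Prod>z\<in>?Z. [:- z, 1:])"
    unfolding coeffs_in_def
  proof (intro allI fixed_field)
    fix i y assume y: "y \<in> \<Sigma>"
    note h = hom_fsubst[OF trans[OF y]]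
    have "fsubst y ` ?Z \<subseteq> ?Z"
      using fsubst_comp(1)[OF trans[OF y] trans] closed[OF y] by auto
    then have im: "fsubst y ` ?Z = ?Z"
      using finZ hom_inj[OF h] by (metis card_image card_subset_eq inj_on_subset subset_UNIV)
    have "map_poly (fsubst y) (\<Prod>z\<in>?Z. [:- z, 1:]) = (\<Prod>z\<in>?Z. [:- fsubst y z, 1:])"
      by (simp add: hom_prod[OF hom_map_poly[OF h]] map_poly_pCons hom_simps[OF h])
    also have "\<dots> = (\<Prod>z\<in>fsubst y ` ?Z. [:- z, 1:])"
      by (rule prod.reindex_cong[symmetric, OF inj_on_subset[OF hom_inj[OF h] subset_UNIV]]) auto
    finally have "map_poly (fsubst y) (\<Prod>z\<in>?Z. [:- z, 1:]) = (\<Prod>z\<in>?Z. [:- z, 1:])" by (simp only: im)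
    then have "Polynomial.coeff (map_poly (fsubst y) (\<Prod>z\<in>?Z. [:- z, 1:])) i = Polynomial.coeff (\<Prod>z\<in>?Z. [:- z, 1:]) i"
      by (rule arg_cong)
    then show "fsubst y (Polynomial.coeff (\<Prod>z\<in>?Z. [:- z, 1:]) i) = Polynomial.coeff (\<Prod>z\<in>?Z. [:- z, 1:]) i"
      by (simp only: coeff_map_poly[of "fsubst y", OF hom_0[OF h]])
  qed
qed

end

locale modelled_substitution_group =
  field_model L \<psi> + substitution_group \<Sigma> \<pi> N M
  for L :: "('c, 'd) ring_scheme" (structure) and \<psi> :: "'a::Fields.field poly fract \<Rightarrow> 'c"
    and \<Sigma> :: "'a poly fract set" and \<pi> :: "'a poly fract" and N M :: "'a poly"
begin

lemma galois: "galois_extension L (\<psi> ` range (fsubst \<pi>))"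
  by (rule galois_extensionI[OF range_hom_subfield[OF hom_fsubst[OF \<pi>(2)]] conjugates_split])

text \<open>
  Elements of the Galois group are extensional functions, undefined outside the carrier.
\<close>

definition automorphism :: "'a poly fract \<Rightarrow> 'c \<Rightarrow> 'c" where
  "automorphism y = (\<lambda>x\<in>carrier L. \<psi> (fsubst y (inv_into UNIV \<psi> x)))"

lemma inv_model [simp]: "inv_into UNIV \<psi> (\<psi> x) = x"
  using inj_model by simp

lemma automorphism_model [simp]: "automorphism y (\<psi> x) = \<psi> (fsubst y x)"
  by (simp add: automorphism_def)

lemma fsubst_surj: assumes "y \<in> \<Sigma>" shows "surj (fsubst y)"
proof -
  obtain z where z: "z \<in> \<Sigma>" "fsubst y z = fvar" using substitution_inverse[OF assms] by blast
  have "fsubst y (fsubst z x) = x" for x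
    by (simp add: fsubst_comp(1)[OF trans trans] assms z)
  then show ?thesis by (metis surjI)
qed

lemma automorphism_Bij: assumes "y \<in> \<Sigma>" shows "automorphism y \<in> Bij (carrier L)"
proof -
  have "inj_on (automorphism y) (carrier L)"
  proof (rule inj_onI)
    fix u v assume "u \<in> carrier L" "v \<in> carrier L" "automorphism y u = automorphism y v"
    then show "u = v"
      by (elim carrierE) (simp add: inj_eq[OF hom_inj[OF hom_fsubst[OF trans[OF assms]]]])
  qed
  moreover have "automorphism y ` carrier L = carrier L"
  proof -
    have "automorphism y ` range \<psi> = \<psi> ` range (fsubst y)" by (simp add: image_image)
    then show ?thesis by (simp add: carrier_model fsubst_surj[OF assms])
  qed
  ultimately show ?thesis by (simp add: Bij_def bij_betw_def) (simp add: automorphism_def)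
qed

lemma carrier_galois_group: "carrier (galois_group L (\<psi> ` range (fsubst \<pi>))) = automorphism ` \<Sigma>"
proof (intro equalityI subsetI)
  fix \<sigma> assume "\<sigma> \<in> automorphism ` \<Sigma>"
  then obtain y where y: "y \<in> \<Sigma>" "\<sigma> = automorphism y" by blast
  note h = hom_fsubst[OF trans[OF y(1)]]
  have "automorphism y \<in> ring_hom L L"
    by (rule ring_hom_memI) (auto elim!: carrierE simp: model_mult model_add model_one hom_simps[OF h])
  then show "\<sigma> \<in> carrier (galois_group L (\<psi> ` range (fsubst \<pi>)))"
    using automorphism_Bij[OF y(1)] fixes_range[OF y(1)] by (auto simp: galois_group_def y(2))
next
  fix \<sigma> assume "\<sigma> \<in> carrier (galois_group L (\<psi> ` range (fsubst \<pi>)))"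
  then have \<sigma>: "\<sigma> \<in> Bij (carrier L)" "\<sigma> \<in> ring_hom L L" "\<And>x. x \<in> range (fsubst \<pi>) \<Longrightarrow> \<sigma> (\<psi> x) = \<psi> x"
    by (auto simp: galois_group_def)
  define f where "f x = inv_into UNIV \<psi> (\<sigma> (\<psi> x))" for x
  have "\<sigma> (\<psi> x) \<in> range \<psi>" for x
    using ring_hom_closed[OF \<sigma>(2) model_closed[of x]] by (simp add: carrier_model)
  then have \<psi>f: "\<psi> (f x) = \<sigma> (\<psi> x)" for x by (simp add: f_def f_inv_into_f)
  have "\<psi> (f (x + y)) = \<psi> (f x + f y)" "\<psi> (f (x * y)) = \<psi> (f x * f y)" "\<psi> (f 1) = \<psi> 1" for x y
    unfolding model_add[symmetric] model_mult[symmetric] model_one[symmetric] \<psi>f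
    using ring_hom_add[OF \<sigma>(2) model_closed[of x] model_closed[of y]]
      ring_hom_mult[OF \<sigma>(2) model_closed[of x] model_closed[of y]] ring_hom_one[OF \<sigma>(2)]
    by (simp_all add: model_add model_mult model_one \<psi>f)
  then have h: "unital_hom f" by (simp add: unital_hom_def)
  have fixd: "f x = x" if "x \<in> range (fsubst \<pi>)" for x using \<sigma>(3)[OF that] by (simp add: f_def)
  note F = fixing_hom_in_group[OF h fixd]
  have "\<sigma> = automorphism (f fvar)"
  proof (rule extensionalityI[of _ "carrier L"])
    show "\<sigma> \<in> extensional (carrier L)" using \<sigma>(1) by (rule Bij_imp_extensional)
    show "automorphism (f fvar) \<in> extensional (carrier L)" by (simp add: automorphism_def)
    fix x assume "x \<in> carrier L"
    then obtain u where u: "x = \<psi> u" by (rule carrierE)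
    show "\<sigma> x = automorphism (f fvar) x" using F(2) by (simp add: u \<psi>f[symmetric])
  qed
  then show "\<sigma> \<in> automorphism ` \<Sigma>" using F(1) by blast
qed

lemma automorphism_comp:
  assumes "y \<in> \<Sigma>" "z \<in> \<Sigma>"
  shows "automorphism y \<otimes>\<^bsub>galois_group L (\<psi> ` range (fsubst \<pi>))\<^esub> automorphism z = automorphism (fsubst y z)"
proof -
  have "compose (carrier L) (automorphism y) (automorphism z) = automorphism (fsubst y z)"
  proof (rule extensionalityI[of _ "carrier L"])
    fix x assume "x \<in> carrier L"
    then obtain u where u: "x = \<psi> u" by (rule carrierE)
    show "compose (carrier L) (automorphism y) (automorphism z) x = automorphism (fsubst y z) x"
      by (simp add: compose_def u fsubst_comp(1)[OF trans trans] assms)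
  qed (simp_all add: automorphism_def)
  then show ?thesis
    by (simp add: galois_group_def BijGroup_def automorphism_Bij assms)
qed

lemma automorphism_inj: "inj_on automorphism \<Sigma>"
proof (rule inj_onI)
  fix y z assume "y \<in> \<Sigma>" "z \<in> \<Sigma>" "automorphism y = automorphism z"
  then have "automorphism y (\<psi> fvar) = automorphism z (\<psi> fvar)" by simp
  then show "y = z" using trans \<open>y \<in> \<Sigma>\<close> \<open>z \<in> \<Sigma>\<close> by simp
qed

text \<open>
  Stated with a bijection from \<open>H\<close> onto the substitutions, because the groups of interest come with
  normal forms of their elements, to which substitutions are easily assigned.
\<close>

lemma galois_group_iso:
  assumes f: "bij_betw f (carrier H) \<Sigma>"
    and hom: "\<And>a b. a \<in> carrier H \<Longrightarrow> b \<in> carrier H \<Longrightarrow> a \<otimes>\<^bsub>H\<^esub> b \<in> carrier H \<and> f (a \<otimes>\<^bsub>H\<^esub> b) = fsubst (f a) (f b)"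
  shows "galois_group L (\<psi> ` range (fsubst \<pi>)) \<cong> H"
proof -
  let ?G = "galois_group L (\<psi> ` range (fsubst \<pi>))"
  define g where "g = (\<lambda>a. automorphism (f a))"
  have g: "bij_betw g (carrier H) (carrier ?G)"
    unfolding carrier_galois_group g_def
    using bij_betw_trans[OF f inj_on_imp_bij_betw[OF automorphism_inj]] by (simp add: o_def)
  have fm: "a \<in> carrier H \<Longrightarrow> f a \<in> \<Sigma>" for a using f by (auto simp: bij_betw_def)
  define h where "h = inv_into (carrier H) g"
  have h: "bij_betw h (carrier ?G) (carrier H)"
    unfolding h_def by (rule bij_betw_inv_into[OF g])
  have "h \<in> hom ?G H"
  proof (rule homI)
    fix x assume "x \<in> carrier ?G" then show "h x \<in> carrier H" using h by (auto simp: bij_betw_def)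
  next
    fix x y assume "x \<in> carrier ?G" "y \<in> carrier ?G"
    then obtain a b where ab: "a \<in> carrier H" "b \<in> carrier H" "x = g a" "y = g b"
      using g unfolding bij_betw_def by (metis imageE)
    have "x \<otimes>\<^bsub>?G\<^esub> y = g (a \<otimes>\<^bsub>H\<^esub> b)"
      using hom[OF ab(1,2)] by (simp add: ab(3,4) g_def automorphism_comp fm ab(1,2))
    moreover have "h (g c) = c" if "c \<in> carrier H" for c
      using g that by (simp add: h_def bij_betw_def)
    ultimately show "h (x \<otimes>\<^bsub>?G\<^esub> y) = h x \<otimes>\<^bsub>H\<^esub> h y" using hom[OF ab(1,2)] ab by simp
  qed
  then show ?thesis using h by (auto simp: is_iso_def iso_def)
qed

end

section \<open>Values of rational functions\<close>

text \<open>
  The rational function \<open>x\<close> is regular at the point \<open>c\<close> of the affine line, with value \<open>v\<close>. This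
  is the local ring at \<open>c\<close> together with its residue map.
\<close>

definition has_value :: "'a::Fields.field \<Rightarrow> 'a poly fract \<Rightarrow> 'a \<Rightarrow> bool" where
  "has_value c x v \<longleftrightarrow> (\<exists>a b. x = Fract a b \<and> poly b c \<noteq> 0 \<and> v = poly a c / poly b c)"

lemma has_valueI: "poly b c \<noteq> 0 \<Longrightarrow> has_value c (Fract a b) (poly a c / poly b c)"
  by (auto simp: has_value_def)

lemma has_value_fconst: "has_value c (fconst x) x"
  using has_valueI[of 1 c "[:x:]"] by (simp add: fconst_def to_fract_def)

lemma has_value_add: "has_value c x u \<Longrightarrow> has_value c y v \<Longrightarrow> has_value c (x + y) (u + v)"
proof -
  assume "has_value c x u" "has_value c y v"
  then obtain a b a' b' where *: "x = Fract a b" "poly b c \<noteq> 0" "u = poly a c / poly b c"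
      "y = Fract a' b'" "poly b' c \<noteq> 0" "v = poly a' c / poly b' c"
    by (auto simp: has_value_def)
  then have nz: "b \<noteq> 0" "b' \<noteq> 0" by auto
  show ?thesis
    using has_valueI[of "b * b'" c "a * b' + a' * b"] *(2,5) nz by (simp add: * add_frac_eq)
qed

lemma has_value_mult: "has_value c x u \<Longrightarrow> has_value c y v \<Longrightarrow> has_value c (x * y) (u * v)"
proof -
  assume "has_value c x u" "has_value c y v"
  then obtain a b a' b' where *: "x = Fract a b" "poly b c \<noteq> 0" "u = poly a c / poly b c"
      "y = Fract a' b'" "poly b' c \<noteq> 0" "v = poly a' c / poly b' c"
    by (auto simp: has_value_def)
  show ?thesis
    using has_valueI[of "b * b'" c "a * a'"] *(2,5) by (simp add: *)
qed

lemma has_value_uminus: "has_value c x u \<Longrightarrow> has_value c (- x) (- u)"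
  using has_value_mult[OF has_value_fconst[of c "- 1"], of x u] by (simp add: hom_uminus[OF hom_fconst])

lemma has_value_diff: "has_value c x u \<Longrightarrow> has_value c y v \<Longrightarrow> has_value c (x - y) (u - v)"
  using has_value_add[OF _ has_value_uminus] by fastforce

lemma has_value_power: "has_value c x u \<Longrightarrow> has_value c (x ^ n) (u ^ n)"
  using has_value_fconst[of c 1] by (induction n) (auto intro: has_value_mult)

lemma has_value_feval: "has_value c y v \<Longrightarrow> has_value c (feval y p) (poly p v)"
proof (induction p)
  case 0
  then show ?case using has_value_fconst[of c 0] by simp
next
  case (pCons a p)
  then show ?case by (auto intro!: has_value_add has_value_mult has_value_fconst)
qed

lemma has_value_unique: "has_value c x u \<Longrightarrow> has_value c x v \<Longrightarrow> u = v"
proof -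
  assume "has_value c x u" "has_value c x v"
  then obtain a b a' b' where *: "x = Fract a b" "poly b c \<noteq> 0" "u = poly a c / poly b c"
      "x = Fract a' b'" "poly b' c \<noteq> 0" "v = poly a' c / poly b' c"
    unfolding has_value_def by blast
  then have "b \<noteq> 0" "b' \<noteq> 0" by auto
  then have "a * b' = a' * b" using * eq_fract(1)[of b b' a a'] by simp
  then have "poly a c * poly b' c = poly a' c * poly b c" by (metis poly_mult)
  then show ?thesis using * by (simp add: frac_eq_eq)
qed

lemma has_value_prod_list:
  "(\<And>z. z \<in> set zs \<Longrightarrow> has_value c (f z) (g z)) \<Longrightarrow> has_value c (\<Prod>z\<leftarrow>zs. f z) (\<Prod>z\<leftarrow>zs. g z)"
  using has_value_fconst[of c 1] by (induction zs) (auto intro!: has_value_mult)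

text \<open>
  The local rings of the line are valuation rings: after cancelling the common powers of \<open>T - c\<close>,
  numerator and denominator do not both vanish at \<open>c\<close>.
\<close>

lemma regular_cases:
  obtains v where "has_value c x v" | "x \<noteq> 0" "has_value c (inverse x) 0"
proof -
  have "(\<exists>v. has_value c x v) \<or> x \<noteq> 0 \<and> has_value c (inverse x) 0"
    if "x = Fract a b" "b \<noteq> 0" for a b
    using that
  proof (induction "Polynomial.degree b" arbitrary: a b rule: less_induct)
    case less
    show ?case
    proof (cases "poly b c = 0")
      case False
      then show ?thesis using has_valueI[OF False, of a] by (auto simp: less.prems(1))
    next
      case b: True
      show ?thesis
      proof (cases "poly a c = 0")
        case True
        obtain b' a' where *: "b = [:- c, 1:] * b'" "a = [:- c, 1:] * a'"
          using b True by (metis dvdE poly_eq_0_iff_dvd)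
        have b'0: "b' \<noteq> 0" using less.prems(2) *(1) by auto
        then have "Polynomial.degree b' < Polynomial.degree b"
          unfolding *(1) by (subst degree_mult_eq) auto
        moreover have "x = Fract a' b'"
          unfolding less.prems(1) * by (rule mult_fract_cancel) simp
        ultimately show ?thesis using less.hyps b'0 by blast
      next
        case False
        then have "a \<noteq> 0" by auto
        then have "x \<noteq> 0" using less.prems by (simp add: Zero_fract_def eq_fract)
        moreover have "has_value c (inverse x) 0"
          using has_valueI[OF False, of b] b less.prems by simp
        ultimately show ?thesis by blast
      qed
    qed
  qed
  then show ?thesis using that by (metis Fract_cases)
qed

section \<open>Ramification\<close>

text \<open>
  Coprimality is expressed through roots, which is enough over an algebraically closed field.
\<close>

lemma dvd_mult_power_cancel:
  fixes N M r :: "'a::alg_closed_field poly"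
  assumes "\<And>x. poly N x = 0 \<Longrightarrow> poly M x \<noteq> 0" and "N dvd r * M ^ e" and "N \<noteq> 0"
  shows "N dvd r"
  using assms
proof (induction "Polynomial.degree N" arbitrary: N r)
  case 0
  then show ?case by (auto simp: is_unit_iff_degree intro: unit_imp_dvd)
next
  case (Suc n)
  obtain a where a: "poly N a = 0" using alg_closed_imp_poly_has_root[of N] Suc(2) by auto
  obtain N' where N': "N = [:- a, 1:] * N'" using a by (metis dvdE poly_eq_0_iff_dvd)
  have "poly (r * M ^ e) a = 0" using Suc.prems(2) a by (metis dvd_trans poly_eq_0_iff_dvd)
  then have "poly r a = 0" using Suc.prems(1)[OF a] by simp
  then obtain r' where r': "r = [:- a, 1:] * r'" by (metis dvdE poly_eq_0_iff_dvd)
  have N'0: "N' \<noteq> 0" using Suc.prems(3) N' by auto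
  have "[:- a, 1:] * N' dvd [:- a, 1:] * (r' * M ^ e)"
    using Suc.prems(2) unfolding N' r' by (simp only: mult.assoc)
  then have "N' dvd r' * M ^ e" by (subst (asm) dvd_mult_cancel_left) simp
  moreover have "n = Polynomial.degree N'"
    using Suc(2) N'0 unfolding N' by (subst (asm) degree_mult_eq) auto
  moreover have "poly N' x = 0 \<Longrightarrow> poly M x \<noteq> 0" for x
    using Suc.prems(1)[of x] by (simp add: N' del: mult_pCons_left)
  ultimately have "N' dvd r'" using Suc(1) N'0 by blast
  then show ?case unfolding N' r' by (rule mult_dvd_mono[OF dvd_refl])
qed

text \<open>
  A homogeneous relation between coprime \<open>N\<close> and \<open>M\<close> whose coefficients are polynomials of
  degree less than that of \<open>N\<close>: modulo \<open>N\<close> only the term with \<open>j = 0\<close> survives, so its coefficient is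
  divisible by \<open>N\<close> and vanishes; then divide by \<open>N\<close> and repeat.
\<close>

lemma relation_trivial:
  fixes N M :: "'a::alg_closed_field poly"
  assumes "\<And>x. poly N x = 0 \<Longrightarrow> poly M x \<noteq> 0"
    and "\<And>j. Polynomial.degree (r j) < Polynomial.degree N"
    and "(\<Sum>j\<le>e. r j * N ^ j * M ^ (e - j)) = 0" "j \<le> e"
  shows "r j = 0"
  using assms(2-4)
proof (induction e arbitrary: r j)
  case (0 r)
  then show ?case by simp
next
  case (Suc e r)
  have N0: "N \<noteq> 0" using Suc.prems(1)[of 0] by auto
  have split: "(\<Sum>j\<le>Suc e. r j * N ^ j * M ^ (Suc e - j)) =
      r 0 * M ^ Suc e + N * (\<Sum>j\<le>e. r (Suc j) * N ^ j * M ^ (e - j))"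
    by (subst sum.atMost_Suc_shift) (simp add: sum_distrib_left algebra_simps)
  then have "N dvd r 0 * M ^ Suc e" using Suc.prems(2)
    by (intro dvdI[of _ _ "- (\<Sum>j\<le>e. r (Suc j) * N ^ j * M ^ (e - j))"]) (simp add: eq_neg_iff_add_eq_0)
  then have "N dvd r 0" using dvd_mult_power_cancel[of N M "r 0" "Suc e"] assms(1) N0 by blast
  then have r0: "r 0 = 0" using Suc.prems(1)[of 0] by (metis dvd_imp_degree_le not_le)
  then have "(\<Sum>j\<le>e. r (Suc j) * N ^ j * M ^ (e - j)) = 0"
    using split Suc.prems(2) N0 by simp
  then have "r (Suc i) = 0" if "i \<le> e" for i
    using Suc.IH[of "\<lambda>j. r (Suc j)" i] Suc.prems(1) that by blast
  then show ?case using r0 Suc.prems(3) by (cases j) auto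
qed

lemma clear_denominators:
  fixes g :: "'a::Fields.field poly fract poly"
  obtains D P where "D \<noteq> 0" "\<And>i. Polynomial.coeff g i * to_fract D = to_fract (P i)"
proof -
  have "\<exists>D P. D \<noteq> 0 \<and> (\<forall>i. Polynomial.coeff g i * to_fract D = to_fract (P i))"
  proof (induction g)
    case 0
    show ?case by (intro exI[of _ 1] exI[of _ "\<lambda>_. 0"]) simp
  next
    case (pCons x g)
    then obtain D P where DP: "D \<noteq> 0" "\<And>i. Polynomial.coeff g i * to_fract D = to_fract (P i)" by blast
    obtain a b where x: "x = Fract a b" "b \<noteq> 0" by (cases x)
    have "Polynomial.coeff (pCons x g) i * to_fract (D * b) = to_fract (case i of 0 \<Rightarrow> a * D | Suc j \<Rightarrow> P j * b)" for i
      using x(2) by (cases i) (simp_all add: x(1) DP(2)[symmetric] Fract_conv_to_fract)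
    then show ?case using DP(1) x(2) by (intro exI[of _ "D * b"] exI[of _ "\<lambda>i. case i of 0 \<Rightarrow> a * D | Suc j \<Rightarrow> P j * b"]) auto
  qed
  then show ?thesis using that by blast
qed

text \<open>
  Since the denominator has the smaller degree, the point at infinity is a pole of \<open>\<pi>\<close>, and all
  zeros of \<open>\<pi>\<close> are roots of \<open>N\<close>.
\<close>

locale rational_function =
  fixes N M :: "'a::alg_closed_field poly" and \<pi> :: "'a poly fract"
  assumes cop: "\<And>x. poly N x = 0 \<Longrightarrow> poly M x \<noteq> 0" and deg: "Polynomial.degree M < Polynomial.degree N" and M0: "M \<noteq> 0"
    and \<pi>: "\<pi> = Fract N M"
begin

lemma N_nonzero: "N \<noteq> 0" using deg by auto

lemma transcendental: "transcendental_fract \<pi>"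
  unfolding \<pi> using deg M0 by (rule transcendental_Fract)

text \<open>
  The degree of \<open>k(T)\<close> over \<open>k(\<pi>)\<close> is at least that of \<open>N\<close>. Write the coefficients of \<open>g\<close> as
  polynomials in \<open>\<pi>\<close> with a common denominator and multiply the relation by a power of \<open>M\<close>. Sorted by
  powers of \<open>N\<close> and \<open>M\<close> it is a homogeneous relation of the kind that \<open>relation_trivial\<close> excludes.
\<close>

lemma degree_minimal:
  assumes g: "coeffs_in (range (fsubst \<pi>)) g" and d: "Polynomial.degree g < Polynomial.degree N"
    and root: "poly g fvar = 0"
  shows "g = 0"
proof -
  note h = hom_fsubst[OF transcendental]
  obtain g0 where g0: "g = map_poly (fsubst \<pi>) g0" using coeffs_in_range[OF h g] by blast
  obtain D P where DP: "D \<noteq> 0" "\<And>i. Polynomial.coeff g0 i * to_fract D = to_fract (P i)"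
    using clear_denominators by blast
  have D\<pi>: "feval \<pi> D \<noteq> 0" using DP(1) transcendental by (auto simp: transcendental_fract_def)
  have cg: "Polynomial.coeff g i * feval \<pi> D = feval \<pi> (P i)" for i
    using arg_cong[OF DP(2)[of i], of "fsubst \<pi>"]
    by (simp add: g0 coeff_map_poly hom_0[OF h] hom_mult[OF h] fsubst_to_fract[OF transcendental])
  define n where "n = Polynomial.degree g"
  define e where "e = (MAX i\<in>{..n}. Polynomial.degree (P i))"
  have e: "Polynomial.degree (P i) \<le> e" if "i \<le> n" for i
    unfolding e_def using that by (intro Max_ge) auto
  have "0 = (\<Sum>i\<le>n. Polynomial.coeff g i * fvar ^ i) * feval \<pi> D"
    using root by (simp add: poly_altdef n_def)
  also have "\<dots> = (\<Sum>i\<le>n. feval \<pi> (P i) * fvar ^ i)"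
    by (simp add: sum_distrib_left sum_distrib_right cg[symmetric] mult_ac)
  also have "\<dots> = (\<Sum>i\<le>n. (\<Sum>j\<le>e. fconst (Polynomial.coeff (P i) j) * \<pi> ^ j) * fvar ^ i)"
  proof (rule sum.cong[OF HOL.refl])
    fix i assume "i \<in> {..n}"
    then have "feval \<pi> (P i) = (\<Sum>j\<le>e. fconst (Polynomial.coeff (P i) j) * \<pi> ^ j)"
      by (intro feval_altdef' e) simp
    then show "feval \<pi> (P i) * fvar ^ i = (\<Sum>j\<le>e. fconst (Polynomial.coeff (P i) j) * \<pi> ^ j) * fvar ^ i"
      by simp
  qed
  finally have "0 = (\<Sum>i\<le>n. (\<Sum>j\<le>e. fconst (Polynomial.coeff (P i) j) * \<pi> ^ j) * fvar ^ i) * to_fract M ^ e"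
    by simp
  also have "\<dots> = (\<Sum>i\<le>n. \<Sum>j\<le>e. fconst (Polynomial.coeff (P i) j) * fvar ^ i * to_fract N ^ j * to_fract M ^ (e - j))"
  proof -
    have pw: "\<pi> ^ j * to_fract M ^ e = to_fract N ^ j * to_fract M ^ (e - j)" if "j \<le> e" for j
    proof -
      have "to_fract M ^ e = to_fract M ^ j * to_fract M ^ (e - j)"
        using that by (simp flip: power_add)
      then show ?thesis using M0 by (simp add: \<pi> Fract_conv_to_fract power_divide)
    qed
    have "fconst (Polynomial.coeff (P i) j) * \<pi> ^ j * fvar ^ i * to_fract M ^ e =
        fconst (Polynomial.coeff (P i) j) * fvar ^ i * to_fract N ^ j * to_fract M ^ (e - j)"
      if "j \<in> {..e}" for i j
    proof -
      have "fconst (Polynomial.coeff (P i) j) * \<pi> ^ j * fvar ^ i * to_fract M ^ e =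
          fconst (Polynomial.coeff (P i) j) * fvar ^ i * (\<pi> ^ j * to_fract M ^ e)"
        by (simp only: mult_ac)
      also have "\<dots> = fconst (Polynomial.coeff (P i) j) * fvar ^ i * (to_fract N ^ j * to_fract M ^ (e - j))"
        using pw[of j] that by simp
      finally show ?thesis by (simp only: mult_ac)
    qed
    then show ?thesis
      unfolding sum_distrib_right by (intro sum.cong[OF HOL.refl]) auto
  qed
  also have "\<dots> = to_fract (\<Sum>j\<le>e. (\<Sum>i\<le>n. Polynomial.monom (Polynomial.coeff (P i) j) i) * N ^ j * M ^ (e - j))"
  proof -
    have m: "to_fract (Polynomial.monom c i) = fconst c * fvar ^ i" for c :: 'a and i
      using feval_monom[of fvar c i] by (simp add: feval_fvar)
    show ?thesis
      by (subst sum.swap) (simp add: hom_power[OF hom_to_fract] m sum_distrib_right)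
  qed
  finally have rel: "(\<Sum>j\<le>e. (\<Sum>i\<le>n. Polynomial.monom (Polynomial.coeff (P i) j) i) * N ^ j * M ^ (e - j)) = 0"
    by (rule to_fract_eq_0_iff[THEN iffD1, OF HOL.sym])
  have "(\<Sum>i\<le>n. Polynomial.monom (Polynomial.coeff (P i) j) i) = 0" if "j \<le> e" for j
    by (rule relation_trivial[OF cop _ rel that])
       (use d in \<open>auto simp: n_def intro!: le_less_trans[OF degree_sum_le] le_trans[OF degree_monom_le]\<close>)
  then have "Polynomial.coeff (\<Sum>i\<le>n. Polynomial.monom (Polynomial.coeff (P i) j) i) n = 0" if "j \<le> e" for j
    using that by simp
  then have "Polynomial.coeff (P n) j = 0" if "j \<le> e" for j
    using that by (simp add: coeff_sum)
  then have "P n = 0"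
    using e[of n] by (intro poly_eqI) (metis coeff_0 coeff_eq_0 le_less_trans not_le order_refl)
  then have "Polynomial.coeff g n = 0" using cg[of n] D\<pi> by simp
  then show "g = 0" by (simp add: n_def)
qed

definition fibre_poly :: "'a poly fract poly" where
  "fibre_poly = map_poly fconst N - Polynomial.smult \<pi> (map_poly fconst M)"

lemma poly_fibre_poly: "poly fibre_poly z = feval z N - \<pi> * feval z M"
  by (simp add: fibre_poly_def feval_def)

lemma degree_fibre_poly: "Polynomial.degree fibre_poly = Polynomial.degree N"
  and lead_fibre_poly: "Polynomial.lead_coeff fibre_poly = fconst (Polynomial.lead_coeff N)"
proof -
  have d: "Polynomial.degree (map_poly fconst N) = Polynomial.degree N" by (simp add: degree_map_poly)
  have "Polynomial.degree (- Polynomial.smult \<pi> (map_poly fconst M)) < Polynomial.degree (map_poly fconst N)"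
    using deg by (auto simp: degree_map_poly intro: le_less_trans[OF degree_smult_le])
  then have "Polynomial.degree fibre_poly = Polynomial.degree (map_poly fconst N)"
    "Polynomial.lead_coeff fibre_poly = Polynomial.lead_coeff (map_poly fconst N)"
    using degree_add_eq_left[of "- Polynomial.smult \<pi> (map_poly fconst M)" "map_poly fconst N"]
      lead_coeff_add_le[of "- Polynomial.smult \<pi> (map_poly fconst M)" "map_poly fconst N"]
    by (simp_all only: fibre_poly_def diff_conv_add_uminus add.commute)
  then show "Polynomial.degree fibre_poly = Polynomial.degree N"
    "Polynomial.lead_coeff fibre_poly = fconst (Polynomial.lead_coeff N)"
    by (simp_all add: d coeff_map_poly)
qed

text \<open>
  If the extension is normal, the minimal polynomial of \<open>T\<close> splits. It divides \<open>N - \<pi> M\<close> and has at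
  least the same degree, so both agree up to the leading coefficient of \<open>N\<close>.
\<close>

lemma fibre_poly_splits:
  assumes zs: "coeffs_in (range (fsubst \<pi>)) (\<Prod>z\<leftarrow>zs. [:- z, 1:])" "fvar \<in> set zs"
    and min: "\<And>g. coeffs_in (range (fsubst \<pi>)) g \<Longrightarrow> poly g fvar = 0 \<Longrightarrow> (\<Prod>z\<leftarrow>zs. [:- z, 1:]) dvd g"
  shows "fibre_poly = Polynomial.smult (fconst (Polynomial.lead_coeff N)) (\<Prod>z\<leftarrow>zs. [:- z, 1:])"
proof -
  define \<mu> where "\<mu> = (\<Prod>z\<leftarrow>zs. [:- z, 1:])"
  have \<mu>0: "\<mu> \<noteq> 0" by (auto simp: \<mu>_def prod_list_zero_iff)
  have "poly \<mu> fvar = 0" using zs(2) by (auto simp: \<mu>_def poly_prod_linear prod_list_zero_iff)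
  then have dm: "Polynomial.degree \<mu> \<ge> Polynomial.degree N"
    using degree_minimal[of \<mu>] zs(1) \<mu>0 by (auto simp: \<mu>_def[symmetric] not_less[symmetric])
  have "poly fibre_poly fvar = 0"
  proof -
    have "\<pi> * to_fract M = to_fract N" using M0 by (simp add: \<pi> Fract_conv_to_fract)
    then show ?thesis by (simp add: poly_fibre_poly feval_fvar)
  qed
  moreover have "coeffs_in (range (fsubst \<pi>)) fibre_poly"
  proof -
    have "Polynomial.coeff fibre_poly i = fsubst \<pi> (fconst (Polynomial.coeff N i) - fvar * fconst (Polynomial.coeff M i))" for i
      using transcendental
      by (simp add: fibre_poly_def coeff_map_poly hom_diff[OF hom_fsubst] hom_mult[OF hom_fsubst])
    then show ?thesis by (simp add: coeffs_in_def)
  qed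
  ultimately have "\<mu> dvd fibre_poly" unfolding \<mu>_def by (intro min)
  then obtain r where r: "fibre_poly = \<mu> * r" by blast
  have f0: "fibre_poly \<noteq> 0" using lead_fibre_poly N_nonzero by auto
  then have r0: "r \<noteq> 0" using r by auto
  have "Polynomial.degree N = Polynomial.degree \<mu> + Polynomial.degree r"
    using degree_fibre_poly r degree_mult_eq[OF \<mu>0 r0] by simp
  then have "Polynomial.degree r = 0" using dm by simp
  then obtain \<nu> where \<nu>: "r = [:\<nu>:]" by (metis degree0_coeffs)
  have "Polynomial.lead_coeff \<mu> = 1"
    unfolding \<mu>_def by (induction zs) (simp_all add: lead_coeff_mult del: mult_pCons_left)
  then have "\<nu> = fconst (Polynomial.lead_coeff N)"
    using lead_fibre_poly unfolding r lead_coeff_mult by (simp add: \<nu>)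
  then show ?thesis by (simp add: r \<nu> \<mu>_def)
qed

text \<open>
  At a zero \<open>c\<close> of \<open>\<pi>\<close> the polynomial \<open>N - \<pi> M\<close> has coefficients regular at \<open>c\<close> and constant leading
  coefficient, so its roots are integral. Explicitly, if \<open>1 / z\<close> had the value \<open>0\<close>, the
  reversed equation would give the value \<open>0\<close> to the leading coefficient of \<open>N\<close>.
\<close>

lemma fibre_root_regular:
  assumes c: "poly N c = 0" and z: "feval z N = \<pi> * feval z M"
  obtains v where "has_value c z v"
proof (cases z rule: regular_cases[of c])
  case 2
  have Mc: "poly M c \<noteq> 0" using cop c by blast
  have \<pi>0: "has_value c \<pi> 0" using has_valueI[OF Mc, of N] c by (simp add: \<pi>)
  let ?w = "inverse z"
  have refl: "feval ?w (reflect_poly p) = ?w ^ Polynomial.degree p * feval z p" for p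
  proof -
    have "map_poly fconst (reflect_poly p) = reflect_poly (map_poly fconst p)"
      by (intro poly_eqI) (simp add: coeff_reflect_poly coeff_map_poly degree_map_poly)
    then show ?thesis using 2(1) by (simp add: feval_def poly_reflect_poly_nz degree_map_poly)
  qed
  let ?k = "Polynomial.degree N - Polynomial.degree M"
  have "feval ?w (reflect_poly N) = \<pi> * (?w ^ Polynomial.degree N * feval z M)" by (simp add: refl z)
  also have "?w ^ Polynomial.degree N = ?w ^ ?k * ?w ^ Polynomial.degree M"
    using deg by (simp flip: power_add)
  finally have "feval ?w (reflect_poly N) = \<pi> * (?w ^ ?k * feval ?w (reflect_poly M))" by (simp add: refl mult_ac)
  moreover have "has_value c (\<pi> * (?w ^ ?k * feval ?w (reflect_poly M))) (0 * (0 ^ ?k * poly (reflect_poly M) 0))"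
    by (intro has_value_mult \<pi>0 has_value_power 2(2) has_value_feval)
  ultimately have "poly (reflect_poly N) 0 = 0"
    using has_value_unique[OF has_value_feval[OF 2(2), of "reflect_poly N"]] by fastforce
  then show ?thesis using N_nonzero by simp
qed

text \<open>
  In the split case some root \<open>z\<close> of \<open>N - \<pi> M\<close> takes the value \<open>b\<close> at \<open>c\<close>: evaluate the
  factorization of \<open>N(b) - \<pi> M(b)\<close> at \<open>c\<close>. As an element of the Galois group, \<open>z\<close> moves the point \<open>c\<close>
  to the point \<open>b\<close>. Comparing the orders at \<open>c\<close> of both sides of \<open>N(z) = \<pi> M(z)\<close> shows that the
  multiplicity of \<open>N\<close> at \<open>b\<close>, times the order of \<open>z - b\<close> at \<open>c\<close>, is the multiplicity of \<open>N\<close> at \<open>c\<close>.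
\<close>

theorem ramification_divides:
  assumes split: "fibre_poly = Polynomial.smult (fconst (Polynomial.lead_coeff N)) (\<Prod>z\<leftarrow>zs. [:- z, 1:])"
    and c: "poly N c = 0" and b: "poly N b = 0"
  shows "Polynomial.order b N dvd Polynomial.order c N"
proof -
  have Mc: "poly M c \<noteq> 0" "poly M b \<noteq> 0" using cop c b by blast+
  have \<pi>0: "has_value c \<pi> 0" using has_valueI[OF Mc(1), of N] c by (simp add: \<pi>)
  have root: "feval z N = \<pi> * feval z M" if "z \<in> set zs" for z
  proof -
    have "poly fibre_poly z = 0" using that by (simp add: split poly_prod_linear prod_list_zero_iff image_iff)
    then show ?thesis by (simp add: poly_fibre_poly)
  qed
  have "\<exists>v. has_value c z v" if "z \<in> set zs" for z
    using fibre_root_regular[OF c root[OF that]] by blast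
  then obtain v where v: "\<And>z. z \<in> set zs \<Longrightarrow> has_value c z (v z)" by metis
  \<comment> \<open>some root takes the value \<open>b\<close> at \<open>c\<close>\<close>
  have "feval (fconst b) N - \<pi> * feval (fconst b) M = fconst (Polynomial.lead_coeff N) * (\<Prod>z\<leftarrow>zs. fconst b - z)"
    using split poly_fibre_poly[of "fconst b"] by (simp add: poly_prod_linear)
  moreover have "has_value c (feval (fconst b) N - \<pi> * feval (fconst b) M) (poly N b - 0 * poly M b)"
    by (intro has_value_diff has_value_mult has_value_feval has_value_fconst \<pi>0)
  moreover have "has_value c (fconst (Polynomial.lead_coeff N) * (\<Prod>z\<leftarrow>zs. fconst b - z))
      (Polynomial.lead_coeff N * (\<Prod>z\<leftarrow>zs. b - v z))"
    by (intro has_value_mult has_value_fconst has_value_prod_list has_value_diff v)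
  ultimately have "Polynomial.lead_coeff N * (\<Prod>z\<leftarrow>zs. b - v z) = 0"
    using has_value_unique b by fastforce
  then obtain z where z: "z \<in> set zs" "v z = b" using N_nonzero by (auto simp: prod_list_zero_iff)
  then have zb: "has_value c z b" using v by blast
  then obtain \<alpha> \<beta> where \<alpha>\<beta>: "z = Fract \<alpha> \<beta>" "poly \<beta> c \<noteq> 0" "b = poly \<alpha> c / poly \<beta> c"
    by (auto simp: has_value_def)
  define f where "f = Polynomial.order b N"
  obtain N1 where N1: "N = [:- b, 1:] ^ f * N1" "\<not> [:- b, 1:] dvd N1"
    using order_decomp[OF N_nonzero] by (auto simp: f_def)
  have N1b: "poly N1 b \<noteq> 0" using N1(2) by (simp add: poly_eq_0_iff_dvd)
  have val1: "has_value c (feval z N1) (poly N1 b)" and val2: "has_value c (feval z M) (poly M b)"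
    using zb by (auto intro: has_value_feval)
  obtain a1 b1 where 1: "feval z N1 = Fract a1 b1" "poly b1 c \<noteq> 0" "poly N1 b = poly a1 c / poly b1 c"
    using val1 by (auto simp: has_value_def)
  obtain a2 b2 where 2: "feval z M = Fract a2 b2" "poly b2 c \<noteq> 0" "poly M b = poly a2 c / poly b2 c"
    using val2 by (auto simp: has_value_def)
  have nz: "poly a1 c \<noteq> 0" "poly a2 c \<noteq> 0" using N1b Mc(2) 1(3) 2(3) by auto
  then have nz': "a1 \<noteq> 0" "a2 \<noteq> 0" "b1 \<noteq> 0" "b2 \<noteq> 0" "\<beta> \<noteq> 0" using 1 2 \<alpha>\<beta> by auto
  have fact: "feval z [:- b, 1:] = z - fconst b" by (simp add: hom_uminus[OF hom_fconst])
  have "feval z N = (z - fconst b) ^ f * feval z N1"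
    by (subst N1(1)) (simp only: hom_mult[OF hom_feval] hom_power[OF hom_feval] fact)
  then have "(z - fconst b) ^ f * Fract a1 b1 = Fract N M * Fract a2 b2"
    using root[OF z(1)] by (simp add: 1 2 \<pi>)
  moreover have "z - fconst b = to_fract (\<alpha> - Polynomial.smult b \<beta>) / to_fract \<beta>"
    using nz'(5) by (simp add: \<alpha>\<beta>(1) fconst_def to_fract_def)
  ultimately have "to_fract ((\<alpha> - Polynomial.smult b \<beta>) ^ f * a1 * M * b2) = to_fract (N * a2 * \<beta> ^ f * b1)"
    using nz' M0 by (simp add: Fract_conv_to_fract power_divide hom_power[OF hom_to_fract] field_simps)
  then have eq: "(\<alpha> - Polynomial.smult b \<beta>) ^ f * (a1 * M * b2) = N * (a2 * \<beta> ^ f * b1)"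
    by (simp only: to_fract_eq_iff mult.assoc)
  have "N * (a2 * \<beta> ^ f * b1) \<noteq> 0" using nz' N_nonzero by simp
  then have "Polynomial.order c ((\<alpha> - Polynomial.smult b \<beta>) ^ f) + Polynomial.order c (a1 * M * b2) =
      Polynomial.order c N + Polynomial.order c (a2 * \<beta> ^ f * b1)"
    using eq order_mult by metis
  moreover have "Polynomial.order c (a1 * M * b2) = 0" "Polynomial.order c (a2 * \<beta> ^ f * b1) = 0"
    using nz 1(2) 2(2) Mc(1) \<alpha>\<beta>(2) by (auto intro!: order_0I)
  moreover have ord_pow: "Polynomial.order c (p ^ k) = k * Polynomial.order c p" if "p \<noteq> 0" for p :: "'a poly" and k
    using that by (induction k) (simp_all add: order_mult)
  moreover have "Polynomial.order c ((\<alpha> - Polynomial.smult b \<beta>) ^ f) = f * Polynomial.order c (\<alpha> - Polynomial.smult b \<beta>)"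
  proof (cases "\<alpha> - Polynomial.smult b \<beta> = 0 \<and> f > 0")
    case True
    then show ?thesis using eq \<open>N * (a2 * \<beta> ^ f * b1) \<noteq> 0\<close> by (simp add: power_0_left)
  next
    case False
    then show ?thesis by (cases "f = 0") (auto simp: ord_pow)
  qed
  ultimately show ?thesis by (simp add: f_def)
qed

end

section \<open>Ternary forms\<close>

lemma infinite_alg_closed: "infinite (UNIV :: 'a::alg_closed_field set)"
proof
  assume fin: "finite (UNIV :: 'a set)"
  define p :: "'a poly" where "p = (\<Prod>x\<in>UNIV. [:- x, 1:])"
  have dp: "Polynomial.degree p = card (UNIV :: 'a set)"
    unfolding p_def by (subst degree_prod_eq_sum_degree) auto
  have "card (UNIV :: 'a set) > 0" using fin by (simp add: card_gt_0_iff)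
  then have "Polynomial.degree (1 + p) > 0"
    using dp degree_add_eq_right[of 1 p] by simp
  then obtain x where "poly (1 + p) x = 0" using alg_closed_imp_poly_has_root by blast
  moreover have "poly p x = 0" using fin by (simp add: p_def poly_prod prod_zero_iff)
  ultimately show False by simp
qed

lemma poly_eq_0_if_infinite:
  fixes p :: "'r::idom poly"
  assumes "infinite S" "\<And>s. s \<in> S \<Longrightarrow> poly p s = 0" shows "p = 0"
  using assms poly_roots_finite[of p] finite_subset[of S "{x. poly p x = 0}"] by blast

text \<open>
  Evaluation of a ternary polynomial in an algebra over its coefficients. With \<open>\<iota>\<close> the identity this
  is evaluation at a point, with \<open>\<iota>\<close> the constant polynomials it is the pullback along a
  polynomial parametrization.
\<close>

definition ev :: "('a::comm_ring_1 \<Rightarrow> 'r::comm_ring_1) \<Rightarrow> 'r \<Rightarrow> 'r \<Rightarrow> 'r \<Rightarrow> 'a poly3 \<Rightarrow> 'r" where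
  "ev \<iota> x y z F = poly (map_poly (\<lambda>g. poly (map_poly (\<lambda>h. poly (map_poly \<iota> h) x) g) y) F) z"

abbreviation ev_at :: "'a::comm_ring_1 \<Rightarrow> 'a \<Rightarrow> 'a \<Rightarrow> 'a poly3 \<Rightarrow> 'a" where
  "ev_at \<equiv> ev (\<lambda>x. x)"

abbreviation ev_poly :: "'a::comm_ring_1 poly \<Rightarrow> 'a poly \<Rightarrow> 'a poly \<Rightarrow> 'a poly3 \<Rightarrow> 'a poly" where
  "ev_poly \<equiv> ev (\<lambda>c. [:c:])"

context
  fixes \<iota> :: "'a::comm_ring_1 \<Rightarrow> 'r::comm_ring_1"
  assumes \<iota>: "unital_hom \<iota>"
begin

lemma hom_ev1: "unital_hom (\<lambda>h. poly (map_poly \<iota> h) x)"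
  by (rule hom_comp[OF hom_poly hom_map_poly[OF \<iota>]])

lemma hom_ev2: "unital_hom (\<lambda>g. poly (map_poly (\<lambda>h. poly (map_poly \<iota> h) x) g) y)"
  by (rule hom_comp[OF hom_poly hom_map_poly[OF hom_ev1]])

lemma hom_ev: "unital_hom (ev \<iota> x y z)"
  unfolding ev_def by (rule hom_comp[OF hom_poly hom_map_poly[OF hom_ev2]])

lemma ev_const3 [simp]: "ev \<iota> x y z (const3 c) = \<iota> c"
  by (simp add: ev_def const3_def map_poly_pCons hom_0[OF \<iota>] hom_0[OF hom_ev1] hom_0[OF hom_ev2])

end

definition varX :: "'a::comm_ring_1 poly3" where "varX = [:[:[:0, 1:]:]:]"
definition varY :: "'a::comm_ring_1 poly3" where "varY = [:[:0, 1:]:]"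
definition varZ :: "'a::comm_ring_1 poly3" where "varZ = [:0, 1:]"

lemma
  assumes \<iota>: "unital_hom \<iota>"
  shows ev_varX [simp]: "ev \<iota> x y z varX = x" and ev_varY [simp]: "ev \<iota> x y z varY = y"
    and ev_varZ [simp]: "ev \<iota> x y z varZ = z"
  by (simp_all add: ev_def varX_def varY_def varZ_def map_poly_pCons hom_0[OF \<iota>] hom_1[OF \<iota>]
      hom_0[OF hom_ev1[OF \<iota>]] hom_1[OF hom_ev1[OF \<iota>]] hom_0[OF hom_ev2[OF \<iota>]] hom_1[OF hom_ev2[OF \<iota>]])

lemma hom_ident: "unital_hom (\<lambda>x. x)"
  by (simp add: unital_hom_def)

lemma hom_const_poly: "unital_hom (\<lambda>c. [:c:])"
  by (simp add: unital_hom_def one_pCons)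

lemma poly_map_poly_altdef:
  fixes x :: "'r::comm_ring_1"
  shows "f 0 = 0 \<Longrightarrow> poly (map_poly f p) x = (\<Sum>i\<le>Polynomial.degree p. f (Polynomial.coeff p i) * x ^ i)"
  unfolding poly_altdef
  by (rule sum.mono_neutral_cong_left) (auto simp: coeff_map_poly map_poly_degree_leq intro!: le_degree)

lemma ev_altdef:
  assumes \<iota>: "unital_hom \<iota>"
  shows "ev \<iota> x y z F = (\<Sum>l\<le>Polynomial.degree F. (\<Sum>j\<le>Polynomial.degree (Polynomial.coeff F l).
    (\<Sum>i\<le>Polynomial.degree (Polynomial.coeff (Polynomial.coeff F l) j).
       \<iota> (Polynomial.coeff (Polynomial.coeff (Polynomial.coeff F l) j) i) * x ^ i) * y ^ j) * z ^ l)"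
  by (simp add: ev_def poly_map_poly_altdef hom_0[OF \<iota>] hom_0[OF hom_ev1[OF \<iota>]] hom_0[OF hom_ev2[OF \<iota>]])

lemma hom_ev_commute:
  assumes f: "unital_hom f" and \<iota>: "unital_hom \<iota>"
  shows "f (ev \<iota> x y z F) = ev (\<lambda>c. f (\<iota> c)) (f x) (f y) (f z) F"
  by (simp add: ev_altdef[OF \<iota>] ev_altdef[OF hom_comp[OF f \<iota>]] hom_sum[OF f] hom_mult[OF f] hom_power[OF f])

lemma ev_homogeneous:
  assumes \<iota>: "unital_hom \<iota>" and F: "is_form d F"
  shows "ev \<iota> (t * x) (t * y) (t * z) F = t ^ d * ev \<iota> x y z F"
proof -
  have "\<iota> (Polynomial.coeff (Polynomial.coeff (Polynomial.coeff F l) j) i) * (t * x) ^ i * (t * y) ^ j * (t * z) ^ l =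
      t ^ d * (\<iota> (Polynomial.coeff (Polynomial.coeff (Polynomial.coeff F l) j) i) * x ^ i * y ^ j * z ^ l)" for i j l
  proof (cases "Polynomial.coeff (Polynomial.coeff (Polynomial.coeff F l) j) i = 0")
    case False
    then have "d = i + j + l" using F unfolding is_form_def by metis
    then show ?thesis by (simp add: power_mult_distrib power_add mult_ac)
  qed (simp add: hom_0[OF \<iota>])
  then show ?thesis
    by (simp add: ev_altdef[OF \<iota>] sum_distrib_left sum_distrib_right)
qed

lemma eval3_conv_ev: "eval3 F v = ev_at (v $ 1) (v $ 2) (v $ 3) F"
proof -
  let ?h1 = "\<lambda>h. poly (map_poly (\<lambda>x. x) h) (v $ 1)" and ?h2 = "\<lambda>g. poly (map_poly (\<lambda>h. poly (map_poly (\<lambda>x. x) h) (v $ 1)) g) (v $ 2)"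
  have h2: "?h2 g = poly (poly g [:v $ 2:]) (v $ 1)" for g
    using poly_map_poly_hom[OF hom_ev1[OF hom_ident, of "v $ 1"], of g "[:v $ 2:]"] by simp
  have "ev_at (v $ 1) (v $ 2) (v $ 3) F = poly (map_poly ?h2 F) (?h2 [:[:v $ 3:]:])"
    by (simp add: ev_def map_poly_pCons)
  also have "\<dots> = ?h2 (poly F [:[:v $ 3:]:])"
    by (rule poly_map_poly_hom[OF hom_ev2[OF hom_ident]])
  finally show ?thesis by (simp only: h2 eval3_def)
qed

lemma eval3_vec: "eval3 F (vector [x, y, z]) = ev_at x y z F"
  by (simp add: eval3_conv_ev)

lemma form_0 [simp]: "is_form d 0"
  by (simp add: is_form_def)

lemma form_const3 [simp]: "is_form 0 (const3 c)"
  by (auto simp: is_form_def const3_def coeff_pCons split: nat.splits)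

lemma form_1 [simp]: "is_form 0 1"
  using form_const3[of 1] by (simp add: const3_def one_pCons)

lemma form_vars [simp]: "is_form 1 varX" "is_form 1 varY" "is_form 1 varZ"
  "is_form (Suc 0) varX" "is_form (Suc 0) varY" "is_form (Suc 0) varZ"
  by (auto simp: is_form_def varX_def varY_def varZ_def coeff_pCons split: nat.splits)

lemma form_add: "is_form d F \<Longrightarrow> is_form d G \<Longrightarrow> is_form d (F + G)"
  for F :: "'a::comm_ring_1 poly3"
  unfolding is_form_def by (metis add.right_neutral coeff_add)

lemma form_uminus: "is_form d F \<Longrightarrow> is_form d (- F)"
  for F :: "'a::comm_ring_1 poly3"
  by (auto simp: is_form_def)

lemma form_diff: "is_form d F \<Longrightarrow> is_form d G \<Longrightarrow> is_form d (F - G)"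
  for F :: "'a::comm_ring_1 poly3"
  using form_add[OF _ form_uminus] by fastforce

lemma form_mult:
  fixes F G :: "'a::comm_ring_1 poly3"
  assumes "is_form d F" "is_form e G" "n = d + e" shows "is_form n (F * G)"
  unfolding is_form_def
proof (intro allI impI)
  fix i j l
  assume "Polynomial.coeff (Polynomial.coeff (Polynomial.coeff (F * G) l) j) i \<noteq> 0"
  then obtain l' j' i' where
    *: "l' \<le> l" "j' \<le> j" "i' \<le> i"
      "Polynomial.coeff (Polynomial.coeff (Polynomial.coeff F l') j') i' *
       Polynomial.coeff (Polynomial.coeff (Polynomial.coeff G (l - l')) (j - j')) (i - i') \<noteq> 0"
    unfolding coeff_mult coeff_sum by (fastforce elim!: sum.not_neutral_contains_not_neutral)
  then have "i' + j' + l' = d" "(i - i') + (j - j') + (l - l') = e"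
    using assms(1,2) unfolding is_form_def by (metis mult_zero_left mult_zero_right)+
  then show "i + j + l = n" using *(1-3) assms(3) by linarith
qed

lemma form_power: "is_form d F \<Longrightarrow> n = d * k \<Longrightarrow> is_form n (F ^ k)"
  for F :: "'a::comm_ring_1 poly3"
  by (induction k arbitrary: n) (auto intro!: form_mult)

lemma form_sum: "(\<And>i. i \<in> A \<Longrightarrow> is_form d (f i)) \<Longrightarrow> is_form d (sum f A)"
  for f :: "'b \<Rightarrow> 'a::comm_ring_1 poly3"
  by (induction A rule: infinite_finite_induct) (auto intro: form_add)

lemma form_0_mult: "is_form 0 F \<Longrightarrow> is_form d G \<Longrightarrow> is_form d (F * G)"
  for F G :: "'a::comm_ring_1 poly3"
  by (rule form_mult) auto

lemma form_of_nat: "is_form 0 (of_nat n :: 'a::comm_ring_1 poly3)"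
  by (induction n) (auto intro: form_add)

lemma form_binary_form:
  assumes "is_form 1 l" "is_form 1 m" shows "is_form d (binary_form d a l m)"
  unfolding binary_form_def
proof (rule form_sum)
  fix i assume "i \<in> {..d}"
  then show "is_form d (const3 (a i) * l ^ i * m ^ (d - i))"
    by (intro form_mult[OF form_mult[OF form_const3 form_power[OF assms(1) HOL.refl] HOL.refl] form_power[OF assms(2) HOL.refl]]) simp
qed

lemma eval3_eq_0_imp_0:
  fixes F :: "'a::alg_closed_field poly3"
  assumes "\<And>x y z. ev_at x y z F = 0"
  shows "F = 0"
proof -
  note inf = infinite_alg_closed[where 'a='a]
  have e: "poly (poly (poly F [:[:z:]:]) [:y:]) x = 0" for x y z
    using assms[of x y z] eval3_conv_ev[of F "vector [x, y, z]"] by (simp add: eval3_def)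
  have "poly (poly F [:[:z:]:]) [:y:] = 0" for y z
    by (rule poly_eq_0_if_infinite[OF inf]) (simp add: e)
  then have "poly F [:[:z:]:] = 0" for z
    by (intro poly_eq_0_if_infinite[of "range (\<lambda>y. [:y:])"]) (auto simp: finite_image_iff inj_def inf)
  then show ?thesis
    by (intro poly_eq_0_if_infinite[of "range (\<lambda>z. [:[:z:]:])" F]) (auto simp: finite_image_iff inj_def inf)
qed

section \<open>Points of the projective plane\<close>

lemma smult_nonzero: "w \<noteq> 0 \<Longrightarrow> c \<noteq> 0 \<Longrightarrow> c *s w \<noteq> (0 :: 'a::Fields.field ^ 'n)"
  by (simp add: vector_mul_eq_0)

lemma point_eq: "w \<noteq> 0 \<Longrightarrow> point w = {c *s w | c. c \<noteq> 0}"
  unfolding point_def proj_rel_def by (auto simp: smult_nonzero)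

lemma mem_point: "w \<noteq> 0 \<Longrightarrow> w \<in> point w"
  by (auto simp: point_eq intro: exI[of _ 1])

lemma point_smult: "w \<noteq> 0 \<Longrightarrow> c \<noteq> 0 \<Longrightarrow> point (c *s w) = point w"
proof -
  assume w: "w \<noteq> 0" and c: "c \<noteq> 0"
  have "\<exists>e. d *s w = e *s (c *s w) \<and> e \<noteq> 0" if "d \<noteq> 0" for d
    using that c by (intro exI[of _ "d / c"]) (simp add: vector_smult_assoc)
  then show ?thesis
    using w c by (auto simp: point_eq smult_nonzero vector_smult_assoc)
qed

lemma projective_space_conv: "projective_space = {point w | w. w \<noteq> 0}"
  unfolding projective_space_def quotient_def point_def by auto

lemma vanishes_at_point:
  assumes F: "is_form d F" and w: "w \<noteq> 0"
  shows "vanishes_at F (point w) \<longleftrightarrow> eval3 F w = 0"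
proof -
  have "eval3 F (c *s w) = c ^ d * eval3 F w" for c
    using ev_homogeneous[OF hom_ident F, of c] by (simp add: eval3_conv_ev)
  then show ?thesis
    using w by (auto simp: vanishes_at_def point_eq intro: exI[of _ 1])
qed

lemma vec3_eq: "(v :: 'a::zero ^ 3) = vector [v $ 1, v $ 2, v $ 3]"
  by (simp add: vec_eq_iff forall_3)

lemma vec2_eq: "(v :: 'a::zero ^ 2) = vector [v $ 1, v $ 2]"
  by (simp add: vec_eq_iff forall_2)

lemma vec3_nonzero: "vector [x, y, z] \<noteq> (0 :: 'a::zero ^ 3) \<longleftrightarrow> x \<noteq> 0 \<or> y \<noteq> 0 \<or> z \<noteq> 0"
  by (simp add: vec_eq_iff forall_3)

lemma vec2_nonzero: "vector [x, y] \<noteq> (0 :: 'a::zero ^ 2) \<longleftrightarrow> x \<noteq> 0 \<or> y \<noteq> 0"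
  by (simp add: vec_eq_iff forall_2)

lemma vec3_smult: "c *s vector [x, y, z] = (vector [c * x, c * y, c * z] :: 'a::semiring_1 ^ 3)"
  by (simp add: vec_eq_iff forall_3)

section \<open>Irreducibility\<close>

lemma unit_const3: "c \<noteq> 0 \<Longrightarrow> const3 c dvd (1 :: 'a::Fields.field poly3)"
  by (rule dvdI[of _ _ "const3 (inverse c)"]) (simp add: const3_def one_pCons)

lemma hom_ev_poly: "unital_hom (ev_poly (x :: 'a::comm_ring_1 poly) y z)"
  by (rule hom_ev[OF hom_const_poly])

lemma poly_ev_poly: "poly (ev_poly x y z F) t = ev_at (poly x t) (poly y t) (poly z t) F"
  using hom_ev_commute[OF hom_poly[of t] hom_const_poly, of x y z F] by simp

text \<open>
  On a line through the origin of affine space on which \<open>F\<close> is not identically zero, \<open>F\<close> is a constant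
  multiple of \<open>t ^ d\<close>. A factor of a power of \<open>t\<close> not vanishing at \<open>t = 0\<close> is constant, so \<open>G\<close> equals its
  value at the origin wherever \<open>F\<close> is not zero, hence everywhere.
\<close>

lemma form_factor_constant:
  fixes F G H :: "'a::alg_closed_field poly3"
  assumes F: "is_form d F" "F \<noteq> 0" and GH: "F = G * H" and G0: "ev_at 0 0 0 G \<noteq> 0"
  shows "G dvd 1"
proof -
  define c where "c = ev_at 0 0 0 G"
  have const: "ev_at x y z G = c" if Fv: "ev_at x y z F \<noteq> 0" for x y z
  proof -
    define l where "l K = ev_poly [:0, x:] [:0, y:] [:0, z:] K" for K :: "'a poly3"
    have "l F = [:0, 1:] ^ d * [:ev_at x y z F:]"
      using ev_homogeneous[OF hom_const_poly F(1), of "[:0, 1:]" "[:x:]" "[:y:]" "[:z:]"]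
        hom_ev_commute[OF hom_const_poly hom_ident, of x y z F] by (simp add: l_def)
    then have "l G * l H = Polynomial.monom (ev_at x y z F) d"
      by (simp add: GH l_def hom_mult[OF hom_ev_poly] monom_altdef mult.commute)
    moreover have "poly (l G) 0 \<noteq> 0" using G0 by (simp add: l_def poly_ev_poly)
    then have "Polynomial.order 0 (l G) = 0" by (rule order_0I)
    moreover have nz: "l G * l H \<noteq> 0" using calculation Fv by simp
    ultimately have oH: "Polynomial.order 0 (l H) = d"
      using order_mult[OF nz, of 0] Fv by simp
    have nz': "l G \<noteq> 0" "l H \<noteq> 0" using nz by auto
    have "Polynomial.degree (l G) + Polynomial.degree (l H) = d"
      using degree_mult_eq[OF nz'] \<open>l G * l H = _\<close> Fv by (simp add: degree_monom_eq)
    then have "Polynomial.degree (l G) = 0"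
      using order_degree[of "l H" 0] nz oH by simp
    then obtain e where "l G = [:e:]" by (metis degree0_coeffs)
    then have "poly (l G) 1 = poly (l G) 0" by simp
    then show ?thesis by (simp add: l_def poly_ev_poly c_def)
  qed
  have "ev_at x y z ((G - const3 c) * F) = 0" for x y z
    using const[of x y z] by (cases "ev_at x y z F = 0")
      (simp_all add: hom_mult[OF hom_ev[OF hom_ident]] hom_diff[OF hom_ev[OF hom_ident]] ev_const3[OF hom_ident])
  then have "(G - const3 c) * F = 0" by (rule eval3_eq_0_imp_0)
  then have "G = const3 c" using F(2) by simp
  moreover have "const3 c dvd 1" using G0 by (intro unit_const3) (simp add: c_def)
  ultimately show ?thesis by (rule ssubst)
qed

text \<open>
  The line \<open>Y + Z = 0\<close> meets the curve \<open>F = 0\<close> only at \<open>(1:0:0)\<close>, and \<open>F\<close> vanishes there to first order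
  along another line. As in Eisenstein's criterion, modulo \<open>Y + Z\<close> the form is a constant times a power of
  \<open>Y\<close>, so every non-unit factor passes through \<open>(1:0:0)\<close>; two such factors would give \<open>F\<close> a double
  zero along the other line.
\<close>

lemma irreducible_form_total_flex:
  fixes F :: "'a::alg_closed_field poly3"
  assumes F: "is_form d F" and d: "d > 0"
    and flex: "\<And>x y. ev_at x y (- y) F = c * y ^ d" "c \<noteq> 0"
    and smooth: "\<And>z. ev_at 1 0 z F = e * z" "e \<noteq> 0"
  shows "Factorial_Ring.irreducible F"
proof (rule Factorial_Ring.irreducibleI)
  note hev = hom_ev[OF hom_ident]
  show F0: "F \<noteq> 0"
    using flex(1)[of 0 1] flex(2) by (auto simp: hom_0[OF hev])
  have "ev_at 0 0 0 F = 0" using flex(1)[of 0 0] d by simp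
  then show "\<not> F dvd 1"
    by (metis dvdE hom_1[OF hev] hom_mult[OF hev] mult_zero_left zero_neq_one)
  fix G H assume GH: "F = G * H"
  define r :: "'a poly3 \<Rightarrow> 'a poly poly" where "r K = poly K [:0, -1:]" for K
  have r: "poly (poly (r K) [:y:]) x = ev_at x y (- y) K" for K x y
  proof -
    have "poly (r K) [:y:] = poly (poly K [:[:- y:]:]) [:y:]"
      using poly_map_poly_hom[OF hom_poly, of "[:y:]" K "[:0, -1:]"]
        poly_map_poly_hom[OF hom_poly, of "[:y:]" K "[:[:- y:]:]"]
      by (simp add: r_def minus_pCons)
    then show ?thesis using eval3_conv_ev[of K "vector [x, y, - y]"] by (simp add: eval3_def)
  qed
  have rF: "r F = Polynomial.monom [:c:] d"
  proof -
    have "poly (r F - Polynomial.monom [:c:] d) [:y:] = 0" for y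
      by (rule poly_eq_0_if_infinite[OF infinite_alg_closed])
         (simp add: r flex poly_monom)
    then have "r F - Polynomial.monom [:c:] d = 0"
      by (intro poly_eq_0_if_infinite[of "range (\<lambda>y. [:y:])"])
         (auto simp: finite_image_iff inj_def infinite_alg_closed)
    then show ?thesis by simp
  qed
  \<comment> \<open>restricted to the line, a factor not vanishing there divides a power of \<open>Y\<close> and has nonzero
    constant term, so it is constant\<close>
  have vanish: "ev_at 1 0 0 A = 0" if AB: "F = A * B" and A: "\<not> A dvd 1" for A B
  proof (rule ccontr)
    assume "ev_at 1 0 0 A \<noteq> 0"
    then have "poly (r A) 0 \<noteq> 0" using r[of A 0 1] by auto
    then have oA: "Polynomial.order 0 (r A) = 0" by (rule order_0I)
    have rAB: "r A * r B = Polynomial.monom [:c:] d" using rF by (simp add: AB r_def)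
    then have nz: "r A * r B \<noteq> 0" using flex(2) by simp
    then have oB: "Polynomial.order 0 (r B) = d"
      using order_mult[OF nz, of 0] oA flex(2) by (simp add: rAB)
    have nz': "r A \<noteq> 0" "r B \<noteq> 0" using nz by auto
    have "Polynomial.degree (r A) + Polynomial.degree (r B) = d"
      using degree_mult_eq[OF nz'] flex(2) by (simp add: rAB degree_monom_eq)
    then have dA: "Polynomial.degree (r A) = 0"
      using order_degree[of "r B" 0] nz oB by simp
    then obtain a where a: "r A = [:a:]" by (metis degree0_coeffs)
    have "Polynomial.coeff (r A * r B) d = a * Polynomial.coeff (r B) d" by (simp add: a)
    then have "a * Polynomial.coeff (r B) d = [:c:]" by (simp add: rAB)
    then have "a dvd [:c:]" by (metis dvd_triv_left)
    then have "poly a 0 \<noteq> 0" using flex(2)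
      by (metis dvdE mult_zero_left pCons_0_0 poly_mult poly_pCons mult_zero_left add_0_right)
    then have "ev_at 0 0 0 A \<noteq> 0" using r[of A 0 0] by (simp add: a)
    then show False using form_factor_constant[OF F F0 AB] A by blast
  qed
  show "G dvd 1 \<or> H dvd 1"
  proof (rule ccontr)
    assume "\<not> (G dvd 1 \<or> H dvd 1)"
    then have v: "ev_at 1 0 0 G = 0" "ev_at 1 0 0 H = 0"
      using vanish[of G H] vanish[of H G] GH by (auto simp: mult.commute)
    define l where "l K = ev_poly [:1:] [:0:] [:0, 1:] K" for K :: "'a poly3"
    have "poly (l F - [:0, e:]) t = 0" for t
      using smooth(1)[of t] by (simp add: l_def poly_ev_poly)
    then have lF: "l F = [:0, e:]"
      using poly_eq_0_if_infinite[OF infinite_alg_closed, of "l F - [:0, e:]"] by simp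
    have "poly (l G) 0 = 0" "poly (l H) 0 = 0" using v by (simp_all add: l_def poly_ev_poly)
    then obtain g h where "l G = [:0, 1:] * g" "l H = [:0, 1:] * h"
      by (metis dvdE poly_eq_0_iff_dvd minus_zero)
    moreover have "l F = l G * l H" by (simp add: l_def GH hom_mult[OF hom_ev_poly])
    ultimately have "[:0, e:] = [:0, 1:] * ([:0, 1:] * (g * h))" using lF by (simp add: mult_ac)
    then have "Polynomial.coeff [:0, e:] 1 = Polynomial.coeff ([:0, 1:] * ([:0, 1:] * (g * h))) 1" by (rule arg_cong)
    then show False using smooth(2) by simp
  qed
qed

section \<open>Partial derivatives\<close>

text \<open>
  Formal differentiation in the innermost variable commutes with specializing the outer two.
\<close>

lemma pderiv_X:
  "pderiv (poly (poly F [:[:z:]:]) [:y:]) = poly (poly (map_poly (map_poly pderiv) F) [:[:z:]:]) [:y:]"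
  for F :: "'a::Fields.field poly3"
proof -
  have 1: "pderiv (poly g [:y:]) = poly (map_poly pderiv g) [:y:]" for g :: "'a poly poly"
    by (induction g) (simp_all add: map_poly_pCons pderiv_add pderiv_mult pderiv_pCons pderiv_smult)
  have 2: "map_poly pderiv (poly F [:[:z:]:]) = poly (map_poly (map_poly pderiv) F) [:[:z:]:]"
  proof (induction F)
    case (pCons a F)
    have "map_poly pderiv (a + [:[:z:]:] * b) = map_poly pderiv a + [:[:z:]:] * map_poly pderiv b" for b
      by (intro poly_eqI) (simp add: coeff_map_poly pderiv_add pderiv_smult)
    then show ?case using pCons by (simp add: map_poly_pCons)
  qed simp
  show ?thesis by (simp add: 1 2)
qed

section \<open>Projections\<close>

lemma linear_form:
  fixes l :: "'a::comm_ring_1 poly3"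
  assumes "is_form 1 l"
  obtains a b c where "l = const3 a * varX + const3 b * varY + const3 c * varZ"
proof
  let ?c = "\<lambda>i j k. Polynomial.coeff (Polynomial.coeff (Polynomial.coeff l k) j) i"
  have z: "?c i j k = 0" if "i + j + k \<noteq> 1" for i j k
    using assms that unfolding is_form_def by blast
  show "l = const3 (?c 1 0 0) * varX + const3 (?c 0 1 0) * varY + const3 (?c 0 0 1) * varZ"
    by (intro poly_eqI)
       (auto simp: const3_def varX_def varY_def varZ_def coeff_pCons z split: nat.splits)
qed

lemma projection_forms_swap: "projection_forms P l m \<longleftrightarrow> projection_forms P m l"
  unfolding projection_forms_def by (auto simp: conj_commute)

lemma projection_formsI:
  assumes l: "is_form 1 l" and m: "is_form 1 m" and w: "w \<noteq> 0"
    and "\<And>x y z. ev_at x y z l = 0 \<Longrightarrow> ev_at x y z m = 0 \<Longrightarrow> \<exists>c. vector [x, y, z] = c *s w"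
    and "eval3 l w = 0" "eval3 m w = 0"
  shows "projection_forms (point w) l m"
proof -
  have "point v = point w" if v: "v \<noteq> 0" "eval3 l v = 0" "eval3 m v = 0" for v
  proof -
    obtain c where "v = c *s w"
      using assms(4)[of "v $ 1" "v $ 2" "v $ 3"] v(2,3) vec3_eq[of v] by (auto simp: eval3_conv_ev)
    then show ?thesis using v(1) w by (cases "c = 0") (simp_all add: point_smult)
  qed
  note unique = this
  have "{Q \<in> projective_space. vanishes_at l Q \<and> vanishes_at m Q} = {point w}"
  proof (intro equalityI subsetI)
    fix Q assume Q: "Q \<in> {Q \<in> projective_space. vanishes_at l Q \<and> vanishes_at m Q}"
    then obtain v where v: "Q = point v" "v \<noteq> 0" unfolding projective_space_conv by blast
    then show "Q \<in> {point w}"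
      using Q unique[OF v(2)] vanishes_at_point[OF l v(2)] vanishes_at_point[OF m v(2)] by simp
  next
    fix Q assume "Q \<in> {point w}"
    then show "Q \<in> {Q \<in> projective_space. vanishes_at l Q \<and> vanishes_at m Q}"
      using w assms(5,6) vanishes_at_point[OF l w] vanishes_at_point[OF m w]
      by (auto simp: projective_space_conv)
  qed
  then show ?thesis using l m by (simp add: projection_forms_def)
qed

text \<open>
  The function field of the target of a projection is defined through all choices of two linear forms
  with common zero \<open>P\<close>. The second conjunct expresses every other choice through \<open>l\<close> and \<open>m\<close>.
\<close>

definition forms_through :: "('a::Fields.field ^ 3) set \<Rightarrow> 'a poly3 \<Rightarrow> 'a poly3 \<Rightarrow> bool" where
  "forms_through P l m \<longleftrightarrow> projection_forms P l m \<and>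
     (\<forall>l'. is_form 1 l' \<longrightarrow> vanishes_at l' P \<longrightarrow> (\<exists>a b. l' = const3 a * l + const3 b * m))"

lemma forms_through_swap: "forms_through P l m \<longleftrightarrow> forms_through P m l"
  unfolding forms_through_def by (metis projection_forms_swap add.commute)

lemmas ev_id_simps = hom_mult[OF hom_ev[OF hom_ident]] hom_add[OF hom_ev[OF hom_ident]]
  hom_diff[OF hom_ev[OF hom_ident]] hom_power[OF hom_ev[OF hom_ident]] ev_const3[OF hom_ident]
  ev_varX[OF hom_ident] ev_varY[OF hom_ident] ev_varZ[OF hom_ident]

lemma const3_mult: "const3 (a * b) = const3 a * const3 b"
  and const3_diff: "const3 (a - b) = const3 a - const3 b" and const3_uminus: "const3 (- a) = - const3 (a :: 'a::comm_ring_1)"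
  by (simp_all add: const3_def)

lemma const3_0 [simp]: "const3 0 = 0" by (simp add: const3_def)

lemma forms_through_affine:
  "forms_through (point (vector [1, y0, z0])) (varY - const3 y0 * varX) (varZ - const3 z0 * varX)"
  (is "forms_through ?P ?l ?m")
proof -
  have w: "vector [1, y0, z0] \<noteq> (0 :: 'a ^ 3)" by (simp add: vec3_nonzero)
  have f: "is_form 1 (varY - const3 y0 * varX)" "is_form 1 (varZ - const3 z0 * varX)"
    by (auto intro!: form_diff form_0_mult)
  have "projection_forms ?P ?l ?m"
    by (rule projection_formsI[OF f w]) (auto simp: eval3_vec ev_id_simps vec3_smult mult.commute)
  moreover have "\<exists>a b. l' = const3 a * ?l + const3 b * ?m" if l': "is_form 1 l'" "vanishes_at l' ?P" for l'
  proof -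
    obtain a b c where abc: "l' = const3 a * varX + const3 b * varY + const3 c * varZ"
      using linear_form[OF l'(1)] .
    have "a + b * y0 + c * z0 = 0"
      using l'(2) vanishes_at_point[OF l'(1) w] by (simp add: eval3_vec abc ev_id_simps)
    then have a: "a = - (b * y0) - c * z0" by (simp add: algebra_simps eq_neg_iff_add_eq_0)
    then have "l' = const3 b * ?l + const3 c * ?m"
      unfolding abc a const3_diff const3_mult const3_uminus by (simp add: algebra_simps)
    then show ?thesis by blast
  qed
  ultimately show ?thesis by (simp add: forms_through_def)
qed

lemma forms_through_Y: "forms_through (point (vector [0, 1, 0])) (varX :: 'a::Fields.field poly3) varZ"
proof -
  have w: "vector [0, 1, 0] \<noteq> (0 :: 'a ^ 3)" by (simp add: vec3_nonzero)
  have "projection_forms (point (vector [0, 1, 0])) (varX :: 'a poly3) varZ"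
    by (rule projection_formsI[OF _ _ w]) (auto simp: eval3_vec ev_id_simps vec3_smult)
  moreover have "\<exists>a b. l' = const3 a * varX + const3 b * varZ"
    if l': "is_form 1 l'" "vanishes_at l' (point (vector [0, 1, 0 :: 'a]))" for l'
  proof -
    obtain a b c where abc: "l' = const3 a * varX + const3 b * varY + const3 c * varZ"
      using linear_form[OF l'(1)] .
    have "b = 0"
      using l'(2) vanishes_at_point[OF l'(1) w] by (simp add: eval3_vec abc ev_id_simps)
    then show ?thesis using abc by auto
  qed
  ultimately show ?thesis by (simp add: forms_through_def)
qed

lemma forms_through_Z: "forms_through (point (vector [0, 0, 1])) (varX :: 'a::Fields.field poly3) varY"
proof -
  have w: "vector [0, 0, 1] \<noteq> (0 :: 'a ^ 3)" by (simp add: vec3_nonzero)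
  have "projection_forms (point (vector [0, 0, 1])) (varX :: 'a poly3) varY"
    by (rule projection_formsI[OF _ _ w]) (auto simp: eval3_vec ev_id_simps vec3_smult)
  moreover have "\<exists>a b. l' = const3 a * varX + const3 b * varY"
    if l': "is_form 1 l'" "vanishes_at l' (point (vector [0, 0, 1 :: 'a]))" for l'
  proof -
    obtain a b c where abc: "l' = const3 a * varX + const3 b * varY + const3 c * varZ"
      using linear_form[OF l'(1)] .
    have "c = 0"
      using l'(2) vanishes_at_point[OF l'(1) w] by (simp add: eval3_vec abc ev_id_simps)
    then show ?thesis using abc by auto
  qed
  ultimately show ?thesis by (simp add: forms_through_def)
qed

section \<open>Rational parametrizations\<close>

text \<open>
  A parametrization of \<open>C\<close> by polynomials \<open>x\<close>, \<open>y\<close>, \<open>z\<close> in \<open>T\<close>: a form vanishes on \<open>C\<close> if and only if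
  its pullback is zero. The forms \<open>A\<close> and \<open>B\<close>, whose quotient pulls back to \<open>T\<close>, witness that the
  parametrization is birational.
\<close>

locale curve_chart =
  fixes C :: "('a::alg_closed_field ^ 3) set set" and x y z :: "'a poly"
    and A B :: "'a poly3" and e :: nat
  assumes vanish: "\<And>d G. is_form d G \<Longrightarrow> vanishes_on G C \<longleftrightarrow> ev_poly x y z G = 0"
    and AB: "is_form e A" "is_form e B"
    and gen: "ev_poly x y z A = [:0, 1:] * ev_poly x y z B" "ev_poly x y z B \<noteq> 0"
begin

abbreviation pull :: "'a poly3 \<Rightarrow> 'a poly" where
  "pull \<equiv> ev_poly x y z"

lemmas hom_pull = hom_ev_poly[of x y z]

lemmas pull_simps = hom_simps[OF hom_pull] ev_const3[OF hom_const_poly]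
  ev_varX[OF hom_const_poly] ev_varY[OF hom_const_poly] ev_varZ[OF hom_const_poly]

text \<open>
  The isomorphism from \<open>k(T)\<close> onto the function field: the class of all fractions with pullback \<open>u\<close>.
\<close>

definition model :: "'a poly fract \<Rightarrow> ('a poly3 \<times> 'a poly3) set" where
  "model u = {(F, G). (F, G) \<in> fractions C \<and> Fract (pull F) (pull G) = u}"

lemma mem_fractions: "(F, G) \<in> fractions C \<longleftrightarrow> (\<exists>d. is_form d F \<and> is_form d G) \<and> pull G \<noteq> 0"
  unfolding fractions_def using vanish by auto

lemma frac_rel_iff:
  assumes "(F, G) \<in> fractions C" "(F', G') \<in> fractions C"
  shows "((F, G), (F', G')) \<in> frac_rel C \<longleftrightarrow> Fract (pull F) (pull G) = Fract (pull F') (pull G')"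
proof -
  obtain d d' where d: "is_form d F" "is_form d G" "is_form d' F'" "is_form d' G'"
    using assms by (auto simp: mem_fractions)
  have "is_form (d + d') (F * G' - F' * G)"
    by (intro form_diff form_mult[OF d(1,4)] form_mult[OF d(3,2)]) auto
  then have "vanishes_on (F * G' - F' * G) C \<longleftrightarrow> pull F * pull G' = pull F' * pull G"
    using vanish by (simp add: pull_simps)
  then show ?thesis using assms by (simp add: frac_rel_def mem_fractions eq_fract)
qed

lemma rat_fun_eq:
  assumes "(F, G) \<in> fractions C"
  shows "rat_fun C F G = model (Fract (pull F) (pull G))"
proof -
  have "((F, G), (F', G')) \<in> frac_rel C \<longleftrightarrow>
      (F', G') \<in> fractions C \<and> Fract (pull F') (pull G') = Fract (pull F) (pull G)" for F' G'
    using frac_rel_iff[OF assms, of F' G'] assms by (auto simp: frac_rel_def)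
  then show ?thesis by (auto simp: rat_fun_def model_def)
qed

text \<open>
  The common factor \<open>u\<close> reflects that homogeneous coordinates matter only up to scaling; it cancels
  from quotients of two binary forms of equal degree.
\<close>

lemma pull_binary_form:
  assumes l: "to_fract (pull l) = u * feval \<pi> a'" and m: "to_fract (pull m) = u * feval \<pi> b'"
  shows "to_fract (pull (binary_form d c l m)) =
    u ^ d * feval \<pi> (\<Sum>i\<le>d. Polynomial.smult (c i) (a' ^ i * b' ^ (d - i)))"
proof -
  have "to_fract (pull (binary_form d c l m)) =
      (\<Sum>i\<le>d. fconst (c i) * to_fract (pull l) ^ i * to_fract (pull m) ^ (d - i))"
    by (simp add: binary_form_def pull_simps fconst_def flip: hom_power[OF hom_to_fract] to_fract_mult)
  also have "\<dots> = (\<Sum>i\<le>d. u ^ d * (fconst (c i) * (feval \<pi> a' ^ i * feval \<pi> b' ^ (d - i))))"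
  proof (rule sum.cong[OF HOL.refl])
    fix i assume "i \<in> {..d}"
    then have "u ^ d = u ^ i * u ^ (d - i)" by (simp flip: power_add)
    then show "fconst (c i) * to_fract (pull l) ^ i * to_fract (pull m) ^ (d - i) =
        u ^ d * (fconst (c i) * (feval \<pi> a' ^ i * feval \<pi> b' ^ (d - i)))"
      unfolding l m power_mult_distrib by (simp only: mult_ac)
  qed
  also have "\<dots> = u ^ d * feval \<pi> (\<Sum>i\<le>d. Polynomial.smult (c i) (a' ^ i * b' ^ (d - i)))"
  proof -
    have "feval \<pi> (Polynomial.smult e p) = fconst e * feval \<pi> p" for e p
      using hom_mult[OF hom_feval[of \<pi>], of "[:e:]" p] by simp
    then show ?thesis by (simp add: hom_simps[OF hom_feval] sum_distrib_left)
  qed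
  finally show ?thesis .
qed

lemma sum_monom: "Polynomial.degree a \<le> d \<Longrightarrow>
  (\<Sum>i\<le>d. Polynomial.smult (Polynomial.coeff a i) ([:0, 1:] ^ i * [:1:] ^ (d - i))) = a"
proof -
  assume "Polynomial.degree a \<le> d"
  then have "a = (\<Sum>i\<le>d. Polynomial.monom (Polynomial.coeff a i) i)"
    by (intro poly_eqI) (auto simp: coeff_sum coeff_eq_0)
  then show ?thesis by (simp add: monom_altdef flip: one_pCons)
qed

text \<open>
  Homogenize numerator and denominator of \<open>u\<close> and substitute \<open>A\<close> and \<open>B\<close> for the two variables.
\<close>

lemma surj_model: obtains F G where "(F, G) \<in> fractions C" "Fract (pull F) (pull G) = u"
proof -
  obtain a b where ab: "u = Fract a b" "b \<noteq> 0" by (cases u)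
  define d where "d = max (Polynomial.degree a) (Polynomial.degree b)"
  have *: "to_fract (pull (binary_form d (Polynomial.coeff p) A B)) = to_fract (pull B) ^ d * to_fract p"
    if "Polynomial.degree p \<le> d" for p
  proof -
    have 1: "to_fract (pull A) = to_fract (pull B) * feval fvar [:0, 1:]"
      by (simp only: gen(1) feval_fvar to_fract_mult mult.commute)
    have 2: "to_fract (pull B) = to_fract (pull B) * feval fvar [:1:]" by simp
    show ?thesis by (simp only: pull_binary_form[OF 1 2] sum_monom[OF that] feval_fvar)
  qed
  let ?F = "binary_form d (Polynomial.coeff a) A B" and ?G = "binary_form d (Polynomial.coeff b) A B"
  have F: "to_fract (pull ?F) = to_fract (pull B) ^ d * to_fract a"
    and G: "to_fract (pull ?G) = to_fract (pull B) ^ d * to_fract b"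
    by (intro *; simp add: d_def)+
  have form: "is_form (e * d) (binary_form d c A B)" for c
    unfolding binary_form_def
  proof (rule form_sum)
    fix i assume "i \<in> {..d}"
    then have "e * d = e * i + e * (d - i)" by (simp flip: distrib_left)
    then show "is_form (e * d) (const3 (c i) * A ^ i * B ^ (d - i))"
      by (intro form_mult[OF form_mult[OF form_const3 form_power[OF AB(1) HOL.refl] HOL.refl]
            form_power[OF AB(2) HOL.refl]]) simp
  qed
  have "pull ?G \<noteq> 0" using G gen(2) ab(2) by (metis mult_eq_0_iff power_eq_0_iff to_fract_eq_0_iff)
  then have "(?F, ?G) \<in> fractions C" using form by (auto simp: mem_fractions)
  moreover have "Fract (pull ?F) (pull ?G) = u"
    unfolding Fract_conv_to_fract F G ab(1) using gen(2) by simp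
  ultimately show ?thesis by (rule that)
qed

lemma model_nonempty: "\<exists>F G. (F, G) \<in> model u"
proof -
  obtain F G where "(F, G) \<in> fractions C" "Fract (pull F) (pull G) = u" by (rule surj_model)
  then show ?thesis by (auto simp: model_def)
qed

lemma mem_modelD: "(F, G) \<in> model u \<Longrightarrow> (F, G) \<in> fractions C" "(F, G) \<in> model u \<Longrightarrow> Fract (pull F) (pull G) = u"
  by (auto simp: model_def)

lemma UN_model:
  assumes "\<And>F G F' G'. (F, G) \<in> model u \<Longrightarrow> (F', G') \<in> model v \<Longrightarrow> h F G F' G' = S"
  shows "(\<Union>(F, G)\<in>model u. \<Union>(F', G')\<in>model v. h F G F' G') = S"
  using model_nonempty[of u] model_nonempty[of v] assms by fastforce

lemma field_model: "field_model (function_field C) model"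
proof
  show "inj model"
  proof (rule injI)
    fix u v assume "model u = model v"
    then show "u = v" using model_nonempty[of u] mem_modelD(2) by blast
  qed
  show "carrier (function_field C) = range model"
  proof (intro equalityI subsetI)
    fix c assume "c \<in> carrier (function_field C)"
    then obtain F G where "(F, G) \<in> fractions C" "c = rat_fun C F G"
      by (auto simp: function_field_def quotient_def rat_fun_def)
    then show "c \<in> range model" by (simp add: rat_fun_eq)
  next
    fix c assume "c \<in> range model"
    then obtain u where u: "c = model u" by blast
    obtain F G where FG: "(F, G) \<in> fractions C" "Fract (pull F) (pull G) = u" by (rule surj_model)
    then have "c = frac_rel C `` {(F, G)}" using rat_fun_eq[OF FG(1)] by (simp add: u rat_fun_def)
    then show "c \<in> carrier (function_field C)" using FG(1) by (auto simp: function_field_def quotient_def)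
  qed
  show "model u \<otimes>\<^bsub>function_field C\<^esub> model v = model (u * v)" for u v
  proof -
    have "rat_fun C (F * F') (G * G') = model (u * v)"
      if FG: "(F, G) \<in> model u" "(F', G') \<in> model v" for F G F' G'
    proof -
      have "(F * F', G * G') \<in> fractions C"
        using mem_modelD(1)[OF FG(1)] mem_modelD(1)[OF FG(2)] unfolding mem_fractions
        by (auto simp: pull_simps intro: form_mult)
      then show ?thesis
        using mem_modelD(2)[OF FG(1)] mem_modelD(2)[OF FG(2)] by (auto simp: rat_fun_eq pull_simps)
    qed
    then show ?thesis by (simp add: function_field_def UN_model)
  qed
  show "model u \<oplus>\<^bsub>function_field C\<^esub> model v = model (u + v)" for u v
  proof -
    have "rat_fun C (F * G' + F' * G) (G * G') = model (u + v)"
      if FG: "(F, G) \<in> model u" "(F', G') \<in> model v" for F G F' G'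
    proof -
      note m = mem_modelD(1)[OF FG(1)] mem_modelD(1)[OF FG(2)]
      obtain d d' where d: "is_form d F" "is_form d G" "is_form d' F'" "is_form d' G'" and nz: "pull G \<noteq> 0" "pull G' \<noteq> 0"
        using m by (auto simp: mem_fractions)
      have "is_form (d + d') (F * G' + F' * G)" "is_form (d + d') (G * G')"
        by (auto intro!: form_add form_mult[OF d(1,4)] form_mult[OF d(3,2)] form_mult[OF d(2,4)])
      then have "(F * G' + F' * G, G * G') \<in> fractions C"
        using nz by (auto simp: mem_fractions pull_simps)
      then show ?thesis
        using mem_modelD(2)[OF FG(1)] mem_modelD(2)[OF FG(2)] nz by (auto simp: rat_fun_eq pull_simps)
    qed
    then show ?thesis by (simp add: function_field_def UN_model)
  qed
  have c: "(const3 c, 1) \<in> fractions C" for c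
    unfolding mem_fractions by (auto simp: pull_simps intro: form_const3 form_1)
  show "\<zero>\<^bsub>function_field C\<^esub> = model 0" "\<one>\<^bsub>function_field C\<^esub> = model 1"
    using rat_fun_eq[OF c[of 0]] rat_fun_eq[OF c[of 1]]
    by (simp_all add: function_field_def pull_simps Zero_fract_def One_fract_def const3_def one_pCons[symmetric])
qed

text \<open>
  The subfield belonging to the projection is \<open>k(\<pi>)\<close>, where \<open>\<pi>\<close> is the pullback of the quotient of any
  two independent linear forms through the centre.
\<close>

lemma projection_subfield_eq:
  assumes P: "forms_through P l0 m0" and nz: "pull m0 \<noteq> 0"
    and \<pi>: "\<pi> = Fract (pull l0) (pull m0)" "transcendental_fract \<pi>"
  shows "projection_subfield C P = model ` range (fsubst \<pi>)"
proof (intro equalityI subsetI)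
  define u where "u = to_fract (pull m0)"
  have u: "u \<noteq> 0" using nz by (simp add: u_def)
  have l0: "to_fract (pull l0) = u * \<pi>" using nz by (simp add: u_def \<pi>(1) Fract_conv_to_fract)
  have pf: "projection_forms P l0 m0" using P by (simp add: forms_through_def)
  have f0: "is_form 1 l0" "is_form 1 m0" using pf by (simp_all add: projection_forms_def)
  {
    fix c assume "c \<in> projection_subfield C P"
    then obtain l m d a b where c: "c = rat_fun C (binary_form d a l m) (binary_form d b l m)"
      and lm: "projection_forms P l m" and nv: "\<not> vanishes_on (binary_form d b l m) C"
      unfolding projection_subfield_def by blast
    have f: "is_form 1 l" "is_form 1 m" using lm by (simp_all add: projection_forms_def)
    have "vanishes_at l P" "vanishes_at m P" using lm unfolding projection_forms_def by blast+
    then obtain \<alpha> \<beta> \<gamma> \<delta> where eqs: "l = const3 \<alpha> * l0 + const3 \<beta> * m0" "m = const3 \<gamma> * l0 + const3 \<delta> * m0"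
      using P f unfolding forms_through_def by metis
    have lin: "to_fract (pull (const3 a * l0 + const3 b * m0)) = u * feval \<pi> [:b, a:]" for a b
    proof -
      have "to_fract (pull (const3 a * l0 + const3 b * m0)) = fconst a * to_fract (pull l0) + fconst b * to_fract (pull m0)"
        unfolding pull_simps fconst_def to_fract_add to_fract_mult ..
      also have "\<dots> = u * feval \<pi> [:b, a:]"
        unfolding l0 u_def[symmetric] by (simp add: algebra_simps)
      finally show ?thesis .
    qed
    define p where "p c = (\<Sum>i\<le>d. Polynomial.smult (c i) ([:\<beta>, \<alpha>:] ^ i * [:\<delta>, \<gamma>:] ^ (d - i)))" for c
    have bf: "to_fract (pull (binary_form d c l m)) = u ^ d * feval \<pi> (p c)" for c
      unfolding p_def by (rule pull_binary_form) (simp_all only: eqs lin)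
    have form: "is_form d (binary_form d c l m)" for c by (rule form_binary_form[OF f])
    have nzb: "pull (binary_form d b l m) \<noteq> 0" using nv vanish[OF form] by simp
    then have "feval \<pi> (p b) \<noteq> 0" using bf[of b] by (metis mult_zero_right to_fract_eq_0_iff)
    then have pb: "p b \<noteq> 0" by auto
    have "c = model (Fract (pull (binary_form d a l m)) (pull (binary_form d b l m)))"
      unfolding c by (rule rat_fun_eq) (use form nzb in \<open>auto simp: mem_fractions\<close>)
    also have "Fract (pull (binary_form d a l m)) (pull (binary_form d b l m)) = fsubst \<pi> (Fract (p a) (p b))"
      using u by (simp add: Fract_conv_to_fract[of "pull _"] bf fsubst_Fract[OF \<pi>(2) pb])
    finally show "c \<in> model ` range (fsubst \<pi>)" by simp
  next
    fix c assume "c \<in> model ` range (fsubst \<pi>)"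
    then obtain v where v: "c = model (fsubst \<pi> v)" by blast
    obtain a b where ab: "v = Fract a b" "b \<noteq> 0" by (cases v)
    define d where "d = max (Polynomial.degree a) (Polynomial.degree b)"
    have bf: "to_fract (pull (binary_form d (Polynomial.coeff p) l0 m0)) = u ^ d * feval \<pi> p"
      if "Polynomial.degree p \<le> d" for p
    proof -
      have 1: "to_fract (pull l0) = u * feval \<pi> [:0, 1:]" by (simp add: l0)
      have 2: "to_fract (pull m0) = u * feval \<pi> [:1:]" by (simp add: u_def)
      show ?thesis by (simp only: pull_binary_form[OF 1 2] sum_monom[OF that])
    qed
    let ?F = "binary_form d (Polynomial.coeff a) l0 m0" and ?G = "binary_form d (Polynomial.coeff b) l0 m0"
    have F: "to_fract (pull ?F) = u ^ d * feval \<pi> a" and G: "to_fract (pull ?G) = u ^ d * feval \<pi> b"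
      by (intro bf; simp add: d_def)+
    have form: "is_form d ?F" "is_form d ?G" by (intro form_binary_form f0)+
    have "feval \<pi> b \<noteq> 0" using ab(2) \<pi>(2) by (auto simp: transcendental_fract_def)
    then have nzG: "pull ?G \<noteq> 0" using G u by (metis mult_eq_0_iff power_eq_0_iff to_fract_eq_0_iff)
    have "rat_fun C ?F ?G = model (Fract (pull ?F) (pull ?G))"
      by (rule rat_fun_eq) (use form nzG in \<open>auto simp: mem_fractions\<close>)
    also have "Fract (pull ?F) (pull ?G) = fsubst \<pi> v"
      unfolding Fract_conv_to_fract[of "pull _"] F G ab(1) fsubst_Fract[OF \<pi>(2) ab(2)] using u by simp
    finally have "c = rat_fun C ?F ?G" by (simp add: v)
    moreover have "\<not> vanishes_on ?G C" using vanish[OF form(2)] nzG by simp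
    ultimately show "c \<in> projection_subfield C P"
      using pf unfolding projection_subfield_def by blast
  }
qed

end

section \<open>The curve and its equation\<close>

text \<open>
  The coordinates of the parametrization with \<open>q = 2 m + 1\<close>, in an arbitrary ring, so that \<open>s\<close> and \<open>t\<close>
  may be field elements or polynomials.
\<close>

definition pX :: "nat \<Rightarrow> 'r::comm_ring_1 \<Rightarrow> 'r \<Rightarrow> 'r" where "pX m s t = s ^ (m + 1) * t ^ m"
definition pY :: "nat \<Rightarrow> 'r::comm_ring_1 \<Rightarrow> 'r \<Rightarrow> 'r" where "pY m s t = (s - t) * t ^ (2 * m)"
definition pZ :: "nat \<Rightarrow> 'r::comm_ring_1 \<Rightarrow> 'r \<Rightarrow> 'r" where "pZ m s t = s ^ (2 * m + 1) - s * t ^ (2 * m)"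

lemma p_hom:
  assumes "unital_hom f"
  shows "f (pX m s t) = pX m (f s) (f t)" "f (pY m s t) = pY m (f s) (f t)" "f (pZ m s t) = pZ m (f s) (f t)"
  by (simp_all add: pX_def pY_def pZ_def hom_mult[OF assms] hom_power[OF assms] hom_diff[OF assms])

lemma p_scale:
  "pX m (c * s) (c * t) = c ^ (2 * m + 1) * pX m s t"
  "pY m (c * s) (c * t) = c ^ (2 * m + 1) * pY m s t"
  "pZ m (c * s) (c * t) = c ^ (2 * m + 1) * pZ m s t"
proof -
  have 1: "c ^ (2 * m) = c ^ m * c ^ m" by (simp add: mult_2 power_add)
  then have 2: "c ^ (2 * m + 1) = c * (c ^ m * c ^ m)" by simp
  show "pX m (c * s) (c * t) = c ^ (2 * m + 1) * pX m s t"
    "pY m (c * s) (c * t) = c ^ (2 * m + 1) * pY m s t"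
    "pZ m (c * s) (c * t) = c ^ (2 * m + 1) * pZ m s t"
    unfolding pX_def pY_def pZ_def power_mult_distrib 1 2 by (simp_all add: algebra_simps)
qed

text \<open>
  The polynomial expressing \<open>a ^ n + b ^ n\<close> through \<open>z = a + b\<close> and \<open>W = - a b\<close> (a Lucas sequence).
\<close>

fun power_sum :: "'r::comm_ring_1 \<Rightarrow> 'r \<Rightarrow> nat \<Rightarrow> 'r" where
  "power_sum z W 0 = 2"
| "power_sum z W (Suc 0) = z"
| "power_sum z W (Suc (Suc n)) = z * power_sum z W (Suc n) + W * power_sum z W n"

lemma power_sum_eq: "power_sum (a + b) (- (a * b)) n = a ^ n + b ^ n"
  by (induction n rule: induct_nat_012) (simp_all add: algebra_simps)

lemma power_sum_hom: "unital_hom f \<Longrightarrow> f (power_sum z W n) = power_sum (f z) (f W) n"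
proof (induction n rule: induct_nat_012)
  case 0
  then show ?case using hom_of_nat[of f 2] by simp
qed (simp_all add: hom_add hom_mult)

lemma form_power_sum:
  assumes "is_form 1 z" "is_form 2 W" shows "is_form n (power_sum z W n)"
proof (induction n rule: induct_nat_012)
  case 0
  show ?case using form_of_nat[of 2] by simp
next
  case 1
  show ?case using assms by simp
next
  case (ge2 n)
  then show ?case by (auto intro!: form_add form_mult[OF assms(1)] form_mult[OF assms(2)])
qed

text \<open>
  The equation of the curve: the form of \<open>curve_form_factors\<close>, which is symmetric in \<open>a\<close> and \<open>b\<close>,
  with \<open>a + b\<close> and \<open>a b\<close> replaced by \<open>z\<close> and \<open>- x ^ 2\<close>.
\<close>

definition curve_form :: "nat \<Rightarrow> 'r::comm_ring_1 \<Rightarrow> 'r \<Rightarrow> 'r \<Rightarrow> 'r" where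
  "curve_form m x y z = x * (y\<^sup>2 + z * y - x\<^sup>2) ^ m - (- 1) ^ m * x ^ (2 * m + 1) +
     (- 1) ^ m * (\<Sum>j\<le>m. of_nat (m choose j) * (- y) ^ j * x ^ (2 * (m - j)) * power_sum z (x\<^sup>2) (Suc j))"

lemma curve_form_hom: "unital_hom f \<Longrightarrow> f (curve_form m x y z) = curve_form m (f x) (f y) (f z)"
proof -
  assume f: "unital_hom f"
  show ?thesis by (simp add: curve_form_def hom_simps[OF f] power_sum_hom[OF f] del: power_sum.simps)
qed

lemma form_curve_form: "is_form (2 * m + 1) (curve_form m varX varY (varZ :: 'a::comm_ring_1 poly3))"
proof -
  have W: "is_form 2 (varX\<^sup>2 :: 'a poly3)" by (rule form_power[of 1]) auto
  have "is_form (2 * m + 1) (of_nat (m choose j) * (- varY) ^ j * varX ^ (2 * (m - j)) * power_sum varZ (varX\<^sup>2) (Suc j) :: 'a poly3)"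
    if "j \<le> m" for j
  proof -
    have "is_form j ((- varY) ^ j :: 'a poly3)" by (rule form_power[of 1]) (auto intro: form_uminus)
    moreover have "is_form (2 * (m - j)) (varX ^ (2 * (m - j)) :: 'a poly3)" by (rule form_power[of 1]) auto
    ultimately show ?thesis
      using that by (intro form_mult[OF form_mult[OF form_0_mult[OF form_of_nat] _ HOL.refl] form_power_sum[OF _ W]]) auto
  qed
  moreover have "is_form 2 (varY\<^sup>2 + varZ * varY - varX\<^sup>2 :: 'a poly3)"
    using W by (auto intro!: form_diff form_add form_power[of 1] form_mult[of 1 _ 1])
  then have "is_form (2 * m) ((varY\<^sup>2 + varZ * varY - varX\<^sup>2 :: 'a poly3) ^ m)" by (rule form_power) simp
  moreover have s: "is_form 0 ((- 1) ^ m :: 'a poly3)" by (rule form_power[of 0]) (auto intro: form_uminus)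
  moreover have "is_form (2 * m + 1) (varX ^ (2 * m + 1) :: 'a poly3)" by (rule form_power[of 1]) auto
  ultimately show ?thesis
    unfolding curve_form_def
    by (auto intro!: form_add form_diff form_0_mult[OF s] form_sum form_mult[of 1 varX "2 * m"])
qed

lemma curve_form_factors:
  fixes a b x y z :: "'r::comm_ring_1"
  assumes z: "z = a + b" and x: "x\<^sup>2 = - (a * b)"
  shows "curve_form m x y z = x * ((y + a) ^ m * (y + b) ^ m - (a * b) ^ m) + a ^ (m + 1) * (y + b) ^ m + b ^ (m + 1) * (y + a) ^ m"
proof -
  have s: "(\<Sum>j\<le>m. of_nat (m choose j) * (- y) ^ j * (- (a * b)) ^ (m - j) * c ^ Suc j) = (- 1) ^ m * (c ^ (m + 1) * (y + d) ^ m)"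
    if cd: "c * d = a * b" for c d
  proof -
    have "of_nat (m choose j) * (- y) ^ j * (- (a * b)) ^ (m - j) * c ^ Suc j =
        c * (of_nat (m choose j) * (- (c * y)) ^ j * (- (c * d)) ^ (m - j))" for j
      by (simp add: cd power_mult_distrib[of c] minus_mult_right[of c] mult_ac del: mult_minus_right)
    then have "(\<Sum>j\<le>m. of_nat (m choose j) * (- y) ^ j * (- (a * b)) ^ (m - j) * c ^ Suc j) = c * (- (c * y) + - (c * d)) ^ m"
      by (simp only: binomial_ring sum_distrib_left)
    also have "- (c * y) + - (c * d) = (- 1) * (c * (y + d))" by (simp add: algebra_simps)
    also have "c * ((- 1) * (c * (y + d))) ^ m = (- 1) ^ m * (c ^ (m + 1) * (y + d) ^ m)"
      unfolding power_mult_distrib by (simp add: mult_ac)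
    finally show ?thesis .
  qed
  have X2: "x ^ (2 * k) = (- (a * b)) ^ k" for k by (simp add: power_mult x)
  have sign: "(- 1) ^ m * ((- 1) ^ m * x) = x" for x :: 'r by (simp flip: mult.assoc power_add power_mult_distrib)
  have "(\<Sum>j\<le>m. of_nat (m choose j) * (- y) ^ j * x ^ (2 * (m - j)) * power_sum z (x\<^sup>2) (Suc j)) =
      (\<Sum>j\<le>m. of_nat (m choose j) * (- y) ^ j * (- (a * b)) ^ (m - j) * a ^ Suc j) +
      (\<Sum>j\<le>m. of_nat (m choose j) * (- y) ^ j * (- (a * b)) ^ (m - j) * b ^ Suc j)"
    unfolding sum.distrib[symmetric] X2 z x power_sum_eq by (simp only: distrib_left)
  also have "\<dots> = (- 1) ^ m * (a ^ (m + 1) * (y + b) ^ m + b ^ (m + 1) * (y + a) ^ m)"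
    using s[of a b] s[of b a] by (simp add: mult.commute distrib_left)
  finally have S: "(- 1) ^ m * (\<Sum>j\<le>m. of_nat (m choose j) * (- y) ^ j * x ^ (2 * (m - j)) * power_sum z (x\<^sup>2) (Suc j)) =
      a ^ (m + 1) * (y + b) ^ m + b ^ (m + 1) * (y + a) ^ m"
    by (simp only: sign)
  have "x ^ (2 * m + 1) = (- 1) ^ m * (x * (a * b) ^ m)"
    using X2[of m] by (simp add: power_minus[of "a * b"] mult_ac)
  then have T: "(- 1) ^ m * x ^ (2 * m + 1) = x * (a * b) ^ m" by (simp only: sign)
  have e: "y\<^sup>2 + z * y - x\<^sup>2 = (y + a) * (y + b)" unfolding x z by (simp add: power2_eq_square algebra_simps)
  show ?thesis
    unfolding curve_form_def S T e power_mult_distrib by (simp add: algebra_simps)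
qed

text \<open>
  The conjugate of an equation between \<open>x\<close>, \<open>y\<close> and \<open>b\<close> that holds along the curve. Vanishing of the form
  at a point off the line \<open>x = 0\<close> thus means that the equation holds for one of the two roots.
\<close>

lemma curve_form_product:
  fixes a b x y z :: "'r::comm_ring_1"
  assumes z: "z = a + b" and x: "x\<^sup>2 = - (a * b)"
  shows "x * curve_form m x y z = (x * (y + a) ^ m + a ^ (m + 1)) * (x * (y + b) ^ m + b ^ (m + 1))"
proof -
  have x': "x * x = - (a * b)" using x by (simp add: power2_eq_square)
  have "(x * (y + a) ^ m + a ^ (m + 1)) * (x * (y + b) ^ m + b ^ (m + 1)) =
      (x * x) * ((y + a) ^ m * (y + b) ^ m) + x * (a ^ (m + 1) * (y + b) ^ m + b ^ (m + 1) * (y + a) ^ m) + (a * b) * (a * b) ^ m"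
    by (simp add: power_mult_distrib algebra_simps)
  also have "(a * b) * (a * b) ^ m = - ((x * x) * (a * b) ^ m)" by (simp add: x')
  finally show ?thesis unfolding curve_form_factors[OF assms] by (simp add: algebra_simps)
qed

lemma quadratic_roots:
  fixes z W :: "'a::alg_closed_field"
  obtains a b where "z = a + b" "W = - (a * b)"
proof -
  have "Polynomial.degree [:- W, - z, 1:] > 0" by simp
  then obtain a where "poly [:- W, - z, 1:] a = 0" using alg_closed_imp_poly_has_root by blast
  then have "W = - (a * (z - a))" by (simp add: algebra_simps eq_neg_iff_add_eq_0)
  then show ?thesis using that[of a "z - a"] by simp
qed

text \<open>
  The bound \<open>m \<ge> 2\<close> says that the point \<open>(0:0:1)\<close> is singular.
\<close>

locale galois_curve =
  fixes q m :: nat and C :: "('a::alg_closed_field ^ 3) set set"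
  assumes q: "q = 2 * m + 1" and m: "m \<ge> 2"
    and char_power: "\<exists>e. q = CHAR('a) ^ e" and prime_char: "Factorial_Ring.prime CHAR('a)"
    and C: "C = phi1 q ` projective_space"
begin

lemma frobenius: "(x + y) ^ q = x ^ q + y ^ q" for x y :: 'a
  using freshmans_dream' prime_char char_power by blast

lemma frobenius_poly: "(x + y) ^ q = x ^ q + y ^ q" for x y :: "'a poly"
proof -
  have "CHAR('a poly) = CHAR('a)"
    by (rule CHAR_eqI) (simp_all add: of_nat_poly of_nat_eq_0_iff_char_dvd)
  then show ?thesis using freshmans_dream'[where 'a="'a poly"] prime_char char_power by metis
qed

lemma odd_q: "odd q" and q0: "q > 0" and q_def: "2 * m + 1 = q" "Suc (2 * m) = q"
  by (simp_all add: q)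

lemma neg_q: "(- x) ^ q = - (x ^ q)" for x :: "'r::comm_ring_1"
  using odd_q by simp

lemma frobenius_poly_diff: "(x - y) ^ q = x ^ q - y ^ q" for x y :: "'a poly"
  using frobenius_poly[of x "- y"] by (simp add: neg_q)

lemma of_nat_q: "of_nat q = (0 :: 'a)"
proof -
  obtain e where e: "q = CHAR('a) ^ e" using char_power by blast
  then have "e > 0" using m q by (cases e) auto
  then show ?thesis by (simp add: e)
qed

lemma two_m: "2 * of_nat m = (- 1 :: 'a)"
  using of_nat_q by (simp add: q eq_neg_iff_add_eq_0 add.commute)

definition phi :: "'a \<Rightarrow> 'a \<Rightarrow> 'a ^ 3" where
  "phi s t = vector [pX m s t, pY m s t, pZ m s t]"

lemma phi1_vec_eq: "phi1_vec q v = phi (v $ 1) (v $ 2)"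
  by (simp add: phi1_vec_def phi_def pX_def pY_def pZ_def q Let_def)

lemma phi_nonzero: "s \<noteq> 0 \<or> t \<noteq> 0 \<Longrightarrow> phi s t \<noteq> 0"
  using m by (auto simp: phi_def vec3_nonzero pX_def pY_def pZ_def power_0_left)

lemma phi_scale: "phi (c * s) (c * t) = c ^ q *s phi s t"
  by (simp add: phi_def p_scale vec3_smult q)

lemma phi1_point:
  assumes "s \<noteq> 0 \<or> t \<noteq> 0" shows "phi1 q (point (vector [s, t])) = point (phi s t)"
proof -
  have w: "vector [s, t] \<noteq> (0 :: 'a ^ 2)" using assms by (simp add: vec2_nonzero)
  have "point (phi1_vec q v) = point (phi s t)" if v: "v \<in> point (vector [s, t])" for v
  proof -
    obtain c where c: "v = c *s vector [s, t]" "c \<noteq> 0" using v unfolding point_eq[OF w] by blast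
    then have "phi1_vec q v = c ^ q *s phi s t" by (simp add: phi1_vec_eq phi_scale)
    then show ?thesis using point_smult[OF phi_nonzero[OF assms]] c(2) by simp
  qed
  moreover have "vector [s, t] \<in> point (vector [s, t] :: 'a ^ 2)" by (rule mem_point[OF w])
  ultimately show ?thesis unfolding phi1_def by blast
qed

lemma C_eq: "C = {point (phi s t) | s t. s \<noteq> 0 \<or> t \<noteq> 0}"
proof (intro equalityI subsetI)
  fix P assume "P \<in> C"
  then obtain w :: "'a ^ 2" where w: "w \<noteq> 0" "P = phi1 q (point w)" by (auto simp: C projective_space_conv)
  have nz: "w $ 1 \<noteq> 0 \<or> w $ 2 \<noteq> 0" using w(1) vec2_eq[of w] vec2_nonzero by metis
  have "P = point (phi (w $ 1) (w $ 2))" using w(2) phi1_point[OF nz] vec2_eq[of w] by simp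
  then show "P \<in> {point (phi s t) | s t. s \<noteq> 0 \<or> t \<noteq> 0}" using nz by blast
next
  fix P assume "P \<in> {point (phi s t) | s t. s \<noteq> 0 \<or> t \<noteq> 0}"
  then obtain s t where st: "P = point (phi s t)" "s \<noteq> 0 \<or> t \<noteq> 0" by blast
  then have "P = phi1 q (point (vector [s, t]))" by (simp add: phi1_point)
  moreover have "point (vector [s, t] :: 'a ^ 2) \<in> projective_space"
    unfolding projective_space_conv using st(2) vec2_nonzero by blast
  ultimately show "P \<in> C" by (simp add: C)
qed

subsection \<open>The defining form\<close>

definition form :: "'a poly3" where "form = curve_form m varX varY varZ"

lemma is_form_form: "is_form q form"
  using form_curve_form by (simp add: form_def q)

lemma ev_form: "ev_at x y z form = curve_form m x y z"
  by (simp add: form_def curve_form_hom[OF hom_ev[OF hom_ident]] ev_id_simps)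

text \<open>
  With \<open>a = s ^ q\<close> and \<open>b = - s t ^ (2 m)\<close> one has \<open>Y + b = - t ^ q\<close>, and the terms cancel in pairs. The
  shorter route through \<open>curve_form_product\<close> would leave the case \<open>X = 0\<close> open.
\<close>

lemma curve_form_phi: "curve_form m (pX m s t) (pY m s t) (pZ m s t) = 0" for s t :: 'a
proof -
  let ?a = "s ^ q" and ?b = "- (s * t ^ (2 * m))"
  have z: "pZ m s t = ?a + ?b" by (simp add: pZ_def q)
  have x: "(pX m s t)\<^sup>2 = - (?a * ?b)"
  proof -
    have 1: "(pX m s t)\<^sup>2 = s ^ ((m + 1) * 2) * t ^ (m * 2)"
      unfolding pX_def power_mult_distrib power_mult by (rule HOL.refl)
    have 2: "- (?a * ?b) = s ^ (q + 1) * t ^ (2 * m)" by simp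
    have 3: "(m + 1) * 2 = q + 1" "m * 2 = 2 * m" by (simp_all add: q)
    show ?thesis unfolding 1 2 3 ..
  qed
  have Yb: "pY m s t + ?b = - (t ^ q)" by (simp add: pY_def q algebra_simps)
  have tq: "(t ^ q) ^ m * t ^ m = (t ^ (2 * m)) ^ (m + 1)"
    unfolding power_mult[symmetric] power_add[symmetric] by (rule arg_cong[of _ _ "power t"]) (simp add: q algebra_simps)
  have "pX m s t * (- (t ^ q)) ^ m + ?b ^ (m + 1) =
      (- 1) ^ m * (s ^ (m + 1) * ((t ^ q) ^ m * t ^ m)) + (- 1) ^ (m + 1) * (s ^ (m + 1) * (t ^ (2 * m)) ^ (m + 1))"
    unfolding pX_def power_minus[of "t ^ q"] power_minus[of "s * _"] power_mult_distrib by (simp add: mult_ac)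
  also have "\<dots> = 0" unfolding tq by simp
  finally have 1: "pX m s t * (- (t ^ q)) ^ m + ?b ^ (m + 1) = 0" .
  have 2: "?a ^ (m + 1) * (- (t ^ q)) ^ m = pX m s t * (?a * ?b) ^ m"
  proof -
    have 3: "?a ^ (m + 1) * (- (t ^ q)) ^ m = (- 1) ^ m * (s ^ (q * (m + 1)) * t ^ (q * m))"
    proof -
      have "?a ^ (m + 1) = s ^ (q * (m + 1))" "(t ^ q) ^ m = t ^ (q * m)" by (simp_all only: power_mult)
      then show ?thesis unfolding power_minus[of "t ^ q"] by (simp only: mult_ac)
    qed
    have 4: "pX m s t * (?a * ?b) ^ m = (- 1) ^ m * (s ^ (m + 1 + (q * m + m)) * t ^ (m + 2 * m * m))"
    proof -
      have e: "(s ^ q) ^ m = s ^ (q * m)" "(t ^ (2 * m)) ^ m = t ^ (2 * m * m)" by (simp_all only: power_mult)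
      show ?thesis
        unfolding pX_def power_mult_distrib power_minus[of "s * _"] e power_add by (simp only: mult_ac)
    qed
    have 5: "m + 1 + (q * m + m) = q * (m + 1)" "m + 2 * m * m = q * m" by (simp_all add: q algebra_simps)
    show ?thesis unfolding 3 4 5 ..
  qed
  have "curve_form m (pX m s t) (pY m s t) (pZ m s t) =
      (pY m s t + ?a) ^ m * (pX m s t * (- (t ^ q)) ^ m + ?b ^ (m + 1)) +
      (?a ^ (m + 1) * (- (t ^ q)) ^ m - pX m s t * (?a * ?b) ^ m)"
    unfolding curve_form_factors[OF z x] Yb by (simp add: algebra_simps)
  then show ?thesis unfolding 1 2 by simp
qed

text \<open>
  The zero set is not larger than the image. Off the line \<open>X = 0\<close> let \<open>b\<close> be the root for which
  \<open>X (Y + b) ^ m + b ^ (m + 1) = 0\<close>. On the curve \<open>Y + b\<close> is \<open>- t ^ q\<close>, so scaling by \<open>c = - 1 / (Y + b)\<close>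
  normalizes to \<open>t = 1\<close>, where \<open>b\<close> is \<open>- s\<close>; this dictates \<open>s = - c b\<close>.
\<close>

lemma curve_form_zero_imp:
  assumes F: "curve_form m x y z = 0" and nz: "vector [x, y, z] \<noteq> (0 :: 'a ^ 3)"
  shows "\<exists>s t. (s \<noteq> 0 \<or> t \<noteq> 0) \<and> (\<exists>c. c \<noteq> 0 \<and> phi s t = c *s vector [x, y, z])"
proof (cases "x = 0")
  case True
  have "curve_form m x y z = z ^ (m + 1) * y ^ m"
    using curve_form_factors[of z z 0 x m y] m by (simp add: True power_0_left)
  then have "z = 0 \<or> y = 0" using F by auto
  then show ?thesis
  proof
    assume z: "z = 0"
    then have "y \<noteq> 0" using nz True by (simp add: vec3_nonzero)
    then show ?thesis
      using m by (intro exI[of _ 0] exI[of _ 1] conjI exI[of _ "- 1 / y"])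
        (simp_all add: phi_def pX_def pY_def pZ_def vec3_smult True z power_0_left)
  next
    assume y: "y = 0"
    then have "z \<noteq> 0" using nz True by (simp add: vec3_nonzero)
    then show ?thesis
      using m by (intro exI[of _ 1] exI[of _ 0] conjI exI[of _ "1 / z"])
        (simp_all add: phi_def pX_def pY_def pZ_def vec3_smult True y power_0_left)
  qed
next
  case X0: False
  have main: ?thesis if ab: "z = a + b" "x\<^sup>2 = - (a * b)" and b: "x * (y + b) ^ m + b ^ (m + 1) = 0" for a b
  proof -
    have ab0: "a \<noteq> 0" "b \<noteq> 0" using ab(2) X0 by auto
    have Yb: "y + b \<noteq> 0" using b ab0(2) m by (auto simp: power_0_left)
    define c where "c = - 1 / (y + b)"
    have c: "c \<noteq> 0" "c * (y + b) = - 1" using Yb by (simp_all add: c_def)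
    define s where "s = - (c * b)"
    have "c * y = c * (y + b) - c * b" by (simp add: distrib_left)
    then have y: "c * y = s - 1" unfolding c(2) by (simp add: s_def)
    have "c ^ (m + 1) * (x * (y + b) ^ m + b ^ (m + 1)) = (c * x) * (c * (y + b)) ^ m + (c * b) ^ (m + 1)"
      unfolding power_mult_distrib[of c] by (simp add: algebra_simps)
    then have "(c * x) * (- 1) ^ m + (- s) ^ (m + 1) = 0" using b c(2) by (simp add: s_def)
    then have "(- 1) ^ m * (c * x - s ^ (m + 1)) = 0"
      unfolding power_minus[of s "m + 1"] by (simp add: algebra_simps)
    then have x: "c * x = s ^ (m + 1)" by simp
    have s0: "s \<noteq> 0" using c(1) ab0 by (simp add: s_def)
    have "(c * x)\<^sup>2 = s * (c * a)" using ab(2) by (simp add: power_mult_distrib s_def power2_eq_square algebra_simps)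
    then have "s * (c * a) = s * s ^ q"
    proof -
      have "(s ^ (m + 1))\<^sup>2 = s ^ ((m + 1) * 2)" by (simp only: power_mult)
      also have "(m + 1) * 2 = Suc q" by (simp add: q)
      finally show "(c * x)\<^sup>2 = s * (c * a) \<Longrightarrow> s * (c * a) = s * s ^ q" unfolding x by simp
    qed
    then have "c * a = s ^ q" using s0 by simp
    then have z: "c * z = s ^ q - s" using ab(1) by (simp add: s_def algebra_simps)
    have "phi s 1 = c *s vector [x, y, z]"
      by (simp add: phi_def pX_def pY_def pZ_def vec3_smult x y z q)
    then show ?thesis using c(1) by (intro exI[of _ s] exI[of _ 1]) auto
  qed
  obtain a b where ab: "z = a + b" "x\<^sup>2 = - (a * b)" using quadratic_roots .
  have "(x * (y + a) ^ m + a ^ (m + 1)) * (x * (y + b) ^ m + b ^ (m + 1)) = 0"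
    using curve_form_product[OF ab, of m y] F by simp
  then have "x * (y + a) ^ m + a ^ (m + 1) = 0 \<or> x * (y + b) ^ m + b ^ (m + 1) = 0"
    by (simp only: mult_eq_0_iff)
  moreover have "z = b + a" "x\<^sup>2 = - (b * a)" using ab by (simp_all add: add.commute mult.commute)
  ultimately show ?thesis using main[OF ab] main[of b a] by blast
qed

lemma C_zero_set: "C = {P \<in> projective_space. vanishes_at form P}"
proof (intro equalityI subsetI)
  fix P assume "P \<in> C"
  then obtain s t where st: "P = point (phi s t)" "s \<noteq> 0 \<or> t \<noteq> 0" by (auto simp: C_eq)
  note nz = phi_nonzero[OF st(2)]
  show "P \<in> {P \<in> projective_space. vanishes_at form P}"
    using nz vanishes_at_point[OF is_form_form nz]
    by (auto simp: st(1) projective_space_conv phi_def eval3_vec ev_form curve_form_phi)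
next
  fix P assume "P \<in> {P \<in> projective_space. vanishes_at form P}"
  then obtain w where w: "P = point w" "w \<noteq> 0" "vanishes_at form P" by (auto simp: projective_space_conv)
  obtain x y z where W: "w = vector [x, y, z]" using vec3_eq by blast
  have "curve_form m x y z = 0"
    using w vanishes_at_point[OF is_form_form w(2)] by (simp add: W eval3_vec ev_form)
  moreover have "vector [x, y, z] \<noteq> (0 :: 'a ^ 3)" using w(2) unfolding W .
  ultimately obtain s t c where st: "s \<noteq> 0 \<or> t \<noteq> 0" "c \<noteq> 0" "phi s t = c *s w"
    using curve_form_zero_imp[of x y z] unfolding W[symmetric] by blast
  have "P = point (phi s t)" using point_smult[OF w(2) st(2)] by (simp add: w(1) st(3))
  then show "P \<in> C" using st(1) unfolding C_eq by blast
qed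

text \<open>
  On the line \<open>Y + Z = 0\<close> one has \<open>y + a = - b\<close> and \<open>y + b = - a\<close>, so the first summand vanishes and the
  others add up to \<open>a ^ q + b ^ q\<close> up to sign, a \<open>q\<close>-th power since \<open>q\<close> is a power of the characteristic.
\<close>

lemma ev_form_line: "ev_at x y (- y) form = - ((- 1) ^ m) * y ^ q" for x y :: 'a
proof -
  obtain a b where ab: "- y = a + b" "x\<^sup>2 = - (a * b)" using quadratic_roots .
  have y: "y = - a - b" using ab(1) by (metis minus_minus minus_add_distrib diff_conv_add_uminus)
  have "curve_form m x y (- y) = (- 1) ^ m * (a ^ q + b ^ q)"
  proof -
    have pw: "c ^ (m + 1) * (- c) ^ m = (- 1) ^ m * c ^ q" for c :: 'a
    proof -
      have "c ^ (m + 1) * c ^ m = c ^ q" unfolding power_add[symmetric] by (rule arg_cong[of _ _ "power c"]) (simp add: q)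
      then have "c ^ q = c ^ (m + 1) * c ^ m" by (rule HOL.sym)
      then show ?thesis by (simp only: power_minus[of c] mult_ac)
    qed
    have "(- b) ^ m * (- a) ^ m = (a * b) ^ m" by (simp add: mult.commute flip: power_mult_distrib)
    moreover have "y + a = - b" "y + b = - a" by (simp_all add: y)
    ultimately show ?thesis unfolding curve_form_factors[OF ab] by (simp only: pw distrib_left) simp
  qed
  also have "\<dots> = (- 1) ^ m * (- y) ^ q" using frobenius[of a b] ab(1) by simp
  finally show ?thesis by (simp add: ev_form neg_q)
qed

lemma ev_form_at_P2: "ev_at 1 0 z form = (- 1) ^ m * z" for z :: 'a
proof -
  obtain a b where ab: "z = a + b" "1 = - (a * b)" using quadratic_roots .
  have b: "a * b = - 1" using ab(2) by (metis minus_minus)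
  have "curve_form m 1 0 z = (a * b) ^ m * (a + b)"
    using curve_form_factors[of z a b 1 m 0] ab by (simp add: power_mult_distrib algebra_simps)
  then show ?thesis using b ab(1) by (simp add: ev_form)
qed

lemma defining_form_C: "defining_form q form C"
proof -
  have "Factorial_Ring.irreducible form"
    by (rule irreducible_form_total_flex[OF is_form_form q0 ev_form_line _ ev_form_at_P2]) simp_all
  then show ?thesis using is_form_form C_zero_set by (simp add: defining_form_def)
qed

text \<open>
  The linear term in \<open>Z\<close> along the line \<open>(1:0:Z)\<close> is the partial derivative by \<open>Z\<close> at \<open>P2\<close>.
\<close>

lemma smooth_P2: "smooth_point C (point (vector [1, 0, 0]))"
proof -
  define h where "h g = poly (poly g [:0:]) 1" for g :: "'a poly poly"
  have h: "unital_hom h" unfolding h_def by (rule hom_comp[OF hom_poly hom_poly])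
  have ev: "eval3 G (vector [1, 0, z]) = poly (map_poly h G) z" for G z
    using poly_map_poly_hom[OF h, of G "[:[:z:]:]"] by (simp add: eval3_def h_def)
  have "poly (map_poly h form - [:0, (- 1) ^ m:]) z = 0" for z
    using ev[of form z] ev_form_at_P2[of z] by (simp add: eval3_vec mult.commute)
  then have "map_poly h form = [:0, (- 1) ^ m:]"
    using poly_eq_0_if_infinite[OF infinite_alg_closed, of "map_poly h form - [:0, (- 1) ^ m:]"] by simp
  then have "Polynomial.coeff (map_poly h form) 1 = (- 1) ^ m" by simp
  then have "h (Polynomial.coeff form 1) = (- 1) ^ m" by (simp add: coeff_map_poly hom_0[OF h])
  moreover have "eval3 (pderiv form) (vector [1, 0, 0]) = h (Polynomial.coeff form 1)"
    by (simp add: ev poly_0_coeff_0 coeff_map_poly hom_0[OF h] coeff_pderiv)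
  ultimately have e: "eval3 (pderiv form) (vector [1, 0, 0]) \<noteq> 0" by simp
  have w: "vector [1, 0, 0] \<noteq> (0 :: 'a ^ 3)" by (simp add: vec3_nonzero)
  have "\<not> vanishes_at (pderiv form) (point (vector [1, 0, 0]))"
    using e mem_point[OF w] unfolding vanishes_at_def by blast
  moreover have "point (vector [1, 0, 0]) \<in> C"
    unfolding C_zero_set using w vanishes_at_point[OF is_form_form w] ev_form_at_P2[of 0]
    by (auto simp: projective_space_conv eval3_vec)
  ultimately show ?thesis using defining_form_C unfolding smooth_point_def partials_def by blast
qed

lemma ev_form_at_P1:
  "\<exists>g. (\<forall>x. ev_at x 1 0 form = x * poly g x) \<and> poly g (0 :: 'a) = 1"
proof (intro exI conjI allI)
  let ?g = "[:1, 1:] ^ m * [:1, -1:] ^ m - [:0, 0, - 1:] ^ m + [:0, 1:] ^ m * [:1, - 1:] ^ m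
      + (- 1) ^ (m + 1) * [:0, 1:] ^ m * [:1, 1:] ^ m :: 'a poly"
  show "poly ?g 0 = 1" using m by (simp add: power_0_left)
  show "ev_at x 1 0 form = x * poly ?g x" for x :: 'a
  proof -
    have 1: "(0 :: 'a) = x + (- x)" and 2: "x\<^sup>2 = - (x * (- x))" by (simp_all add: power2_eq_square)
    have "poly ?g x = (1 + x) ^ m * (1 - x) ^ m - (- (x * x)) ^ m + x ^ m * (1 - x) ^ m + (- 1) ^ (m + 1) * x ^ m * (1 + x) ^ m"
      by simp
    then show ?thesis
      unfolding ev_form curve_form_factors[OF 1 2] power_minus[of x "m + 1"]
      by (simp add: algebra_simps)
  qed
qed

text \<open>
  The partial derivative by \<open>X\<close> at \<open>P1\<close> is read off along the line \<open>(X:1:0)\<close>.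
\<close>

lemma smooth_P1: "smooth_point C (point (vector [0, 1, 0]))"
proof -
  obtain g where g: "\<And>x. ev_at x 1 0 form = x * poly g x" "poly g (0 :: 'a) = 1"
    using ev_form_at_P1 by blast
  define f where "f = poly (poly form [:[:0:]:]) [:1:]"
  have f: "poly f x = eval3 form (vector [x, 1, 0])" for x by (simp add: f_def eval3_def)
  have "poly (f - [:0, 1:] * g) x = 0" for x
    using g(1)[of x] f[of x] by (simp add: eval3_vec)
  then have "f = [:0, 1:] * g"
    using poly_eq_0_if_infinite[OF infinite_alg_closed, of "f - [:0, 1:] * g"] by simp
  then have "poly (pderiv f) 0 = 1" using g(2) by (simp add: pderiv_pCons)
  then have e: "eval3 (map_poly (map_poly pderiv) form) (vector [0, 1, 0]) = 1"
    using pderiv_X[of form 0 1] by (simp add: f_def eval3_def)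
  have w: "vector [0, 1, 0] \<noteq> (0 :: 'a ^ 3)" by (simp add: vec3_nonzero)
  have "\<not> vanishes_at (map_poly (map_poly pderiv) form) (point (vector [0, 1, 0]))"
    using e mem_point[OF w] unfolding vanishes_at_def by fastforce
  moreover have "point (vector [0, 1, 0]) \<in> C"
    unfolding C_zero_set using w vanishes_at_point[OF is_form_form w] g(1)[of 0]
    by (auto simp: projective_space_conv eval3_vec)
  ultimately show ?thesis using defining_form_C unfolding smooth_point_def partials_def by blast
qed

end

section \<open>Multiplicities in the fibres of a projection\<close>

lemma degree_eq_sum_order:
  fixes p :: "'a::alg_closed_field poly"
  assumes "p \<noteq> 0"
  shows "Polynomial.degree p = (\<Sum>b\<in>{b. poly p b = 0}. Polynomial.order b p)"
proof -
  obtain A where A: "size A = Polynomial.degree p"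
      "p = Polynomial.smult (Polynomial.lead_coeff p) (\<Prod>x\<in>#A. [:-x, 1:])"
    using alg_closed_imp_factorization[OF assms] by blast
  have "proots (\<Prod>x\<in>#A. [:-x, 1:]) = A"
  proof (induction A)
    case (add x A)
    have "(\<Prod>x\<in>#A. [:-x, 1:]) \<noteq> 0" by (auto simp: prod_mset_zero_iff)
    then show ?case using add by (simp add: proots_mult del: mult_pCons_left)
  qed simp
  then have "proots p = A" using assms by (subst A(2)) simp
  then have "Polynomial.degree p = size (proots p)" using A(1) by simp
  also have "\<dots> = (\<Sum>b\<in>{b. poly p b = 0}. Polynomial.order b p)"
    using assms by (simp add: size_multiset_overloaded_eq)
  finally show ?thesis .
qed

lemma order_le_Suc_order_pderiv:
  fixes p :: "'a::Fields.field poly"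
  assumes "pderiv p \<noteq> 0"
  shows "Polynomial.order b p \<le> Suc (Polynomial.order b (pderiv p))"
proof (cases "Polynomial.order b p")
  case (Suc n)
  obtain r where r: "p = [:- b, 1:] ^ Suc n * r" using order_1[of b p] Suc by (metis dvdE)
  have "[:- b, 1:] ^ n dvd pderiv p"
    unfolding r lemma_order_pderiv1 by (intro dvd_add dvd_mult2 le_imp_power_dvd dvd_smult dvd_mult) auto
  then show ?thesis using assms Suc by (simp add: order_divides)
qed simp

lemma common_factor:
  fixes N0 M0 :: "'a::alg_closed_field poly"
  assumes "N0 \<noteq> 0" "M0 \<noteq> 0"
  shows "\<exists>N M D. N0 = N * D \<and> M0 = M * D \<and> (\<forall>x. poly N x = 0 \<longrightarrow> poly M x \<noteq> 0)"
  using assms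
proof (induction "Polynomial.degree N0" arbitrary: N0 M0 rule: less_induct)
  case less
  show ?case
  proof (cases "\<exists>a. poly N0 a = 0 \<and> poly M0 a = 0")
    case False
    then show ?thesis by (intro exI[of _ N0] exI[of _ M0] exI[of _ 1]) auto
  next
    case True
    then obtain a N1 M1 where a: "N0 = [:- a, 1:] * N1" "M0 = [:- a, 1:] * M1"
      by (metis dvdE poly_eq_0_iff_dvd)
    have nz: "N1 \<noteq> 0" "M1 \<noteq> 0" using less.prems a by auto
    have "Polynomial.degree N1 < Polynomial.degree N0"
      unfolding a(1) using nz(1) by (subst degree_mult_eq) auto
    then obtain N M D where IH: "N1 = N * D" "M1 = M * D" "\<forall>x. poly N x = 0 \<longrightarrow> poly M x \<noteq> 0"
      using less.hyps nz by blast
    then show ?thesis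
      by (intro exI[of _ N] exI[of _ M] exI[of _ "[:- a, 1:] * D"]) (simp add: a mult.left_commute del: mult_pCons_left)
  qed
qed

context curve_chart
begin

text \<open>
  For a Galois point all zeros of \<open>\<pi> = l0 / m0\<close> on the parameter line have the same multiplicity:
  \<open>ramification_divides\<close> gives divisibility in both directions. The pullbacks of \<open>l0\<close> and \<open>m0\<close> share
  the parameters of the centre as common zeros, so multiplicities in the fibre are differences of orders.
\<close>

theorem galois_point_orders:
  assumes gal: "galois_point C P" and P: "forms_through P l0 m0"
    and deg: "Polynomial.degree (pull m0) < Polynomial.degree (pull l0)" and M0: "pull m0 \<noteq> 0"
    and b: "Polynomial.order b (pull m0) < Polynomial.order b (pull l0)"
    and c: "Polynomial.order c (pull m0) < Polynomial.order c (pull l0)"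
  shows "Polynomial.order b (pull l0) - Polynomial.order b (pull m0) =
    Polynomial.order c (pull l0) - Polynomial.order c (pull m0)"
proof -
  have N0: "pull l0 \<noteq> 0" using deg by auto
  obtain N M D where NMD: "pull l0 = N * D" "pull m0 = M * D" "\<forall>x. poly N x = 0 \<longrightarrow> poly M x \<noteq> 0"
    using common_factor[OF N0 M0] by blast
  have nz: "N \<noteq> 0" "M \<noteq> 0" "D \<noteq> 0" using N0 M0 NMD by auto
  have "Fract (pull l0) (pull m0) = Fract N M"
    unfolding NMD using mult_fract_cancel[OF nz(3), of N M] by (simp add: mult.commute)
  then interpret R: rational_function N M "Fract (pull l0) (pull m0)"
    using nz NMD(3) deg by unfold_locales (auto simp: NMD(1,2) degree_mult_eq)
  interpret F: field_model "function_field C" model by (rule field_model)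
  let ?\<pi> = "Fract (pull l0) (pull m0)"
  have eq: "projection_subfield C P = model ` range (fsubst ?\<pi>)"
    by (rule projection_subfield_eq[OF P M0 HOL.refl R.transcendental])
  have "galois_extension (function_field C) (model ` range (fsubst ?\<pi>))"
    using gal by (simp add: galois_point_def eq)
  then obtain zs where zs: "coeffs_in (range (fsubst ?\<pi>)) (\<Prod>z\<leftarrow>zs. [:- z, 1:])" "fvar \<in> set zs"
    "\<And>g. coeffs_in (range (fsubst ?\<pi>)) g \<Longrightarrow> poly g fvar = 0 \<Longrightarrow> (\<Prod>z\<leftarrow>zs. [:- z, 1:]) dvd g"
    using F.galois_extensionD[OF _ range_hom_subfield[OF hom_fsubst[OF R.transcendental]], of fvar] by blast
  note split = R.fibre_poly_splits[OF zs]
  have ord: "Polynomial.order a (pull l0) = Polynomial.order a N + Polynomial.order a D"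
    "Polynomial.order a (pull m0) = Polynomial.order a M + Polynomial.order a D" for a
    unfolding NMD using nz by (simp_all add: order_mult)
  have zero: "Polynomial.order a M = 0" if "poly N a = 0" for a
    using that NMD(3) by (intro order_0I) blast
  have root: "poly N a = 0" if "Polynomial.order a (pull m0) < Polynomial.order a (pull l0)" for a
    using that ord[of a] nz(1) order_root[of N a] by auto
  have "Polynomial.order a (pull l0) - Polynomial.order a (pull m0) = Polynomial.order a N"
    if "Polynomial.order a (pull m0) < Polynomial.order a (pull l0)" for a
    using ord[of a] zero[OF root[OF that]] by simp
  then show ?thesis
    using R.ramification_divides[OF split] root[OF b] root[OF c] b c dvd_antisym by metis
qed

end

context galois_curve
begin

subsection \<open>Coordinates on the parameter line\<close>

text \<open>
  Forms pulled back along the parametrization itself, and along its restriction to an affine chart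
  \<open>c \<mapsto> (\<sigma>(c) : \<tau>(c))\<close> of the line.
\<close>

definition val_at :: "'a poly3 \<Rightarrow> 'a \<Rightarrow> 'a \<Rightarrow> 'a" where
  "val_at G s t = ev_at (pX m s t) (pY m s t) (pZ m s t) G"

definition pull_at :: "'a poly \<Rightarrow> 'a poly \<Rightarrow> 'a poly3 \<Rightarrow> 'a poly" where
  "pull_at \<sigma> \<tau> = ev_poly (pX m \<sigma> \<tau>) (pY m \<sigma> \<tau>) (pZ m \<sigma> \<tau>)"

lemma poly_pull_at: "poly (pull_at \<sigma> \<tau> G) c = val_at G (poly \<sigma> c) (poly \<tau> c)"
  by (simp add: pull_at_def val_at_def poly_ev_poly p_hom[OF hom_poly])

lemma val_at_scale: "is_form d G \<Longrightarrow> val_at G (c * s) (c * t) = (c ^ q) ^ d * val_at G s t"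
  unfolding val_at_def p_scale q_def by (rule ev_homogeneous[OF hom_ident])

lemma vanishes_on_C: "is_form d G \<Longrightarrow> vanishes_on G C \<longleftrightarrow> (\<forall>s t. s \<noteq> 0 \<or> t \<noteq> 0 \<longrightarrow> val_at G s t = 0)"
proof -
  assume G: "is_form d G"
  have "vanishes_at G (point (phi s t)) \<longleftrightarrow> val_at G s t = 0" if "s \<noteq> 0 \<or> t \<noteq> 0" for s t
    using vanishes_at_point[OF G phi_nonzero[OF that]] by (simp add: phi_def val_at_def eval3_vec)
  then show ?thesis unfolding vanishes_on_def C_eq by blast
qed

lemma val_at_zero_everywhere:
  assumes "\<And>s t. s \<noteq> 0 \<Longrightarrow> t \<noteq> 0 \<Longrightarrow> val_at G s t = 0"
  shows "val_at G s t = 0"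
proof -
  have inf: "infinite (UNIV - {0 :: 'a})" using infinite_alg_closed by simp
  have 1: "val_at G s t = 0" if "t \<noteq> 0" for s t
  proof -
    have "pull_at [:0, 1:] [:t:] G = 0"
      by (rule poly_eq_0_if_infinite[OF inf]) (simp add: poly_pull_at assms that)
    then show ?thesis using poly_pull_at[of "[:0, 1:]" "[:t:]" G s] by simp
  qed
  have "pull_at [:s:] [:0, 1:] G = 0"
    by (rule poly_eq_0_if_infinite[OF inf]) (simp add: poly_pull_at 1)
  then show ?thesis using poly_pull_at[of "[:s:]" "[:0, 1:]" G t] by simp
qed

text \<open>
  A chart reaching all points of the line with two nonzero coordinates suffices to test vanishing on
  the curve, as a polynomial vanishes everywhere if it does so outside a finite set.
\<close>

lemma vanishes_on_chart:
  assumes G: "is_form d G"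
    and cover: "\<And>s t. s \<noteq> 0 \<Longrightarrow> t \<noteq> 0 \<Longrightarrow> \<exists>c l. s = l * poly \<sigma> c \<and> t = l * poly \<tau> c"
    and nz: "\<And>c. poly \<sigma> c \<noteq> 0 \<or> poly \<tau> c \<noteq> 0"
  shows "vanishes_on G C \<longleftrightarrow> pull_at \<sigma> \<tau> G = 0"
proof
  assume "vanishes_on G C"
  then show "pull_at \<sigma> \<tau> G = 0"
    using nz by (intro poly_eq_0_if_infinite[OF infinite_alg_closed]) (auto simp: poly_pull_at vanishes_on_C[OF G])
next
  assume p: "pull_at \<sigma> \<tau> G = 0"
  have "val_at G s t = 0" if st: "s \<noteq> 0" "t \<noteq> 0" for s t
  proof -
    obtain c l where c: "s = l * poly \<sigma> c" "t = l * poly \<tau> c" using cover[OF st] by blast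
    show ?thesis using poly_pull_at[of \<sigma> \<tau> G c] p by (simp add: c val_at_scale[OF G])
  qed
  then show "vanishes_on G C" using val_at_zero_everywhere vanishes_on_C[OF G] by blast
qed

text \<open>
  The inverse of the parametrization. The quantities \<open>D = x ^ 2 - y (y + z)\<close> and \<open>E = 2 y + z\<close> satisfy
  \<open>D = l ^ 2 + l E\<close> for \<open>l = t ^ q\<close>. Its \<open>q\<close>-th power is an equation for \<open>l ^ q\<close>, and \<open>l ^ q (y + z) = l y ^ q\<close>
  because \<open>y + z = (s - t) ^ q\<close>. Substituting this and eliminating \<open>l ^ 2\<close> leaves the linear
  equation \<open>inverse_num = l inverse_den\<close>. So \<open>t ^ q\<close> is rational on the curve, and with it \<open>s / t\<close>.
\<close>

definition inverse_D :: "'r::comm_ring_1 \<Rightarrow> 'r \<Rightarrow> 'r \<Rightarrow> 'r" where "inverse_D x y z = x\<^sup>2 - y * (y + z)"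
definition inverse_E :: "'r::comm_ring_1 \<Rightarrow> 'r \<Rightarrow> 'r" where "inverse_E y z = 2 * y + z"
definition inverse_num :: "'r::comm_ring_1 \<Rightarrow> 'r \<Rightarrow> 'r \<Rightarrow> 'r" where
  "inverse_num x y z = inverse_D x y z ^ q * (y + z)\<^sup>2 - inverse_D x y z * (y ^ q)\<^sup>2"
definition inverse_den :: "'r::comm_ring_1 \<Rightarrow> 'r \<Rightarrow> 'r" where
  "inverse_den y z = y ^ q * ((y + z) * inverse_E y z ^ q - inverse_E y z * y ^ q)"

lemma inverse_hom:
  assumes f: "unital_hom f"
  shows "f (inverse_num x y z) = inverse_num (f x) (f y) (f z)" "f (inverse_den y z) = inverse_den (f y) (f z)"
  using hom_of_nat[OF f, of 2]
  by (simp_all add: inverse_num_def inverse_den_def inverse_D_def inverse_E_def hom_mult[OF f] hom_add[OF f] hom_diff[OF f] hom_power[OF f])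

lemma form_inverse_num: "is_form (2 * q + 2) (inverse_num varX varY varZ :: 'a poly3)"
  and form_inverse_den: "is_form (2 * q + 1) (inverse_den varY varZ :: 'a poly3)"
proof -
  have yz: "is_form 1 (varY + varZ :: 'a poly3)" by (auto intro!: form_add)
  have D: "is_form 2 (inverse_D varX varY varZ :: 'a poly3)"
    unfolding inverse_D_def by (intro form_diff form_power[of 1] form_mult[OF _ yz, of 1]) auto
  have E: "is_form 1 (inverse_E varY varZ :: 'a poly3)"
    using form_of_nat[of 2] unfolding inverse_E_def by (auto intro!: form_add form_0_mult)
  have yq: "is_form q (varY ^ q :: 'a poly3)" by (rule form_power[of 1]) auto
  have "is_form (2 * q) (inverse_D varX varY varZ ^ q :: 'a poly3)" by (rule form_power[OF D]) simp
  moreover have "is_form 2 ((varY + varZ)\<^sup>2 :: 'a poly3)" by (rule form_power[OF yz]) simp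
  moreover have "is_form (2 * q) ((varY ^ q)\<^sup>2 :: 'a poly3)" by (rule form_power[OF yq]) simp
  ultimately show "is_form (2 * q + 2) (inverse_num varX varY varZ :: 'a poly3)"
    unfolding inverse_num_def by (intro form_diff form_mult[OF _ _ HOL.refl] form_mult[OF D]) auto
  have "is_form q (inverse_E varY varZ ^ q :: 'a poly3)" by (rule form_power[OF E]) simp
  then have "is_form (q + 1) ((varY + varZ) * inverse_E varY varZ ^ q - inverse_E varY varZ * varY ^ q :: 'a poly3)"
    using yz E yq by (intro form_diff form_mult[of 1 _ q]) auto
  then show "is_form (2 * q + 1) (inverse_den varY varZ :: 'a poly3)"
    unfolding inverse_den_def by (intro form_mult[OF yq]) auto
qed

lemma pYZ: "pY m \<sigma> \<tau> + pZ m \<sigma> \<tau> = (\<sigma> - \<tau>) ^ q" for \<sigma> \<tau> :: "'a poly"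
  unfolding frobenius_poly_diff by (simp add: pY_def pZ_def q algebra_simps)

lemma inverse_num_eq: "inverse_num (pX m \<sigma> \<tau>) (pY m \<sigma> \<tau>) (pZ m \<sigma> \<tau>) = \<tau> ^ q * inverse_den (pY m \<sigma> \<tau>) (pZ m \<sigma> \<tau>)"
  for \<sigma> \<tau> :: "'a poly"
proof -
  define x y z l where "x = pX m \<sigma> \<tau>" and "y = pY m \<sigma> \<tau>" and "z = pZ m \<sigma> \<tau>" and "l = \<tau> ^ q"
  define S t2 where "S = \<sigma> ^ q" and "t2 = \<tau> ^ (2 * m)"
  have l: "l = \<tau> * t2" by (simp add: l_def t2_def q)
  have y: "y = (\<sigma> - \<tau>) * t2" by (simp add: y_def pY_def t2_def)
  have z: "z = S - \<sigma> * t2" by (simp add: z_def pZ_def S_def t2_def q)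
  have x2: "x\<^sup>2 = S * \<sigma> * t2"
  proof -
    have 1: "x\<^sup>2 = \<sigma> ^ ((m + 1) * 2) * \<tau> ^ (m * 2)"
      unfolding x_def pX_def power_mult_distrib power_mult by (rule HOL.refl)
    have 2: "(m + 1) * 2 = Suc q" "m * 2 = 2 * m" by (simp_all add: q)
    show ?thesis unfolding 1 2 S_def t2_def by (simp add: mult_ac)
  qed
  have D: "inverse_D x y z = l\<^sup>2 + l * inverse_E y z"
    unfolding inverse_D_def inverse_E_def x2 l y z by (simp add: power2_eq_square algebra_simps)
  have yz: "y + z = (\<sigma> - \<tau>) ^ q" by (simp add: y_def z_def pYZ)
  have "l * y ^ q = (\<tau> * t2) * t2 ^ q * (\<sigma> - \<tau>) ^ q" unfolding l y by (simp add: power_mult_distrib mult_ac)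
  also have "(\<tau> * t2) * t2 ^ q = l ^ q"
  proof -
    have "l ^ q = \<tau> ^ q * t2 ^ q" unfolding l by (rule power_mult_distrib)
    then show ?thesis by (simp add: l[symmetric] l_def[symmetric])
  qed
  finally have ly: "l * y ^ q = l ^ q * (y + z)" by (simp add: yz)
  have Dq: "inverse_D x y z ^ q = (l ^ q)\<^sup>2 + l ^ q * inverse_E y z ^ q"
    unfolding D frobenius_poly power_mult_distrib by (simp flip: power_mult add: mult.commute)
  have "inverse_num x y z = (l ^ q * (y + z))\<^sup>2 + (l ^ q * (y + z)) * ((y + z) * inverse_E y z ^ q) - (l\<^sup>2 + l * inverse_E y z) * (y ^ q)\<^sup>2"
    unfolding inverse_num_def Dq unfolding D by (simp add: power2_eq_square algebra_simps)
  also have "\<dots> = l * inverse_den y z"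
    unfolding ly[symmetric] inverse_den_def by (simp add: power2_eq_square algebra_simps)
  finally show ?thesis by (simp add: x_def y_def z_def l_def)
qed

text \<open>
  The factorization shows that the denominator does not vanish identically.
\<close>

lemma inverse_den_eq: "inverse_den (pY m \<sigma> \<tau>) (pZ m \<sigma> \<tau>) =
    (pY m \<sigma> \<tau>) ^ q * ((\<sigma> - \<tau>) ^ q * ((\<sigma> - \<tau>) ^ (q * q) - (\<sigma> - \<tau>) * (\<tau> ^ (2 * m)) ^ (q + 1)))"
  for \<sigma> \<tau> :: "'a poly"
proof -
  define w t2 where "w = \<sigma> - \<tau>" and "t2 = \<tau> ^ (2 * m)"
  have y: "pY m \<sigma> \<tau> = w * t2" by (simp add: pY_def w_def t2_def)
  have yz: "w * t2 + pZ m \<sigma> \<tau> = w ^ q" using pYZ[of \<sigma> \<tau>] by (simp add: y w_def)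
  have "inverse_E (w * t2) (pZ m \<sigma> \<tau>) = w * t2 + (w * t2 + pZ m \<sigma> \<tau>)"
    by (simp only: inverse_E_def mult_2 add.assoc)
  then have E: "inverse_E (w * t2) (pZ m \<sigma> \<tau>) = w * t2 + w ^ q" by (simp only: yz)
  show ?thesis
    unfolding inverse_den_def y w_def[symmetric] t2_def[symmetric] yz E frobenius_poly
    by (simp add: power_mult_distrib power_mult algebra_simps)
qed

text \<open>
  The coordinate \<open>T = t / s\<close>, centred at the parameter of \<open>(0:0:1)\<close>. For \<open>s = 1\<close> one has
  \<open>t ^ q / (t ^ q + Y) = t\<close>.
\<close>

lemma chart_v: "curve_chart C (pX m 1 [:0, 1:]) (pY m 1 [:0, 1:]) (pZ m 1 [:0, 1:])
    (inverse_num varX varY varZ) (inverse_num varX varY varZ + varY * inverse_den varY varZ) (2 * q + 2)"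
proof
  fix d and G :: "'a poly3" assume G: "is_form d G"
  have "\<exists>c l. s = l * poly 1 c \<and> t = l * poly [:0, 1:] c" if "s \<noteq> 0" for s t :: 'a
    using that by (intro exI[of _ "t / s"] exI[of _ s]) simp
  then show "vanishes_on G C \<longleftrightarrow> ev_poly (pX m 1 [:0, 1:]) (pY m 1 [:0, 1:]) (pZ m 1 [:0, 1:]) G = 0"
    using vanishes_on_chart[OF G, of 1 "[:0, 1:]"] by (simp add: pull_at_def)
next
  show "is_form (2 * q + 2) (inverse_num varX varY varZ :: 'a poly3)" by (rule form_inverse_num)
  have "is_form (2 * q + 2) (varY * inverse_den varY varZ :: 'a poly3)" by (rule form_mult[OF _ form_inverse_den, of 1]) auto
  then show "is_form (2 * q + 2) (inverse_num varX varY varZ + varY * inverse_den varY varZ :: 'a poly3)"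
    by (intro form_add form_inverse_num)
next
  let ?T = "[:0, 1:] :: 'a poly"
  let ?d = "inverse_den (pY m 1 ?T) (pZ m 1 ?T)"
  note h = hom_ev_poly[of "pX m 1 ?T" "pY m 1 ?T" "pZ m 1 ?T"]
  note ev = inverse_hom[OF h] hom_add[OF h] hom_mult[OF h] ev_varX[OF hom_const_poly] ev_varY[OF hom_const_poly] ev_varZ[OF hom_const_poly] inverse_num_eq
  have B: "?T ^ q * ?d + pY m 1 ?T * ?d = ?T ^ (2 * m) * ?d"
    by (simp add: pY_def q distrib_right[symmetric] left_diff_distrib)
  show "ev_poly (pX m 1 ?T) (pY m 1 ?T) (pZ m 1 ?T) (inverse_num varX varY varZ) =
      ?T * ev_poly (pX m 1 ?T) (pY m 1 ?T) (pZ m 1 ?T) (inverse_num varX varY varZ + varY * inverse_den varY varZ)"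
    unfolding ev B by (simp add: q)
  have "poly ((1 - ?T) ^ (q * q) - (1 - ?T) * (?T ^ (2 * m)) ^ (q + 1)) 0 = 1"
    using m by (simp add: power_0_left)
  then have "(1 - ?T) ^ (q * q) - (1 - ?T) * (?T ^ (2 * m)) ^ (q + 1) \<noteq> 0"
    by (metis poly_0 zero_neq_one)
  moreover have "1 - ?T \<noteq> 0" by (simp add: one_pCons)
  moreover have "pY m 1 ?T \<noteq> 0" using \<open>1 - ?T \<noteq> 0\<close> unfolding pY_def by simp
  ultimately have "?d \<noteq> 0" unfolding inverse_den_eq by simp
  then show "ev_poly (pX m 1 ?T) (pY m 1 ?T) (pZ m 1 ?T) (inverse_num varX varY varZ + varY * inverse_den varY varZ) \<noteq> 0"
    unfolding ev B by simp
qed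

text \<open>
  The coordinate \<open>T = s / t - 1\<close>, centred at the parameter of \<open>P2\<close>. For \<open>t = 1\<close> it is \<open>Y / t ^ q\<close>.
\<close>

lemma chart_r: "curve_chart C (pX m [:1, 1:] 1) (pY m [:1, 1:] 1) (pZ m [:1, 1:] 1)
    (varY * inverse_den varY varZ) (inverse_num varX varY varZ) (2 * q + 2)"
proof
  fix d and G :: "'a poly3" assume G: "is_form d G"
  have "\<exists>c l. s = l * poly [:1, 1:] c \<and> t = l * poly 1 c" if "t \<noteq> 0" for s t :: 'a
    using that by (intro exI[of _ "s / t - 1"] exI[of _ t]) simp
  then show "vanishes_on G C \<longleftrightarrow> ev_poly (pX m [:1, 1:] 1) (pY m [:1, 1:] 1) (pZ m [:1, 1:] 1) G = 0"
    using vanishes_on_chart[OF G, of "[:1, 1:]" 1] by (simp add: pull_at_def)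
next
  show "is_form (2 * q + 2) (inverse_num varX varY varZ :: 'a poly3)" by (rule form_inverse_num)
  show "is_form (2 * q + 2) (varY * inverse_den varY varZ :: 'a poly3)" by (rule form_mult[OF _ form_inverse_den, of 1]) auto
next
  let ?S = "[:1, 1:] :: 'a poly"
  let ?d = "inverse_den (pY m ?S 1) (pZ m ?S 1)"
  note h = hom_ev_poly[of "pX m ?S 1" "pY m ?S 1" "pZ m ?S 1"]
  note ev = inverse_hom[OF h] hom_add[OF h] hom_mult[OF h] ev_varX[OF hom_const_poly] ev_varY[OF hom_const_poly] ev_varZ[OF hom_const_poly] inverse_num_eq
  have w: "?S - 1 = [:0, 1:]" by (simp add: one_pCons)
  show "ev_poly (pX m ?S 1) (pY m ?S 1) (pZ m ?S 1) (varY * inverse_den varY varZ) =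
      [:0, 1:] * ev_poly (pX m ?S 1) (pY m ?S 1) (pZ m ?S 1) (inverse_num varX varY varZ)"
    unfolding ev by (simp add: pY_def w)
  have qq: "q * q \<noteq> 1" using m by (simp add: q)
  have "Polynomial.coeff ([:0, 1:] ^ (q * q) - [:0, 1:] :: 'a poly) 1 = - 1"
  proof -
    have "[:0, 1:] ^ (q * q) = Polynomial.monom (1 :: 'a) (q * q)" by (simp add: monom_altdef)
    then show ?thesis using qq by simp
  qed
  then have "[:0, 1:] ^ (q * q) - [:0, 1:] \<noteq> (0 :: 'a poly)" by (metis coeff_0 neg_equal_0_iff_equal zero_neq_one)
  moreover have "pY m ?S 1 \<noteq> 0" unfolding pY_def w by simp
  ultimately have "?d \<noteq> 0" unfolding inverse_den_eq w by simp
  then show "ev_poly (pX m ?S 1) (pY m ?S 1) (pZ m ?S 1) (inverse_num varX varY varZ) \<noteq> 0"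
    unfolding ev by simp
qed

subsection \<open>Points that are not Galois\<close>

interpretation V: curve_chart C "pX m 1 [:0, 1:]" "pY m 1 [:0, 1:]" "pZ m 1 [:0, 1:]"
  "inverse_num varX varY varZ" "inverse_num varX varY varZ + varY * inverse_den varY varZ" "2 * q + 2"
  by (rule chart_v)

lemma pull_vars:
  "V.pull varX = [:0, 1:] ^ m" "V.pull varY = [:0, 1:] ^ (2 * m) * [:1, - 1:]" "V.pull varZ = 1 - [:0, 1:] ^ (2 * m)"
proof -
  have "1 - [:0, 1:] = [:1, - 1 :: 'a:]" by (simp add: one_pCons)
  then show "V.pull varX = [:0, 1:] ^ m" "V.pull varY = [:0, 1:] ^ (2 * m) * [:1, - 1:]" "V.pull varZ = 1 - [:0, 1:] ^ (2 * m)"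
    unfolding V.pull_simps pX_def pY_def pZ_def by (simp_all only: power_one mult_1_left mult.commute)
qed

lemma order_T: "Polynomial.order 0 ([:0, 1:] ^ n :: 'a poly) = n"
  using order_power_n_n[of "0::'a" n] by simp

lemma degree_T: "Polynomial.degree ([:0, 1:] ^ n :: 'a poly) = n"
  by (simp add: degree_power_eq)

text \<open>
  In the chart \<open>T = t / s\<close> the projection from \<open>(0:0:1)\<close> is \<open>Y / X = T ^ m (1 - T)\<close>, whose zeros have
  multiplicities \<open>m\<close> and \<open>1\<close>.
\<close>

lemma not_galois_Z: "\<not> galois_point C (point (vector [0, 0, 1]))"
proof
  assume g: "galois_point C (point (vector [0, 0, 1]))"
  let ?N = "V.pull varY" and ?M = "V.pull varX"
  have "Polynomial.degree ?N = 2 * m + 1"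
    unfolding pull_vars by (subst degree_mult_eq) (auto simp: degree_T)
  moreover have "Polynomial.degree ?M = m" unfolding pull_vars by (rule degree_T)
  moreover have "Polynomial.order 0 ?N = 2 * m"
    unfolding pull_vars by (subst order_mult) (auto simp: order_T intro: order_0I simp del: mult_pCons_left mult_pCons_right)
  moreover have "Polynomial.order 0 ?M = m" unfolding pull_vars by (rule order_T)
  moreover have "Polynomial.order 1 ?N = 1"
  proof -
    have "Polynomial.order 1 ([:1, - 1:] :: 'a poly) = 1"
      using order_power_n_n[of "1::'a" 1] order_uminus[of 1 "[:- 1, 1:] :: 'a poly"] by simp
    then show ?thesis
      unfolding pull_vars by (subst order_mult) (auto intro: order_0I simp del: mult_pCons_left mult_pCons_right)
  qed
  moreover have "Polynomial.order 1 ?M = 0" unfolding pull_vars by (rule order_0I) simp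
  moreover have "?M \<noteq> 0" unfolding pull_vars by simp
  ultimately show False
    using V.galois_point_orders[OF g forms_through_Z[unfolded forms_through_swap[of _ varX varY]], of 0 1] m by simp
qed

lemma five: "of_nat 5 = (0 :: 'a)" if "m = 2"
  using of_nat_q that by (simp add: q)

text \<open>
  Projecting from \<open>P = \<phi>(1:c) = (1:y0:z0)\<close>, the fibre of the line through \<open>(0:0:1)\<close> consists of \<open>T = 0\<close> with
  multiplicity \<open>m\<close> and of the roots of \<open>h = (1 - T) T ^ m - y0\<close> that are not parameters of \<open>P\<close>. In
  characteristic \<open>p\<close> one has \<open>2 m = -1\<close>, so the derivative of \<open>h\<close> is a multiple of \<open>T ^ (m - 1) (T + 1)\<close>: the
  roots of \<open>h\<close> are simple, apart from a possible double root \<open>-1\<close>. If \<open>P\<close> were Galois, a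
  root that is not a parameter of \<open>P\<close> would have multiplicity \<open>m\<close>, which is too large unless \<open>m = 2\<close> and
  \<open>-1\<close> is a root. So all \<open>m + 1\<close> roots, with multiplicity, would be among the at most two parameters
  of \<open>P\<close>, at most one of them double.
\<close>

lemma not_galois_general:
  assumes c: "c \<noteq> 0" "c \<noteq> 1"
  shows "\<not> galois_point C (point (phi 1 c))"
proof
  assume g: "galois_point C (point (phi 1 c))"
  define \<gamma> y0 z0 where "\<gamma> = c ^ m" and "y0 = (1 - c) * \<gamma>" and "z0 = (1 - \<gamma>\<^sup>2) / \<gamma>"
  have \<gamma>: "\<gamma> \<noteq> 0" using c by (simp add: \<gamma>_def)
  have y0: "y0 \<noteq> 0" using c \<gamma> by (simp add: y0_def)
  have "phi 1 c = \<gamma> *s vector [1, y0, z0]"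
    using \<gamma> by (simp add: phi_def pX_def pY_def pZ_def vec3_smult y0_def z0_def \<gamma>_def power_mult power2_eq_square mult_ac)
  then have P: "point (phi 1 c) = point (vector [1, y0, z0])"
    using point_smult[of "vector [1, y0, z0] :: 'a ^ 3" \<gamma>] \<gamma> by (simp add: vec3_nonzero)
  let ?l = "varY - const3 y0 * varX" and ?m = "varZ - const3 z0 * varX"
  define h where "h = [:0, 1:] ^ m * [:1, - 1:] - [:y0:]"
  define M where "M = 1 - [:0, 1:] ^ (2 * m) - [:z0:] * [:0, 1:] ^ m"
  have N: "V.pull ?l = [:0, 1:] ^ m * h"
  proof -
    have T2: "[:0, 1:] ^ (2 * m) = [:0, 1:] ^ m * ([:0, 1:] ^ m :: 'a poly)" by (simp only: mult_2 power_add)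
    have "V.pull ?l = [:0, 1:] ^ (2 * m) * [:1, - 1:] - [:y0:] * [:0, 1:] ^ m"
      by (simp only: hom_diff[OF V.hom_pull] hom_mult[OF V.hom_pull] ev_const3[OF hom_const_poly] pull_vars)
    then show ?thesis unfolding T2 h_def by (simp only: right_diff_distrib mult_ac)
  qed
  have M: "V.pull ?m = M"
    by (simp only: hom_diff[OF V.hom_pull] hom_mult[OF V.hom_pull] ev_const3[OF hom_const_poly] pull_vars M_def)
  have hv: "poly h x = x ^ m * (1 - x) - y0" and Mv: "poly M x = 1 - (x ^ m)\<^sup>2 - z0 * x ^ m" for x
    by (simp_all add: h_def M_def power_mult mult.commute[of 2 m] algebra_simps)
  have dh: "Polynomial.degree h = m + 1"
  proof -
    have "Polynomial.degree ([:0, 1:] ^ m * [:1, - 1:] :: 'a poly) = m + 1"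
      by (subst degree_mult_eq) (auto simp: degree_T)
    then show ?thesis
      unfolding h_def diff_conv_add_uminus
      by (subst degree_add_eq_left) (simp_all del: mult_pCons_left mult_pCons_right)
  qed
  have h0: "h \<noteq> 0" using dh by auto
  have "Polynomial.degree (V.pull ?l) = 2 * m + 1"
    unfolding N by (subst degree_mult_eq) (use h0 in \<open>auto simp: degree_T dh\<close>)
  moreover have "Polynomial.degree M \<le> 2 * m"
    unfolding M_def by (intro degree_diff_le le_trans[OF degree_mult_le]) (auto simp: degree_T)
  ultimately have deg: "Polynomial.degree (V.pull ?m) < Polynomial.degree (V.pull ?l)" by (simp add: M)
  have M0: "poly M 0 = 1" using m by (simp add: Mv power_0_left)
  then have Mnz: "V.pull ?m \<noteq> 0" unfolding M by (metis poly_0 zero_neq_one)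
  have o0: "Polynomial.order 0 (V.pull ?l) = m" "Polynomial.order 0 (V.pull ?m) = 0"
  proof -
    have "Polynomial.order 0 h = 0" using y0 m by (intro order_0I) (simp add: hv power_0_left)
    then show "Polynomial.order 0 (V.pull ?l) = m"
      unfolding N using h0 by (subst order_mult) (auto simp: order_T)
    show "Polynomial.order 0 (V.pull ?m) = 0" unfolding M by (rule order_0I) (simp add: M0)
  qed
  have ol: "Polynomial.order b (V.pull ?l) = Polynomial.order b h" if "b \<noteq> 0" for b
  proof -
    have "Polynomial.order b ([:0, 1:] ^ m) = 0" by (rule order_0I) (simp add: that)
    then show ?thesis unfolding N using h0 by (subst order_mult) auto
  qed
  \<comment> \<open>all positive multiplicities in this fibre are equal to \<open>m\<close>\<close>
  have fibre: "Polynomial.order b h = Polynomial.order b M + m"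
    if "b \<noteq> 0" "Polynomial.order b M < Polynomial.order b h" for b
    using V.galois_point_orders[OF g[unfolded P] forms_through_affine deg Mnz, of b 0] o0 that m
    by (simp add: ol M)
  have pd: "pderiv h = [:0, 1:] ^ (m - 1) * [:of_nat m, - of_nat (m + 1):]"
  proof -
    have Tm: "[:0, 1:] ^ m = [:0, 1:] ^ (m - 1) * ([:0, 1:] :: 'a poly)"
    proof -
      have "Suc (m - 1) = m" using m by simp
      then show ?thesis using power_Suc2[of "[:0, 1:] :: 'a poly" "m - 1"] by (simp only:)
    qed
    have 1: "pderiv ([:0, 1:] ^ m) = [:of_nat m:] * ([:0, 1:] ^ (m - 1) :: 'a poly)"
      by (simp add: pderiv_power pderiv_pCons)
    have 2: "pderiv [:1, - 1 :: 'a:] = [:- 1:]" "pderiv [:y0:] = 0" by (simp_all add: pderiv_pCons)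
    have "pderiv h = [:0, 1:] ^ m * [:- 1:] + [:1, - 1:] * ([:of_nat m:] * [:0, 1:] ^ (m - 1))"
      unfolding h_def pderiv_diff pderiv_mult 1 2 by (simp only: diff_zero)
    also have "\<dots> = [:0, 1:] ^ (m - 1) * ([:0, 1:] * [:- 1:] + [:of_nat m:] * [:1, - 1:])"
      unfolding Tm by (simp only: distrib_left mult_ac)
    finally show ?thesis by (simp add: mult_ac)
  qed
  \<comment> \<open>since \<open>m + 1 = - m\<close> in the field, the linear factor of the derivative has the root \<open>-1\<close>\<close>
  have m1: "2 * of_nat (m + 1) = (1 :: 'a)" using two_m by (simp add: distrib_left)
  have lin: "[:of_nat m, - of_nat (m + 1):] = Polynomial.smult (- of_nat (m + 1)) [:1, 1 :: 'a:]"
  proof -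
    have "2 * (of_nat m + of_nat (m + 1)) = (0 :: 'a)" unfolding distrib_left two_m m1 by simp
    moreover have "(2 :: 'a) \<noteq> 0" using m1 by auto
    ultimately have "of_nat m = - (of_nat (m + 1) :: 'a)" by (simp only: mult_eq_0_iff eq_neg_iff_add_eq_0) simp
    then show ?thesis by simp
  qed
  have m10: "of_nat (m + 1) \<noteq> (0 :: 'a)" using m1 by (metis mult_zero_right zero_neq_one)
  have pd0: "pderiv h \<noteq> 0"
    unfolding pd lin
  proof (rule no_zero_divisors)
    show "Polynomial.smult (- of_nat (m + 1)) [:1, 1 :: 'a:] \<noteq> 0" using m10 by (simp del: of_nat_add of_nat_Suc)
  qed simp
  have opd: "Polynomial.order b (pderiv h) = (if b = - 1 then 1 else 0)" if "b \<noteq> 0" for b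
  proof -
    have "Polynomial.order b ([:0, 1:] ^ (m - 1)) = 0" by (rule order_0I) (simp add: that)
    moreover have "Polynomial.order b (Polynomial.smult (- of_nat (m + 1)) [:1, 1:]) = Polynomial.order b [:1, 1 :: 'a:]"
      by (rule order_smult) (use m10 in \<open>simp del: of_nat_add of_nat_Suc\<close>)
    moreover have "Polynomial.order b [:1, 1 :: 'a:] = (if b = - 1 then 1 else 0)"
      using order_power_n_n[of "- 1 :: 'a" 1] by (auto intro!: order_0I simp: add_eq_0_iff)
    ultimately show ?thesis
      using order_mult[OF pd0[unfolded pd lin], of b] unfolding pd lin by simp
  qed
  have oh: "Polynomial.order b h \<le> (if b = - 1 then 2 else 1)" if "b \<noteq> 0" for b
    using order_le_Suc_order_pderiv[OF pd0, of b] opd[OF that] by (auto split: if_splits)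
  have root0: "b \<noteq> 0" if "poly h b = 0" for b
    using that y0 m by (auto simp: hv power_0_left)
  show False
  proof (cases "m = 2 \<and> poly h (- 1) = 0")
    case True
    then have m2: "m = 2" by simp
    note 5 = five[OF m2]
    \<comment> \<open>the case \<open>q = 5\<close>: here \<open>-1\<close> is a double root of \<open>h\<close> and a simple one of \<open>M\<close>, so its
      multiplicity in the fibre is \<open>1\<close> instead of \<open>2\<close>\<close>
    have "(- 1) ^ 2 * (1 - (- 1)) - (1 - c) * c\<^sup>2 = 0"
      using True by (simp only: hv y0_def \<gamma>_def m2)
    then have "c\<^sup>2 * (1 - c) = 2" by (simp add: mult.commute)
    then have "(c + 1)\<^sup>2 * (c - 3) = - 5 * c - 5" by (simp add: power2_eq_square algebra_simps)
    also have "\<dots> = 0" using 5 by simp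
    finally have "c = - 1 \<or> c = 3" by (auto simp: add_eq_0_iff2)
    then have "c ^ 4 = 1"
    proof
      assume "c = 3"
      have "(3 :: 'a) ^ 4 = 1 + 16 * of_nat 5" by simp
      then show ?thesis unfolding \<open>c = 3\<close> 5 by simp
    qed simp
    then have z0: "z0 = 0" by (simp add: z0_def \<gamma>_def m2 flip: power_mult)
    have "poly M (- 1) = 0" by (simp add: Mv z0 m2)
    then have M1: "Polynomial.order (- 1) M > 0" using Mnz order_gt_0_iff[of M "- 1"] by (simp add: M)
    have h1: "Polynomial.order (- 1) h \<le> 2" using oh[of "- 1"] by simp
    have pM: "pderiv M = Polynomial.smult (- 4) ([:0, 1:] ^ 3)"
      by (simp add: M_def z0 m2 pderiv_diff pderiv_power pderiv_pCons)
    have "(4 :: 'a) \<noteq> 0"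
    proof
      assume 4: "(4 :: 'a) = 0"
      have "of_nat 5 = (4 + 1 :: 'a)" by simp
      then show False unfolding 4 5 by simp
    qed
    then have "Polynomial.order (- 1) M \<le> 1"
      using order_le_Suc_order_pderiv[of M "- 1"] unfolding pM
      by (simp add: order_smult order_0I)
    moreover have "\<not> Polynomial.order (- 1) M < Polynomial.order (- 1) h"
      using fibre[of "- 1"] h1 M1 m2 by auto
    moreover have "Polynomial.order (- 1) h \<ge> 2"
    proof -
      have "poly (pderiv h) (- 1) = 0" unfolding pd lin by simp
      obtain r where r: "h = [:1, 1:] * r" using True poly_eq_0_iff_dvd[of h "- 1"] by auto
      have "pderiv h = [:1, 1:] * pderiv r + r"
        by (simp add: r pderiv_mult pderiv_pCons del: mult_pCons_left)
      then have "poly r (- 1) = 0" using \<open>poly (pderiv h) (- 1) = 0\<close> by simp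
      then obtain r' where r': "r = [:1, 1:] * r'" using poly_eq_0_iff_dvd[of r "- 1"] by auto
      have "h = [:- (- 1), 1:] ^ 2 * r'"
        by (simp only: r r' power2_eq_square mult.assoc minus_minus)
      then have "[:- (- 1), 1:] ^ 2 dvd h" by (metis dvd_triv_left)
      then show ?thesis using h0 unfolding order_divides by blast
    qed
    ultimately show False by simp
  next
    case False
    have rootM: "poly M b = 0" if b: "poly h b = 0" for b
    proof (rule ccontr)
      assume "poly M b \<noteq> 0"
      then have M: "Polynomial.order b M = 0" by (rule order_0I)
      have h: "Polynomial.order b h > 0" using b h0 by (simp add: order_gt_0_iff)
      have "Polynomial.order b h = m" using fibre[OF root0[OF b]] M h by simp
      then show False using oh[OF root0[OF b]] False m b by (auto split: if_splits)
    qed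
    \<comment> \<open>for a parameter \<open>b\<close> of \<open>P\<close> the equation for \<open>z0\<close> determines \<open>b ^ m\<close> up to two values, and then
      the equation for \<open>y0\<close> determines \<open>b\<close>\<close>
    have sub: "{b. poly h b = 0} \<subseteq> {1 - y0 / \<gamma>, 1 + y0 * \<gamma>}"
    proof
      fix b assume "b \<in> {b. poly h b = 0}"
      then have b: "b ^ m * (1 - b) = y0" "1 - (b ^ m)\<^sup>2 - z0 * b ^ m = 0" using rootM by (auto simp: hv Mv)
      have "(\<gamma> * b ^ m + 1) * (b ^ m - \<gamma>) = - \<gamma> * (1 - (b ^ m)\<^sup>2 - z0 * b ^ m)"
        using \<gamma> by (simp add: z0_def power2_eq_square field_simps)
      then have "\<gamma> * b ^ m + 1 = 0 \<or> b ^ m - \<gamma> = 0" using b(2) by simp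
      then show "b \<in> {1 - y0 / \<gamma>, 1 + y0 * \<gamma>}"
      proof
        assume "b ^ m - \<gamma> = 0"
        then have "\<gamma> * (1 - b) = y0" using b(1) by simp
        then have "b = 1 - y0 / \<gamma>" using \<gamma> by (simp add: field_simps)
        then show ?thesis by simp
      next
        assume "\<gamma> * b ^ m + 1 = 0"
        then have *: "\<gamma> * b ^ m = - 1" by (simp add: eq_neg_iff_add_eq_0)
        have "y0 * \<gamma> = (\<gamma> * b ^ m) * (1 - b)" by (simp add: b(1)[symmetric] mult_ac)
        then have "b = 1 + y0 * \<gamma>" unfolding * by simp
        then show ?thesis by simp
      qed
    qed
    have fin: "finite {b. poly h b = 0}" using h0 by (rule poly_roots_finite)
    have card: "card {b. poly h b = 0} \<le> 2"
      using card_mono[OF _ sub] card_insert_le_m1[of 2 "{1 + y0 * \<gamma>}" "1 - y0 / \<gamma>"] by simp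
    have "m + 1 = (\<Sum>b\<in>{b. poly h b = 0}. Polynomial.order b h)"
      using degree_eq_sum_order[OF h0] dh by simp
    also have "\<dots> \<le> (\<Sum>b\<in>{b. poly h b = 0}. 1 + (if b = - 1 then 1 else 0))"
    proof (rule sum_mono)
      fix b assume "b \<in> {b. poly h b = 0}"
      then show "Polynomial.order b h \<le> 1 + (if b = - 1 then 1 else 0)" using oh[OF root0, of b] by auto
    qed
    also have "\<dots> = card {b. poly h b = 0} + (if poly h (- 1) = 0 then 1 else 0)"
      using fin unfolding sum.distrib by (simp add: sum.delta)
    finally have "m + 1 \<le> 2 + (if poly h (- 1) = 0 then 1 else 0)" using card by simp
    then show False using False m by (auto split: if_splits)
  qed
qed

lemma galois_points_on_C:
  assumes "P \<in> C" and g: "galois_point C P"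
  shows "P = point (vector [0, 1, 0]) \<or> P = point (vector [1, 0, 0])"
proof -
  obtain s t where P: "P = point (phi s t)" and st: "s \<noteq> 0 \<or> t \<noteq> 0" using assms(1) by (auto simp: C_eq)
  have m0: "m > 0" using m by simp
  consider "t = 0" | "s = 0" "t \<noteq> 0" | "s = t" "s \<noteq> 0" | "s \<noteq> 0" "t \<noteq> 0" "s \<noteq> t" by blast
  then show ?thesis
  proof cases
    case 1
    then have "phi s t = s ^ q *s vector [0, 0, 1]"
      using m0 by (simp add: phi_def pX_def pY_def pZ_def vec3_smult power_0_left q)
    then have "P = point (vector [0, 0, 1])"
      using st 1 point_smult[of "vector [0, 0, 1] :: 'a ^ 3" "s ^ q"] by (simp add: P vec3_nonzero)
    then show ?thesis using not_galois_Z g by simp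
  next
    case 2
    then have "phi s t = - (t ^ q) *s vector [0, 1, 0]"
      using m0 by (simp add: phi_def pX_def pY_def pZ_def vec3_smult power_0_left q)
    then show ?thesis
      using 2 point_smult[of "vector [0, 1, 0] :: 'a ^ 3" "- (t ^ q)"] by (simp add: P vec3_nonzero)
  next
    case 3
    have "t ^ (m + 1) * t ^ m = t ^ q" unfolding power_add[symmetric] by (rule arg_cong[of _ _ "power t"]) (simp add: q)
    then have "phi s t = t ^ q *s vector [1, 0, 0]"
      using 3(1) by (simp add: phi_def pX_def pY_def pZ_def vec3_smult)
    then show ?thesis
      using 3 point_smult[of "vector [1, 0, 0] :: 'a ^ 3" "t ^ q"] by (simp add: P vec3_nonzero)
  next
    case 4
    have "phi s t = s ^ q *s phi 1 (t / s)" using phi_scale[of s 1 "t / s"] 4 by simp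
    then have "P = point (phi 1 (t / s))"
      using 4 point_smult[of "phi 1 (t / s)" "s ^ q"] phi_nonzero[of 1 "t / s"] by (simp add: P)
    moreover have "t / s \<noteq> 0" "t / s \<noteq> 1" using 4 by auto
    ultimately show ?thesis using not_galois_general g by blast
  qed
qed

end

section \<open>Dihedral groups by generators and relations\<close>

lemma word_eq_context: "word_eq R u v \<Longrightarrow> word_eq R (x @ u @ y) (x @ v @ y)"
proof (induction rule: word_eq.induct)
  case (refl u)
  show ?case by (rule word_eq.refl)
next
  case (sym u v)
  then show ?case by (blast intro: word_eq.sym)
next
  case (trans u v w)
  then show ?case by (blast intro: word_eq.trans)
next
  case (cancel u g e v)
  show ?case using word_eq.cancel[of R "x @ u" g e "v @ y"] by simp
next
  case (relator r u v)
  then show ?case using word_eq.relator[of r R "x @ u" "v @ y"] by simp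
qed

lemma word_eq_append: "word_eq R u u' \<Longrightarrow> word_eq R v v' \<Longrightarrow> word_eq R (u @ v) (u' @ v')"
  using word_eq_context[of R u u' "[]" v] word_eq_context[of R v v' u' "[]"]
  by (auto intro: word_eq.trans)

lemma word_class_eq_iff: "word_class R u = word_class R v \<longleftrightarrow> word_eq R u v"
  unfolding word_class_def by (auto intro: word_eq.refl word_eq.sym word_eq.trans)

lemma mem_word_class: "u \<in> word_class R u"
  by (simp add: word_class_def word_eq.refl)

lemma presented_group_mult:
  "word_class R u \<otimes>\<^bsub>presented_group R\<^esub> word_class R v = word_class R (u @ v)"
proof -
  have "word_class R (u' @ v') = word_class R (u @ v)"
    if "u' \<in> word_class R u" "v' \<in> word_class R v" for u' v'
    using word_eq_append[of R u u' v v'] that unfolding word_class_eq_iff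
    by (simp add: word_class_def word_eq.sym)
  then have "(\<Union>u'\<in>word_class R u. \<Union>v'\<in>word_class R v. word_class R (u' @ v')) = word_class R (u @ v)"
    using mem_word_class[of u R] mem_word_class[of v R] by (intro SUP_eq_const) blast+
  then show ?thesis by (simp add: presented_group_def)
qed

definition (in group) word_value :: "('g \<Rightarrow> 'a) \<Rightarrow> ('g \<times> bool) list \<Rightarrow> 'a" where
  "word_value \<phi> w = foldr (\<lambda>(g, e) x. (if e then \<phi> g else inv (\<phi> g)) \<otimes> x) w \<one>"

context group
begin

context
  fixes \<phi> :: "'g \<Rightarrow> 'a" assumes \<phi>: "\<And>g. \<phi> g \<in> carrier G"
begin

lemma word_value_Nil [simp]: "word_value \<phi> [] = \<one>"
  and word_value_Cons: "word_value \<phi> ((g, e) # w) = (if e then \<phi> g else inv (\<phi> g)) \<otimes> word_value \<phi> w"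
  by (simp_all add: word_value_def)

lemma word_value_closed [simp]: "word_value \<phi> w \<in> carrier G"
  by (induction w) (auto simp: word_value_Cons \<phi>)

lemma word_value_append: "word_value \<phi> (u @ v) = word_value \<phi> u \<otimes> word_value \<phi> v"
  by (induction u) (auto simp: word_value_Cons \<phi> m_assoc)

text \<open>
  Von Dyck's theorem: an assignment of the generators respecting the relators is well defined on words.
\<close>

lemma word_value_word_eq:
  assumes "word_eq R u v" and "\<And>r. r \<in> R \<Longrightarrow> word_value \<phi> r = \<one>"
  shows "word_value \<phi> u = word_value \<phi> v"
  using assms(1)
proof (induction rule: word_eq.induct)
  case (cancel u g e v)
  have "word_value \<phi> [(g, e), (g, \<not> e)] = \<one>" by (cases e) (simp_all add: word_value_Cons \<phi>)
  then show ?case by (simp only: word_value_append word_value_closed l_one)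
next
  case (relator r u v)
  then show ?case by (simp add: word_value_append assms(2))
qed auto

end

end

abbreviation letter_a :: "dihedral_gen \<times> bool" where "letter_a \<equiv> (gen_a, True)"
abbreviation letter_b :: "dihedral_gen \<times> bool" where "letter_b \<equiv> (gen_b, True)"

definition dihedral_relators :: "nat \<Rightarrow> (dihedral_gen \<times> bool) list set" where
  "dihedral_relators m = {replicate m letter_a, [letter_b, letter_b], [letter_a, letter_b, letter_a, letter_b]}"

lemma dihedral_group_eq: "dihedral_group (2 * m) = presented_group (dihedral_relators m)"
  by (simp add: dihedral_group_def dihedral_relators_def Let_def)

context
  fixes m :: nat assumes m: "m > 0"
begin

private abbreviation weq (infix "\<approx>" 50) where "u \<approx> v \<equiv> word_eq (dihedral_relators m) u v"

lemma weq_rel: "replicate m letter_a \<approx> []" "[letter_b, letter_b] \<approx> []" "[letter_a, letter_b, letter_a, letter_b] \<approx> []"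
  using word_eq.relator[of _ "dihedral_relators m" "[]" "[]"] by (simp_all add: dihedral_relators_def)

lemma weq_inv_a: "[(gen_a, False)] \<approx> replicate (m - 1) letter_a"
proof -
  have "[(gen_a, False)] @ replicate m letter_a \<approx> [(gen_a, False)] @ []"
    by (rule word_eq_append[OF word_eq.refl weq_rel(1)])
  moreover have "replicate m letter_a = letter_a # replicate (m - 1) letter_a"
    using m by (cases m) auto
  moreover have "[(gen_a, False), letter_a] @ replicate (m - 1) letter_a \<approx> replicate (m - 1) letter_a"
    using word_eq.cancel[of _ "[]" gen_a False "replicate (m - 1) letter_a"] by simp
  ultimately show ?thesis by (auto intro: word_eq.trans word_eq.sym)
qed

lemma weq_inv_b: "[(gen_b, False)] \<approx> [letter_b]"
proof -
  have "[(gen_b, False)] @ [letter_b, letter_b] \<approx> [(gen_b, False)] @ []"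
    by (rule word_eq_append[OF word_eq.refl weq_rel(2)])
  moreover have "[(gen_b, False), letter_b] @ [letter_b] \<approx> [letter_b]"
    using word_eq.cancel[of _ "[]" gen_b False "[letter_b]"] by simp
  ultimately show ?thesis by (auto intro: word_eq.trans word_eq.sym)
qed

text \<open>
  The relator \<open>a b a b\<close> turns into the rule \<open>b a = a\<inverse> b\<close>; as only positive powers are kept, \<open>a\<inverse>\<close> is
  written \<open>a ^ (m - 1)\<close>.
\<close>

lemma weq_ba: "[letter_b, letter_a] \<approx> replicate (m - 1) letter_a @ [letter_b]"
proof -
  let ?r = "replicate (m - 1) letter_a"
  have a: "replicate m letter_a = ?r @ [letter_a]"
    using m by (cases m) (auto simp: replicate_append_same)
  have "replicate m letter_a @ [letter_b, letter_a] \<approx> [] @ [letter_b, letter_a]"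
    by (rule word_eq_append[OF weq_rel(1) word_eq.refl])
  then have 1: "[letter_b, letter_a] \<approx> ?r @ [letter_a, letter_b, letter_a]"
    unfolding a by (simp add: word_eq.sym)
  have "(?r @ [letter_a, letter_b, letter_a]) @ [letter_b, letter_b] \<approx> (?r @ [letter_a, letter_b, letter_a]) @ []"
    by (rule word_eq_append[OF word_eq.refl weq_rel(2)])
  then have 2: "?r @ [letter_a, letter_b, letter_a] \<approx> ?r @ [letter_a, letter_b, letter_a, letter_b] @ [letter_b]"
    by (simp add: word_eq.sym)
  have "?r @ [letter_a, letter_b, letter_a, letter_b] @ [letter_b] \<approx> ?r @ [] @ [letter_b]"
    by (rule word_eq_context[OF weq_rel(3)])
  then show ?thesis using 1 2 by (auto intro: word_eq.trans)
qed

lemma weq_b_pow_a: "letter_b # replicate i letter_a \<approx> replicate ((m - 1) * i) letter_a @ [letter_b]"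
proof (induction i)
  case 0
  show ?case by (simp add: word_eq.refl)
next
  case (Suc i)
  have "[letter_b, letter_a] @ replicate i letter_a \<approx> (replicate (m - 1) letter_a @ [letter_b]) @ replicate i letter_a"
    by (rule word_eq_append[OF weq_ba word_eq.refl])
  moreover have "replicate (m - 1) letter_a @ (letter_b # replicate i letter_a) \<approx>
      replicate (m - 1) letter_a @ (replicate ((m - 1) * i) letter_a @ [letter_b])"
    by (rule word_eq_append[OF word_eq.refl Suc])
  ultimately have "[letter_b, letter_a] @ replicate i letter_a \<approx>
      (replicate (m - 1) letter_a @ replicate ((m - 1) * i) letter_a) @ [letter_b]"
    by (auto intro: word_eq.trans)
  then show ?case by (simp add: replicate_add[symmetric])
qed

text \<open>
  Inverses are replaced by positive powers and every \<open>b\<close> is moved to the right of every \<open>a\<close>. The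
  exponents are only reduced afterwards.
\<close>

lemma weq_normal_form: "\<exists>i j. w \<approx> replicate i letter_a @ replicate j letter_b"
proof (induction w)
  case Nil
  show ?case by (intro exI[of _ 0]) (simp add: word_eq.refl)
next
  case (Cons x w)
  then obtain i j where ij: "w \<approx> replicate i letter_a @ replicate j letter_b" by blast
  have b: "\<exists>i j. letter_b # w \<approx> replicate i letter_a @ replicate j letter_b"
  proof -
    have "[letter_b] @ w \<approx> [letter_b] @ (replicate i letter_a @ replicate j letter_b)"
      by (rule word_eq_append[OF word_eq.refl ij])
    moreover have "(letter_b # replicate i letter_a) @ replicate j letter_b \<approx>
        (replicate ((m - 1) * i) letter_a @ [letter_b]) @ replicate j letter_b"
      by (rule word_eq_append[OF weq_b_pow_a word_eq.refl])
    ultimately have "letter_b # w \<approx> replicate ((m - 1) * i) letter_a @ replicate (Suc j) letter_b"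
      by (auto intro: word_eq.trans)
    then show ?thesis by blast
  qed
  obtain g e where x: "x = (g, e)" by (cases x)
  consider "x = letter_a" | "x = (gen_a, False)" | "x = letter_b" | "x = (gen_b, False)"
    by (cases g; cases e) (auto simp: x)
  then show ?case
  proof cases
    case 1
    have "[letter_a] @ w \<approx> [letter_a] @ (replicate i letter_a @ replicate j letter_b)"
      by (rule word_eq_append[OF word_eq.refl ij])
    then have "x # w \<approx> replicate (Suc i) letter_a @ replicate j letter_b" by (simp add: 1)
    then show ?thesis by blast
  next
    case 2
    have "[x] @ w \<approx> replicate (m - 1) letter_a @ (replicate i letter_a @ replicate j letter_b)"
      unfolding 2 by (rule word_eq_append[OF weq_inv_a ij])
    then have "x # w \<approx> replicate (m - 1 + i) letter_a @ replicate j letter_b" by (simp add: replicate_add)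
    then show ?thesis by blast
  next
    case 3
    then show ?thesis using b by simp
  next
    case 4
    have "[x] @ w \<approx> [letter_b] @ w"
      unfolding 4 by (rule word_eq_append[OF weq_inv_b word_eq.refl])
    then have "x # w \<approx> letter_b # w" by simp
    then show ?thesis using b word_eq.trans by blast
  qed
qed

lemma weq_replicate_mod:
  assumes "replicate k x \<approx> []" shows "replicate i x \<approx> replicate (i mod k) x"
proof -
  have "replicate (k * n + r) x \<approx> replicate r x" for n r
  proof (induction n)
    case 0
    show ?case by (simp add: word_eq.refl)
  next
    case (Suc n)
    have "replicate k x @ replicate (k * n + r) x \<approx> [] @ replicate r x"
      by (rule word_eq_append[OF assms Suc])
    then show ?case by (simp add: replicate_add[symmetric] add.assoc)
  qed
  from this[of "i div k" "i mod k"] show ?thesis by simp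
qed

lemma dihedral_carrier_subset:
  "carrier (dihedral_group (2 * m)) \<subseteq>
     (\<lambda>(i, j). word_class (dihedral_relators m) (replicate i letter_a @ replicate j letter_b)) ` ({..<m} \<times> {..<2})"
proof
  fix c assume "c \<in> carrier (dihedral_group (2 * m))"
  then obtain w where c: "c = word_class (dihedral_relators m) w"
    by (auto simp: dihedral_group_eq presented_group_def)
  obtain i j where ij: "w \<approx> replicate i letter_a @ replicate j letter_b" using weq_normal_form by blast
  have "replicate 2 letter_b \<approx> []" using weq_rel(2) by (simp add: numeral_2_eq_2)
  then have "replicate i letter_a @ replicate j letter_b \<approx> replicate (i mod m) letter_a @ replicate (j mod 2) letter_b"
    by (intro word_eq_append weq_replicate_mod weq_rel(1))
  then have "c = word_class (dihedral_relators m) (replicate (i mod m) letter_a @ replicate (j mod 2) letter_b)"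
    unfolding c word_class_eq_iff using ij by (blast intro: word_eq.trans)
  then show "c \<in> (\<lambda>(i, j). word_class (dihedral_relators m) (replicate i letter_a @ replicate j letter_b)) ` ({..<m} \<times> {..<2})"
    using m by (intro image_eqI[of _ _ "(i mod m, j mod 2)"]) auto
qed

text \<open>
  By the normal form the presented group has at most \<open>2 m\<close> elements. The values of words map it onto
  \<open>G\<close>, which has exactly \<open>2 m\<close>, so this homomorphism is bijective.
\<close>

lemma dihedral_group_bij:
  fixes G (structure)
  assumes "group G" and ab: "a \<in> carrier G" "b \<in> carrier G"
    and rel: "a [^] m = \<one>" "b \<otimes> b = \<one>" "a \<otimes> b \<otimes> (a \<otimes> b) = \<one>"
    and gen: "carrier G \<subseteq> {a [^] i \<otimes> b [^] j | (i::nat) (j::nat). True}" and card: "card (carrier G) = 2 * m"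
  shows "\<exists>f. bij_betw f (carrier (dihedral_group (2 * m))) (carrier G) \<and>
     (\<forall>x\<in>carrier (dihedral_group (2 * m)). \<forall>y\<in>carrier (dihedral_group (2 * m)).
        x \<otimes>\<^bsub>dihedral_group (2 * m)\<^esub> y \<in> carrier (dihedral_group (2 * m)) \<and>
        f (x \<otimes>\<^bsub>dihedral_group (2 * m)\<^esub> y) = f x \<otimes> f y)"
proof -
  interpret group G by fact
  define \<phi> where "\<phi> g = (case g of gen_a \<Rightarrow> a | gen_b \<Rightarrow> b)" for g
  have \<phi>: "\<phi> g \<in> carrier G" for g using ab by (cases g) (simp_all add: \<phi>_def)
  note wv = word_value_Nil[OF \<phi>] word_value_Cons[OF \<phi>] word_value_append[OF \<phi>]
  have \<phi>_simps: "\<phi> gen_a = a" "\<phi> gen_b = b" by (simp_all add: \<phi>_def)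
  have pow: "word_value \<phi> (replicate i letter_a) = a [^] i" "word_value \<phi> (replicate i letter_b) = b [^] i" for i
    by (induction i) (simp_all add: wv \<phi>_simps ab nat_pow_Suc2[symmetric])
  have rels: "word_value \<phi> r = \<one>" if "r \<in> dihedral_relators m" for r
    using that pow(1)[of m] rel ab
    by (auto simp: dihedral_relators_def wv \<phi>_simps m_assoc)
  let ?R = "dihedral_relators m" and ?D = "dihedral_group (2 * m)"
  define f where "f c = word_value \<phi> (SOME w. w \<in> c)" for c
  have f: "f (word_class ?R w) = word_value \<phi> w" for w
  proof -
    have "(SOME v. v \<in> word_class ?R w) \<in> word_class ?R w" by (rule someI[of "\<lambda>v. v \<in> word_class ?R w", OF mem_word_class])
    then show ?thesis
      unfolding f_def using word_value_word_eq[OF \<phi> _ rels, where u = w] by (simp add: word_class_def)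
  qed
  have carr: "carrier ?D = range (word_class ?R)"
    by (simp add: dihedral_group_eq presented_group_def)
  have surj: "f ` carrier ?D = carrier G"
  proof (intro equalityI subsetI)
    fix x assume "x \<in> f ` carrier ?D" then show "x \<in> carrier G" by (auto simp: carr f \<phi>)
  next
    fix x assume "x \<in> carrier G"
    then have "x \<in> {a [^] i \<otimes> b [^] j | (i::nat) (j::nat). True}" by (rule subsetD[OF gen])
    then obtain i j :: nat where "x = a [^] i \<otimes> b [^] j" by auto
    then have "x = f (word_class ?R (replicate i letter_a @ replicate j letter_b))"
      by (simp add: f wv pow)
    then show "x \<in> f ` carrier ?D" by (rule image_eqI) (simp add: carr)
  qed
  have fin: "finite (carrier ?D)" and le: "card (carrier ?D) \<le> 2 * m"
    using finite_subset[OF dihedral_carrier_subset] surj_card_le[OF _ dihedral_carrier_subset]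
    by (simp_all add: card_cartesian_product mult.commute)
  have "card (f ` carrier ?D) = card (carrier ?D)"
    using le card_image_le[OF fin, of f] by (simp add: surj card)
  then have "inj_on f (carrier ?D)" by (rule eq_card_imp_inj_on[OF fin])
  then have "bij_betw f (carrier ?D) (carrier G)" using surj by (simp add: bij_betw_def)
  moreover have "x \<otimes>\<^bsub>?D\<^esub> y \<in> carrier ?D \<and> f (x \<otimes>\<^bsub>?D\<^esub> y) = f x \<otimes> f y"
    if "x \<in> carrier ?D" "y \<in> carrier ?D" for x y
    using that unfolding carr by (auto simp: dihedral_group_eq presented_group_mult f wv)
  ultimately show ?thesis by blast
qed

end

section \<open>Roots of unity\<close>

lemma power_mod:
  fixes a :: "'r::monoid_mult"
  assumes "a ^ n = 1" shows "a ^ (i mod n) = a ^ i"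
proof -
  have "a ^ i = a ^ (n * (i div n) + i mod n)" by simp
  then show ?thesis unfolding power_add power_mult assms by simp
qed

lemma roots_of_unity:
  fixes \<zeta> :: "'a::Fields.field"
  assumes n: "n > 0" and \<zeta>: "\<zeta> ^ n = 1" "inj_on (\<lambda>i. \<zeta> ^ i) {..<n}"
  shows "{a. a ^ n = 1} = (\<lambda>i. \<zeta> ^ i) ` {..<n}" "card {a::'a. a ^ n = 1} = n"
proof -
  define p :: "'a poly" where "p = Polynomial.monom 1 n - 1"
  have "Polynomial.degree p \<le> n" unfolding p_def by (intro degree_diff_le degree_monom_le) simp
  moreover have "p \<noteq> 0"
  proof -
    have "poly p 0 = - 1" using n by (simp add: p_def poly_monom power_0_left)
    then show ?thesis by auto
  qed
  moreover have roots: "{a. poly p a = 0} = {a. a ^ n = 1}" by (simp add: p_def poly_monom)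
  ultimately have fin: "finite {a::'a. a ^ n = 1}" and le: "card {a::'a. a ^ n = 1} \<le> n"
    using poly_roots_finite[of p] card_poly_roots_bound[of p] by simp_all
  have "(\<zeta> ^ i) ^ n = (\<zeta> ^ n) ^ i" for i by (simp only: power_mult[symmetric] mult.commute)
  then have sub: "(\<lambda>i. \<zeta> ^ i) ` {..<n} \<subseteq> {a. a ^ n = 1}"
    using \<zeta>(1) by auto
  have "card ((\<lambda>i. \<zeta> ^ i) ` {..<n}) = n" using \<zeta>(2) by (simp add: card_image)
  then show "{a. a ^ n = 1} = (\<lambda>i. \<zeta> ^ i) ` {..<n}"
    using card_seteq[OF fin sub] le by simp
  then show "card {a::'a. a ^ n = 1} = n" using \<open>card ((\<lambda>i. \<zeta> ^ i) ` {..<n}) = n\<close> by simp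
qed

context galois_curve
begin

text \<open>
  The roots of \<open>T ^ q - T\<close> form a field, and there are \<open>q\<close> of them because its derivative is \<open>-1\<close>. The
  multiplicative group of a finite field is cyclic.
\<close>

lemma primitive_root: "\<exists>\<zeta>::'a. \<zeta> ^ (2 * m) = 1 \<and> inj_on (\<lambda>i. \<zeta> ^ i) {..<2 * m}"
proof -
  define F where "F = {x::'a. x ^ q = x}"
  have cardF: "card F = q"
  proof -
    define p :: "'a poly" where "p = Polynomial.monom 1 q - [:0, 1:]"
    have q1: "q > 1" using m by (simp add: q)
    have "Polynomial.degree p = q"
      unfolding p_def diff_conv_add_uminus using q1 by (subst degree_add_eq_left) (auto simp: degree_monom_eq)
    moreover have p': "pderiv p = [:- 1:]"
      by (simp add: p_def pderiv_diff pderiv_monom pderiv_pCons of_nat_q)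
    have p0: "p \<noteq> 0" using p' by auto
    have "Polynomial.order b p = 1" if "poly p b = 0" for b
    proof -
      have "Polynomial.order b (pderiv p) = 0" unfolding p' by (rule order_0I) simp
      then have "Polynomial.order b p \<le> 1" using order_le_Suc_order_pderiv[of p b] p' by simp
      then show ?thesis using order_gt_0_iff[OF p0, of b] that by simp
    qed
    then have "Polynomial.degree p = card {b. poly p b = 0}"
      using degree_eq_sum_order[OF p0] by simp
    moreover have "{b. poly p b = 0} = F" by (simp add: p_def F_def poly_monom)
    ultimately show ?thesis by simp
  qed
  then have finF: "finite F" using q0 card_gt_0_iff by metis
  define R :: "'a ring" where "R = \<lparr>carrier = F, monoid.mult = (*), one = 1, zero = 0, add = (+)\<rparr>"
  have F: "0 \<in> F" "1 \<in> F" "\<And>x y. x \<in> F \<Longrightarrow> y \<in> F \<Longrightarrow> x + y \<in> F" "\<And>x y. x \<in> F \<Longrightarrow> y \<in> F \<Longrightarrow> x * y \<in> F"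
    "\<And>x. x \<in> F \<Longrightarrow> - x \<in> F" "\<And>x. x \<in> F \<Longrightarrow> inverse x \<in> F"
    using q0 by (auto simp: F_def frobenius power_mult_distrib neg_q power_inverse power_0_left)
  have "abelian_group R"
  proof (rule abelian_groupI)
    fix x assume "x \<in> carrier R"
    then show "\<exists>y\<in>carrier R. y \<oplus>\<^bsub>R\<^esub> x = \<zero>\<^bsub>R\<^esub>"
      by (intro bexI[of _ "- x"]) (simp_all add: R_def F)
  qed (simp_all add: R_def F algebra_simps)
  moreover have "Group.comm_monoid R"
    by (rule comm_monoidI) (simp_all add: R_def F algebra_simps)
  ultimately have "cring R"
    by (rule cringI) (simp_all add: R_def algebra_simps)
  then have "field R"
  proof (rule cring.cring_fieldI2)
    fix x assume "x \<in> carrier R" "x \<noteq> \<zero>\<^bsub>R\<^esub>"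
    then show "\<exists>y\<in>carrier R. x \<otimes>\<^bsub>R\<^esub> y = \<one>\<^bsub>R\<^esub>"
      by (intro bexI[of _ "inverse x"]) (simp_all add: R_def F)
  qed (simp add: R_def)
  then interpret R: field R .
  obtain a where a: "a \<in> carrier (Multiplicative_Group.mult_of R)"
      "carrier (Multiplicative_Group.mult_of R) = {a [^]\<^bsub>R\<^esub> i | i::nat. i \<in> UNIV}"
  proof -
    have "finite (carrier R)" using finF by (simp add: R_def)
    from R.finite_field_mult_group_has_gen[OF this] show ?thesis by (elim bexE) (rule that)
  qed
  have pow: "a [^]\<^bsub>R\<^esub> (i::nat) = a ^ i" for i
    by (induction i) (simp_all add: R_def mult.commute)
  have carr: "carrier (Multiplicative_Group.mult_of R) = F - {0}" by (simp add: R_def)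
  have gen: "F - {0} = range (\<lambda>i::nat. a ^ i)" using a(2) unfolding carr pow by (simp add: image_def)
  have "a ^ q = a" "a \<noteq> 0" using a(1) unfolding carr by (auto simp: F_def)
  then have one: "a ^ (2 * m) = 1" by (simp add: q)
  have "a ^ i \<in> (\<lambda>i. a ^ i) ` {..<2 * m}" for i
  proof -
    have "a ^ i = a ^ (i mod (2 * m))" by (rule power_mod[OF one, symmetric])
    then show ?thesis using m by auto
  qed
  then have "(\<lambda>i. a ^ i) ` {..<2 * m} = F - {0}" unfolding gen by auto
  moreover have "card (F - {0}) = 2 * m" using cardF finF F(1) by (simp add: q)
  ultimately have "inj_on (\<lambda>i. a ^ i) {..<2 * m}" by (intro eq_card_imp_inj_on) simp_all
  then show ?thesis using one by blast
qed

end

section \<open>The two Galois points\<close>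

lemma transcendental_scale: "a \<noteq> 0 \<Longrightarrow> transcendental_fract (fconst a * fvar)"
  and transcendental_scale_inverse: "a \<noteq> 0 \<Longrightarrow> transcendental_fract (fconst a * inverse fvar)"
  for a :: "'a::alg_closed_field"
proof -
  assume a: "a \<noteq> 0"
  have "fconst a * fvar = Fract [:0, a:] 1" by (simp add: fconst_def fvar_def to_fract_def)
  then show "transcendental_fract (fconst a * fvar)" using a by (auto intro: transcendental_Fract)
  show "transcendental_fract (fconst a * inverse fvar)"
  proof (rule transcendental_if_nonconstant, rule)
    assume "fconst a * inverse fvar \<in> range fconst"
    then obtain c where "Fract [:a:] [:0, 1:] = Fract [:c:] 1"
      by (auto simp: fconst_def fvar_def to_fract_def)
    then have "[:a:] = [:0, c:]" by (simp add: eq_fract)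
    then show False using a by simp
  qed
qed

lemma fvar_nonzero [simp]: "fvar \<noteq> 0"
  by (simp add: fvar_def)

lemma fsubst_scale:
  fixes a :: "'a::alg_closed_field"
  assumes "transcendental_fract y"
  shows "fsubst y (fconst a * fvar) = fconst a * y" "fsubst y (fconst a * inverse fvar) = fconst a * inverse y"
  using assms by (simp_all add: hom_mult[OF hom_fsubst] hom_inverse[OF hom_fsubst])

context galois_curve
begin

text \<open>
  It suffices to know the projection in one chart together with a group of substitutions of the same
  order as its degree.
\<close>

lemma galois_at:
  assumes chart: "curve_chart C x y z A B e" and S: "substitution_group \<Sigma> \<pi> N M"
    and P: "forms_through P l0 m0" and nz: "ev_poly x y z m0 \<noteq> 0"
    and \<pi>: "\<pi> = Fract (ev_poly x y z l0) (ev_poly x y z m0)"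
  shows "galois_point C P"
    and "\<And>f. bij_betw f (carrier H) \<Sigma> \<Longrightarrow>
      (\<And>a b. a \<in> carrier H \<Longrightarrow> b \<in> carrier H \<Longrightarrow> a \<otimes>\<^bsub>H\<^esub> b \<in> carrier H \<and> f (a \<otimes>\<^bsub>H\<^esub> b) = fsubst (f a) (f b)) \<Longrightarrow>
      galois_group_at C P \<cong> H"
proof -
  interpret S: substitution_group \<Sigma> \<pi> N M by fact
  interpret K: curve_chart C x y z A B e by fact
  interpret F: field_model "function_field C" K.model by (rule K.field_model)
  interpret F: modelled_substitution_group "function_field C" K.model \<Sigma> \<pi> N M ..
  have eq: "projection_subfield C P = K.model ` range (fsubst \<pi>)"
    by (rule K.projection_subfield_eq[OF P nz \<pi> S.\<pi>(2)])
  have "P \<in> projective_space" using P by (auto simp: forms_through_def projection_forms_def)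
  then show "galois_point C P" using F.galois by (simp add: galois_point_def eq)
  fix f
  assume "bij_betw f (carrier H) \<Sigma>"
    "\<And>a b. a \<in> carrier H \<Longrightarrow> b \<in> carrier H \<Longrightarrow> a \<otimes>\<^bsub>H\<^esub> b \<in> carrier H \<and> f (a \<otimes>\<^bsub>H\<^esub> b) = fsubst (f a) (f b)"
  then show "galois_group_at C P \<cong> H"
    unfolding galois_group_at_def eq by (rule F.galois_group_iso)
qed

lemma inj_scale: "inj_on (\<lambda>a::'a. fconst a * fvar) S" "inj_on (\<lambda>a::'a. fconst a * inverse fvar) S"
  by (auto intro!: inj_onI)

subsection \<open>The cyclic point\<close>

text \<open>
  By additivity of the \<open>q\<close>-th power, \<open>(T + 1) ^ q - (T + 1) = T ^ q - T\<close>. So in the chart \<open>T = s / t - 1\<close> the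
  projection is \<open>Z / Y = T ^ (2 m) - 1\<close>, and its group consists of the scalings by roots of unity.
\<close>

lemma galois_P2:
  shows "galois_point C (point (vector [1, 0, 0]))"
    and "galois_group_at C (point (vector [1, 0, 0])) \<cong> integer_mod_group (q - 1)"
proof -
  obtain \<zeta> :: 'a where \<zeta>: "\<zeta> ^ (2 * m) = 1" "inj_on (\<lambda>i. \<zeta> ^ i) {..<2 * m}" using primitive_root by blast
  have m0: "2 * m > 0" using m by simp
  note U = roots_of_unity[OF m0 \<zeta>]
  define \<Sigma> where "\<Sigma> = (\<lambda>a. fconst a * fvar) ` {a::'a. a ^ (2 * m) = 1}"
  define \<pi> :: "'a poly fract" where "\<pi> = Fract ([:0, 1:] ^ (2 * m) - 1) 1"
  have \<pi>_fvar: "\<pi> = fvar ^ (2 * m) - 1"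
    by (simp add: \<pi>_def fvar_def Fract_conv_to_fract hom_power[OF hom_to_fract])
  have a0: "a \<noteq> 0" if "a ^ (2 * m) = 1" for a :: 'a using that m0 by (auto simp: power_0_left)
  have tr: "transcendental_fract y" if "y \<in> \<Sigma>" for y
    using that a0 by (auto simp: \<Sigma>_def intro: transcendental_scale)
  have comp: "fsubst (fconst a * fvar) (fconst b * fvar) = fconst (a * b) * fvar" if "a \<noteq> 0" for a b :: 'a
    unfolding fsubst_scale[OF transcendental_scale[OF that]] hom_mult[OF hom_fconst] by (simp only: mult_ac)
  have cardS: "card \<Sigma> = 2 * m" unfolding \<Sigma>_def by (simp add: card_image[OF inj_scale(1)] U(2))
  have deg: "Polynomial.degree ([:0, 1:] ^ (2 * m) - 1 :: 'a poly) = 2 * m"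
    unfolding diff_conv_add_uminus using m0 by (subst degree_add_eq_left) (auto simp: degree_power_eq)
  have S: "substitution_group \<Sigma> \<pi> ([:0, 1:] ^ (2 * m) - 1) 1"
  proof
    show "finite \<Sigma>" using cardS m0 card_gt_0_iff by metis
    show "fvar \<in> \<Sigma>" unfolding \<Sigma>_def by (rule image_eqI[of _ _ 1]) simp_all
    show "fsubst y z \<in> \<Sigma>" if "y \<in> \<Sigma>" "z \<in> \<Sigma>" for y z
      using that a0 unfolding \<Sigma>_def by (auto simp: comp power_mult_distrib)
    show "fsubst y \<pi> = \<pi>" if y: "y \<in> \<Sigma>" for y
    proof -
      obtain a where a: "y = fconst a * fvar" "a ^ (2 * m) = 1" using y by (auto simp: \<Sigma>_def)
      note h = hom_fsubst[OF tr[OF y]]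
      have "fsubst y \<pi> = y ^ (2 * m) - 1"
        by (simp add: \<pi>_fvar hom_diff[OF h] hom_power[OF h] hom_1[OF h] tr[OF y])
      also have "y ^ (2 * m) = fconst (a ^ (2 * m)) * fvar ^ (2 * m)"
        by (simp add: a(1) power_mult_distrib hom_power[OF hom_fconst])
      finally show ?thesis by (simp add: a(2) \<pi>_fvar)
    qed
    show "transcendental_fract \<pi>" unfolding \<pi>_def using deg m0 by (intro transcendental_Fract) auto
  qed (use tr deg cardS m0 in \<open>auto simp: \<pi>_def\<close>)
  let ?pull = "ev_poly (pX m [:1, 1:] 1) (pY m [:1, 1:] 1) (pZ m [:1, 1 :: 'a:] 1)"
  have pY: "?pull varY = [:0, 1:]"
  proof -
    have "[:1, 1 :: 'a:] - 1 = [:0, 1:]" by (simp add: one_pCons)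
    then show ?thesis by (simp add: ev_varY[OF hom_const_poly] pY_def)
  qed
  have pZ: "?pull varZ = [:0, 1:] ^ q - [:0, 1:]"
  proof -
    have "[:1, 1 :: 'a:] = 1 + [:0, 1:]" by (simp add: one_pCons)
    then have "[:1, 1 :: 'a:] ^ q = 1 + [:0, 1:] ^ q" by (simp add: frobenius_poly)
    moreover have "?pull varZ = [:1, 1:] ^ q - [:1, 1:]"
      by (simp only: ev_varZ[OF hom_const_poly] pZ_def q_def power_one mult_1_right)
    ultimately show ?thesis by (simp add: one_pCons)
  qed
  have P: "forms_through (point (vector [1, 0, 0])) (varZ :: 'a poly3) varY"
    using forms_through_affine[of "0::'a" 0] by (simp add: forms_through_swap)
  have \<pi>: "\<pi> = Fract (?pull varZ) (?pull varY)"
    unfolding pY pZ \<pi>_def by (subst eq_fract) (simp_all add: q algebra_simps)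
  note G = galois_at[OF chart_r S P _ \<pi>]
  have nz: "?pull varY \<noteq> 0" by (simp add: pY)
  show "galois_point C (point (vector [1, 0, 0]))" by (rule G(1)[OF nz])
  define f where "f i = fconst (\<zeta> ^ nat i) * fvar" for i
  have q1: "q - 1 = 2 * m" by (simp add: q)
  have "bij_betw f {0..<int (2 * m)} \<Sigma>"
  proof -
    have "bij_betw nat {0..<int (2 * m)} {..<2 * m}"
      by (rule bij_betw_byWitness[of _ int]) auto
    moreover have "bij_betw (\<lambda>i. \<zeta> ^ i) {..<2 * m} {a. a ^ (2 * m) = 1}"
      using \<zeta>(2) U(1) by (simp add: bij_betw_def)
    moreover have "bij_betw (\<lambda>a. fconst a * fvar) {a. a ^ (2 * m) = 1} \<Sigma>"
      by (simp add: bij_betw_def \<Sigma>_def inj_scale)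
    ultimately have "bij_betw ((\<lambda>a. fconst a * fvar) \<circ> ((\<lambda>i. \<zeta> ^ i) \<circ> nat)) {0..<int (2 * m)} \<Sigma>"
      by (intro bij_betw_trans)
    moreover have "f = (\<lambda>a. fconst a * fvar) \<circ> ((\<lambda>i. \<zeta> ^ i) \<circ> nat)"
      by (rule ext) (simp add: f_def)
    ultimately show ?thesis by (simp only:)
  qed
  then have bij: "bij_betw f (carrier (integer_mod_group (2 * m))) \<Sigma>"
    using m0 by (simp add: carrier_integer_mod_group)
  have "galois_group_at C (point (vector [1, 0, 0])) \<cong> integer_mod_group (2 * m)"
  proof (rule G(2)[OF nz bij])
    fix a b assume "a \<in> carrier (integer_mod_group (2 * m))" "b \<in> carrier (integer_mod_group (2 * m))"
    then have ab: "0 \<le> a" "a < int (2 * m)" "0 \<le> b" "b < int (2 * m)"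
      using m0 by (simp_all add: carrier_integer_mod_group)
    have "\<zeta> \<noteq> 0" using \<zeta>(1) by (rule a0)
    then have "fsubst (f a) (f b) = fconst (\<zeta> ^ (nat a + nat b)) * fvar"
      by (simp add: f_def comp power_add)
    also have "\<zeta> ^ (nat a + nat b) = \<zeta> ^ ((nat a + nat b) mod (2 * m))" by (rule power_mod[OF \<zeta>(1), symmetric])
    also have "(nat a + nat b) mod (2 * m) = nat ((a + b) mod int (2 * m))"
      using ab by (simp add: nat_mod_distrib nat_add_distrib del: of_nat_mult)
    finally show "a \<otimes>\<^bsub>integer_mod_group (2 * m)\<^esub> b \<in> carrier (integer_mod_group (2 * m)) \<and>
        f (a \<otimes>\<^bsub>integer_mod_group (2 * m)\<^esub> b) = fsubst (f a) (f b)"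
      using m0 by (simp add: f_def carrier_integer_mod_group)
  qed
  then show "galois_group_at C (point (vector [1, 0, 0])) \<cong> integer_mod_group (q - 1)" by (simp only: q1)
qed

subsection \<open>The dihedral point\<close>

text \<open>
  In the chart \<open>T = t / s\<close> the projection is \<open>Z / X = T ^ (- m) - T ^ m\<close>. If \<open>\<zeta>\<close> is a primitive root of unity of
  order \<open>2 m\<close>, then \<open>\<zeta> ^ m = -1\<close>, the rotations are the scalings by powers of \<open>\<zeta> ^ 2\<close>, and \<open>T \<mapsto> \<zeta> / T\<close> is
  a reflection.
\<close>

lemma galois_P1:
  shows "galois_point C (point (vector [0, 1, 0]))"
    and "galois_group_at C (point (vector [0, 1, 0])) \<cong> dihedral_group (q - 1)"
proof -
  obtain \<zeta> :: 'a where \<zeta>: "\<zeta> ^ (2 * m) = 1" "inj_on (\<lambda>i. \<zeta> ^ i) {..<2 * m}" using primitive_root by blast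
  have m0: "m > 0" using m by simp
  have \<zeta>0: "\<zeta> \<noteq> 0" using \<zeta>(1) m0 by (auto simp: power_0_left)
  have \<zeta>m: "\<zeta> ^ m = - 1"
  proof -
    have "(\<zeta> ^ m)\<^sup>2 = 1" using \<zeta>(1) by (simp add: power_mult[symmetric] mult.commute)
    then have "\<zeta> ^ m = 1 \<or> \<zeta> ^ m = - 1" by (simp add: power2_eq_1_iff)
    moreover have "\<zeta> ^ m \<noteq> \<zeta> ^ 0" using inj_onD[OF \<zeta>(2), of m 0] m0 by auto
    ultimately show ?thesis by simp
  qed
  have "(\<zeta>\<^sup>2) ^ m = 1" using \<zeta>(1) by (simp add: power_mult)
  moreover have "inj_on (\<lambda>i. (\<zeta>\<^sup>2) ^ i) {..<m}"
  proof (rule inj_onI)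
    fix i j assume ij: "i \<in> {..<m}" "j \<in> {..<m}" "(\<zeta>\<^sup>2) ^ i = (\<zeta>\<^sup>2) ^ j"
    then have "\<zeta> ^ (2 * i) = \<zeta> ^ (2 * j)" by (simp only: power_mult)
    then have "2 * i = 2 * j" by (rule inj_onD[OF \<zeta>(2)]) (use ij in auto)
    then show "i = j" by simp
  qed
  ultimately have U: "{a. a ^ m = 1} = (\<lambda>i. (\<zeta>\<^sup>2) ^ i) ` {..<m}" "card {a::'a. a ^ m = 1} = m"
    using roots_of_unity[OF m0, of "\<zeta>\<^sup>2"] by blast+
  have W: "{a::'a. a ^ m = - 1} = (\<lambda>a. a * \<zeta>) ` {a. a ^ m = 1}"
  proof (intro equalityI subsetI)
    fix a :: 'a assume a: "a \<in> {a. a ^ m = - 1}"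
    then have "(a / \<zeta>) ^ m = 1" by (simp add: power_divide \<zeta>m)
    then show "a \<in> (\<lambda>a. a * \<zeta>) ` {a. a ^ m = 1}" using \<zeta>0 by (intro image_eqI[of _ _ "a / \<zeta>"]) auto
  qed (auto simp: power_mult_distrib \<zeta>m)
  have cardW: "card {a::'a. a ^ m = - 1} = m"
    unfolding W using U(2) \<zeta>0 by (subst card_image) (auto intro: inj_onI)
  define \<Sigma> where "\<Sigma> = (\<lambda>a. fconst a * fvar) ` {a::'a. a ^ m = 1} \<union> (\<lambda>a. fconst a * inverse fvar) ` {a. a ^ m = - 1}"
  define N :: "'a poly" where "N = 1 - [:0, 1:] ^ (2 * m)"
  define M :: "'a poly" where "M = [:0, 1:] ^ m"
  define \<pi> where "\<pi> = Fract N M"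
  have \<pi>_fvar: "\<pi> = (1 - fvar ^ (2 * m)) / fvar ^ m"
    by (simp add: \<pi>_def N_def M_def fvar_def Fract_conv_to_fract hom_power[OF hom_to_fract])
  have a0: "a \<noteq> 0" if "a ^ m = 1 \<or> a ^ m = - 1" for a :: 'a using that m0 by (auto simp: power_0_left)
  have tr: "transcendental_fract y" if "y \<in> \<Sigma>" for y
    using that a0 by (auto simp: \<Sigma>_def intro: transcendental_scale transcendental_scale_inverse)
  have comp:
    "fsubst (fconst a * fvar) (fconst b * fvar) = fconst (a * b) * fvar"
    "fsubst (fconst a * fvar) (fconst b * inverse fvar) = fconst (b / a) * inverse fvar"
    "fsubst (fconst a * inverse fvar) (fconst b * fvar) = fconst (a * b) * inverse fvar"
    "fsubst (fconst a * inverse fvar) (fconst b * inverse fvar) = fconst (b / a) * fvar" if "a \<noteq> 0" for a b :: 'a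
    using that unfolding fsubst_scale[OF transcendental_scale[OF that]] fsubst_scale[OF transcendental_scale_inverse[OF that]]
      hom_mult[OF hom_fconst] hom_divide[OF hom_fconst] by (simp_all add: field_simps)
  have disj: "(\<lambda>a. fconst a * fvar) ` {a::'a. a ^ m = 1} \<inter> (\<lambda>a. fconst a * inverse fvar) ` {a. a ^ m = - 1} = {}"
  proof (rule ccontr)
    assume "\<not> ?thesis"
    then obtain a b :: 'a where ab: "fconst a * fvar = fconst b * inverse fvar" "a \<noteq> 0" using a0 by blast
    then have "fconst a * fvar * fvar = fconst b" by simp
    then have "to_fract [:0, 0, a:] = to_fract [:b:]" by (simp add: fconst_def fvar_def flip: to_fract_mult)
    then show False using ab(2) by simp
  qed
  have finU: "finite {a::'a. a ^ m = 1}" "finite {a::'a. a ^ m = - 1}"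
    using U(2) cardW m0 card_gt_0_iff by metis+
  have cardS: "card \<Sigma> = 2 * m"
    unfolding \<Sigma>_def using finU disj by (simp add: card_Un_disjoint card_image[OF inj_scale(1)] card_image[OF inj_scale(2)] U(2) cardW)
  have degN: "Polynomial.degree N = 2 * m"
  proof -
    have "Polynomial.degree N = Polynomial.degree (- ([:0, 1:] ^ (2 * m)) + 1 :: 'a poly)" by (simp add: N_def)
    also have "\<dots> = 2 * m" using m0 by (subst degree_add_eq_left) (auto simp: degree_power_eq)
    finally show ?thesis .
  qed
  have degM: "Polynomial.degree M = m" unfolding M_def by (rule degree_T)
  have M0: "M \<noteq> 0" by (simp add: M_def)
  have S: "substitution_group \<Sigma> \<pi> N M"
  proof
    show "finite \<Sigma>" using finU by (simp add: \<Sigma>_def)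
    show "fvar \<in> \<Sigma>" unfolding \<Sigma>_def by (rule UnI1, rule image_eqI[of _ _ 1]) simp_all
    show "fsubst y z \<in> \<Sigma>" if "y \<in> \<Sigma>" "z \<in> \<Sigma>" for y z
      using that a0 unfolding \<Sigma>_def by (auto simp: comp power_mult_distrib power_divide)
    show "fsubst y \<pi> = \<pi>" if y: "y \<in> \<Sigma>" for y
    proof -
      note h = hom_fsubst[OF tr[OF y]]
      have e1: "fsubst y \<pi> = (1 - (y ^ m)\<^sup>2) / y ^ m"
        by (simp add: \<pi>_fvar hom_divide[OF h] hom_diff[OF h] hom_power[OF h] hom_1[OF h] tr[OF y] power_mult mult.commute[of 2 m])
      have e2: "\<pi> = (1 - (fvar ^ m)\<^sup>2) / fvar ^ m"
        by (simp add: \<pi>_fvar power_mult mult.commute[of 2 m])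
      consider a where "y = fconst a * fvar" "a ^ m = 1" | a where "y = fconst a * inverse fvar" "a ^ m = - 1"
        using y by (auto simp: \<Sigma>_def)
      then show ?thesis
      proof cases
        case 1
        have "y ^ m = fconst (a ^ m) * fvar ^ m" by (simp add: 1(1) power_mult_distrib hom_power[OF hom_fconst])
        then have ym: "y ^ m = fvar ^ m" by (simp add: 1(2))
        show ?thesis unfolding e1 ym by (rule e2[symmetric])
      next
        case 2
        have "y ^ m = fconst (a ^ m) * inverse (fvar ^ m)"
          by (simp add: 2(1) power_mult_distrib hom_power[OF hom_fconst] power_inverse)
        then have ym: "y ^ m = - inverse (fvar ^ m)" by (simp add: 2(2) hom_uminus[OF hom_fconst])
        show ?thesis unfolding e1 ym unfolding e2 by (simp add: field_simps power2_eq_square)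
      qed
    qed
    show "transcendental_fract \<pi>" unfolding \<pi>_def using degN degM M0 m0 by (intro transcendental_Fract) auto
  qed (use tr degN degM cardS m0 M0 in \<open>auto simp: \<pi>_def\<close>)
  let ?T = "[:0, 1:] :: 'a poly"
  let ?pull = "ev_poly (pX m 1 ?T) (pY m 1 ?T) (pZ m 1 ?T)"
  have \<pi>: "\<pi> = Fract (?pull varZ) (?pull varX)"
    by (simp add: \<pi>_def N_def M_def ev_varZ[OF hom_const_poly] ev_varX[OF hom_const_poly] pX_def pZ_def)
  have nz: "?pull varX \<noteq> 0" by (simp add: ev_varX[OF hom_const_poly] pX_def)
  note P = forms_through_Y[unfolded forms_through_swap[of _ varX varZ]]
  note G = galois_at[OF chart_v S P nz \<pi>]
  show "galois_point C (point (vector [0, 1, 0]))" by (rule G(1))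
  let ?G = "\<lparr>carrier = \<Sigma>, monoid.mult = fsubst, one = fvar\<rparr>"
  interpret grp: group ?G by (rule substitution_group.group_substitutions[OF S])
  define a where "a = fconst (\<zeta>\<^sup>2) * fvar"
  define b where "b = fconst \<zeta> * inverse fvar"
  have ab: "a \<in> \<Sigma>" "b \<in> \<Sigma>"
    using \<zeta>m \<open>(\<zeta>\<^sup>2) ^ m = 1\<close> by (auto simp: \<Sigma>_def a_def b_def)
  have apow: "a [^]\<^bsub>?G\<^esub> (i::nat) = fconst ((\<zeta>\<^sup>2) ^ i) * fvar" for i
  proof (induction i)
    case (Suc i)
    then show ?case using \<zeta>0 by (simp add: comp a_def power_Suc2 del: power_Suc)
  qed simp
  have bpow: "b [^]\<^bsub>?G\<^esub> (0::nat) = fvar" "b [^]\<^bsub>?G\<^esub> (1::nat) = b"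
    using grp.nat_pow_eone[of b] ab by simp_all
  have r1: "a [^]\<^bsub>?G\<^esub> m = \<one>\<^bsub>?G\<^esub>" using \<open>(\<zeta>\<^sup>2) ^ m = 1\<close> by (simp add: apow)
  have r2: "b \<otimes>\<^bsub>?G\<^esub> b = \<one>\<^bsub>?G\<^esub>" using \<zeta>0 by (simp add: b_def comp)
  have r3: "a \<otimes>\<^bsub>?G\<^esub> b \<otimes>\<^bsub>?G\<^esub> (a \<otimes>\<^bsub>?G\<^esub> b) = \<one>\<^bsub>?G\<^esub>" using \<zeta>0 by (simp add: a_def b_def comp)
  have r4: "carrier ?G \<subseteq> {a [^]\<^bsub>?G\<^esub> i \<otimes>\<^bsub>?G\<^esub> b [^]\<^bsub>?G\<^esub> j | (i::nat) (j::nat). True}"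
    proof
      fix y assume "y \<in> carrier ?G"
      then consider c where "y = fconst c * fvar" "c ^ m = 1" | c where "y = fconst c * inverse fvar" "c ^ m = - 1"
        by (auto simp: \<Sigma>_def)
      then show "y \<in> {a [^]\<^bsub>?G\<^esub> i \<otimes>\<^bsub>?G\<^esub> b [^]\<^bsub>?G\<^esub> j | (i::nat) (j::nat). True}"
      proof cases
        case 1
        then obtain i where "c = (\<zeta>\<^sup>2) ^ i" using U(1) by blast
        then have "y = a [^]\<^bsub>?G\<^esub> i" using 1 by (simp add: apow)
        then have "y = a [^]\<^bsub>?G\<^esub> i \<otimes>\<^bsub>?G\<^esub> b [^]\<^bsub>?G\<^esub> (0::nat)"
          using grp.r_one[OF grp.nat_pow_closed[of a i]] ab by simp
        then show ?thesis by blast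
      next
        case 2
        have "(\<zeta> / c) ^ m = 1" using 2(2) by (simp add: power_divide \<zeta>m)
        then obtain i where i: "\<zeta> / c = (\<zeta>\<^sup>2) ^ i" using U(1) by blast
        have c0: "c \<noteq> 0" using a0 2(2) by blast
        have "a [^]\<^bsub>?G\<^esub> i \<otimes>\<^bsub>?G\<^esub> b [^]\<^bsub>?G\<^esub> (1::nat) = fsubst (fconst (\<zeta> / c) * fvar) b"
          unfolding bpow apow i by simp
        also have "\<dots> = y" using \<zeta>0 c0 by (simp add: b_def comp 2(1))
        finally show ?thesis by blast
      qed
    qed
  have r5: "card (carrier ?G) = 2 * m" by (simp add: cardS)
  have ab': "a \<in> carrier ?G" "b \<in> carrier ?G" using ab by simp_all
  obtain f where f: "bij_betw f (carrier (dihedral_group (2 * m))) \<Sigma>"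
    "\<And>x y. x \<in> carrier (dihedral_group (2 * m)) \<Longrightarrow> y \<in> carrier (dihedral_group (2 * m)) \<Longrightarrow>
        x \<otimes>\<^bsub>dihedral_group (2 * m)\<^esub> y \<in> carrier (dihedral_group (2 * m)) \<and>
        f (x \<otimes>\<^bsub>dihedral_group (2 * m)\<^esub> y) = fsubst (f x) (f y)"
    using dihedral_group_bij[OF m0 grp.is_group ab' r1 r2 r3 r4 r5] by auto
  have "galois_group_at C (point (vector [0, 1, 0])) \<cong> dihedral_group (2 * m)"
    by (rule G(2)[OF f])
  then show "galois_group_at C (point (vector [0, 1, 0])) \<cong> dihedral_group (q - 1)" by (simp add: q)
qed

end

section \<open>The inner Galois points\<close>

theorem theorem1:
  fixes p q :: nat
    and C1 :: "('a::alg_closed_field ^ 3) set set"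
    and P1 P2 :: "('a ^ 3) set"
  assumes "CHAR('a) = p" and "p \<ge> 3"
    and "\<exists>e. q = p ^ e" and "q \<ge> 5"
    and "C1 = phi1 q ` projective_space"
    and "P1 = point (vector [0, 1, 0])"
    and "P2 = point (vector [1, 0, 0])"
  shows "irreducible_plane_curve q C1 \<and>
    (P1 = phi1 q (point (vector [0, 1])) \<and> inner_galois_point C1 P1 \<and>
       galois_group_at C1 P1 \<cong> dihedral_group (q - 1)) \<and>
    (P2 = phi1 q (point (vector [1, 1])) \<and> inner_galois_point C1 P2 \<and>
       galois_group_at C1 P2 \<cong> integer_mod_group (q - 1)) \<and>
    card {P. inner_galois_point C1 P} = 2"
proof -
  have prime: "Factorial_Ring.prime CHAR('a)"
    using prime_CHAR_semidom[where 'a = 'a] assms(1,2) by simp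
  then have "odd q"
    using assms(1-3) prime_odd_nat by auto
  then obtain m where q: "q = 2 * m + 1" by (elim oddE)
  interpret galois_curve q m C1
    using assms prime q by unfold_locales auto
  have m0: "m > 0" using m by simp
  have "phi 0 1 = - 1 *s vector [0, 1, 0]"
    using m0 by (simp add: phi_def pX_def pY_def pZ_def vec3_smult power_0_left)
  then have 1: "P1 = phi1 q (point (vector [0, 1]))"
    using point_smult[of "vector [0, 1, 0] :: 'a ^ 3" "- 1"] by (simp add: phi1_point assms(6) vec3_nonzero)
  have "phi 1 1 = vector [1, 0, 0]"
    by (simp add: phi_def pX_def pY_def pZ_def)
  then have 2: "P2 = phi1 q (point (vector [1, 1]))" by (simp add: phi1_point assms(7))
  have inner: "inner_galois_point C1 P1" "inner_galois_point C1 P2"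
    using galois_P1(1) galois_P2(1) smooth_P1 smooth_P2 by (simp_all add: inner_galois_point_def assms(6,7))
  have "P1 \<noteq> P2"
  proof
    assume "P1 = P2"
    then have "vector [0, 1, 0] \<in> point (vector [1, 0, 0] :: 'a ^ 3)"
      using mem_point[of "vector [0, 1, 0] :: 'a ^ 3"] by (simp add: assms(6,7) vec3_nonzero)
    then obtain c :: 'a where "vector [0, 1, 0] = c *s (vector [1, 0, 0] :: 'a ^ 3)"
      by (auto simp: point_eq vec3_nonzero)
    then show False by (simp add: vec3_smult vec_eq_iff forall_3)
  qed
  moreover have "{P. inner_galois_point C1 P} = {P1, P2}"
    using inner galois_points_on_C by (auto simp: inner_galois_point_def smooth_point_def assms(6,7))
  ultimately have "card {P. inner_galois_point C1 P} = 2" by simp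
  then show ?thesis
    using defining_form_C 1 2 inner galois_P1(2) galois_P2(2) by (auto simp: irreducible_plane_curve_def assms(6,7))
qed

end
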